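(* Let $q\in\{0,\dots,n-1\}$, let $V$ be an open set in $\mathbb{R}^n$ and let $\Omega_V:=\{z\in\mathbb{C}^n:(\ln|z_1|,\dots,\ln|z_n|)\in V\}$. Then $V$ is a real $q$-convex set in $\mathbb{R}^n$ if and only if $\Omega_V$ is $q$-pseudoconvex in $\mathbb{C}^n$.
   Context: Points of $\Omega_V$ have all coordinates nonzero. $d_2(x,\partial\omega)=\inf\{\|x-y\|_2:y\in\partial\omega\}$ is the Euclidean boundary distance, set to $+\infty$ if $\partial\omega=\emptyset$ (and $-\ln(+\infty)=-\infty$); similarly $d_2(z,\partial\Omega)$ in $\mathbb{C}^n$. Real $q$-convex functions: let $\omega\subset\mathbb{R}^n$ be open and $q\in\{0,\dots,n-1\}$. An upper semi-continuous function $u:\omega\to[-\infty,+\infty)$ is real $q$-convex on $\omega$ if for every real $(q+1)$-dimensional affine subspace $\pi$ of $\mathbb{R}^n$, every open Euclidean ball $B$ relatively compact in $\omega$ and every affine linear function $l:\pi\to\mathbb{R}$ with $u\le l$ on $\partial B\cap\pi$, one has $u\le l$ on $\overline{B}\cap\pi$. An open set $\omega\subset\mathbb{R}^n$ is a real $q$-convex set if $x\mapsto-\ln d_2(x,\partial\omega)$ is real $q$-convex on $\omega$. $q$-plurisubharmonic functions: let $\Omega\subset\mathbb{C}^n$ be open and $q\in\{0,\dots,n-1\}$. An upper semi-continuous function $\psi:\Omega\to[-\infty,+\infty)$ is $q$-plurisubharmonic on $\Omega$ if for every complex $(q+1)$-dimensional affine subspace $\Pi$ of $\mathbb{C}^n$,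 every open Euclidean ball $B$ relatively compact in $\Omega$ and every pluriharmonic function $h$ defined in a neighborhood of $\overline{B}$ with $\psi\le h$ on $\partial B\cap\Pi$, one has $\psi\le h$ on $\overline{B}\cap\Pi$. An open set $\Omega\subset\mathbb{C}^n$ is $q$-pseudoconvex if $z\mapsto-\ln d_2(z,\partial\Omega)$ is $q$-plurisubharmonic on $\Omega$. *)

theory Defs
  imports "HOL-Analysis.Analysis"
begin

definition usc_on :: "'a::topological_space set \<Rightarrow> ('a \<Rightarrow> ereal) \<Rightarrow> bool" where
  "usc_on S u \<longleftrightarrow> (\<forall>c. openin (top_of_set S) {x \<in> S. u x < c})"

(* The infimum over an empty boundary is \<infinity>. (The real-valued infdist would give 0.) *)
definition bdry_dist :: "'a::metric_space set \<Rightarrow> 'a \<Rightarrow> ereal" where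
  "bdry_dist S x = (INF y\<in>frontier S. ereal (dist x y))"

definition ext_ln :: "ereal \<Rightarrow> ereal" where
  "ext_ln d = (if d = \<infinity> then \<infinity> else if d \<le> 0 then - \<infinity> else ereal (ln (real_of_ereal d)))"

subsection \<open>Real q-convexity\<close>

definition affine_fun_on :: "'a::real_vector set \<Rightarrow> ('a \<Rightarrow> real) \<Rightarrow> bool" where
  "affine_fun_on P l \<longleftrightarrow>
     (\<forall>x\<in>P. \<forall>y\<in>P. \<forall>t. l ((1 - t) *\<^sub>R x + t *\<^sub>R y) = (1 - t) * l x + t * l y)"

(* Open balls relatively compact in W are the balls whose closed ball lies in W. *)
definition real_q_convex_on :: "nat \<Rightarrow> (real ^ 'n) set \<Rightarrow> (real ^ 'n \<Rightarrow> ereal) \<Rightarrow> bool" where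
  "real_q_convex_on q W u \<longleftrightarrow>
     usc_on W u \<and> (\<forall>x\<in>W. u x < \<infinity>) \<and>
     (\<forall>P c r l.
        affine P \<and> aff_dim P = int (q + 1) \<and> 0 < r \<and> cball c r \<subseteq> W \<and> affine_fun_on P l \<and>
        (\<forall>x \<in> sphere c r \<inter> P. u x \<le> ereal (l x)) \<longrightarrow>
        (\<forall>x \<in> cball c r \<inter> P. u x \<le> ereal (l x)))"

definition real_q_convex_set :: "nat \<Rightarrow> (real ^ 'n) set \<Rightarrow> bool" where
  "real_q_convex_set q W \<longleftrightarrow> open W \<and> real_q_convex_on q W (\<lambda>x. - ext_ln (bdry_dist W x))"

subsection \<open>Pluriharmonic functions\<close>

definition C2_derivs_on ::
  "'a::real_normed_vector set \<Rightarrow> ('a \<Rightarrow> real) \<Rightarrow> ('a \<Rightarrow> 'a \<Rightarrow>\<^sub>L real) \<Rightarrow>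
   ('a \<Rightarrow> 'a \<Rightarrow>\<^sub>L 'a \<Rightarrow>\<^sub>L real) \<Rightarrow> bool" where
  "C2_derivs_on U h h' h'' \<longleftrightarrow>
     (\<forall>x\<in>U. (h has_derivative blinfun_apply (h' x)) (at x)) \<and>
     (\<forall>x\<in>U. (h' has_derivative blinfun_apply (h'' x)) (at x)) \<and>
     continuous_on U h''"

definition harmonic_on :: "'a::euclidean_space set \<Rightarrow> ('a \<Rightarrow> real) \<Rightarrow> bool" where
  "harmonic_on U h \<longleftrightarrow>
     open U \<and> (\<exists>h' h''. C2_derivs_on U h h' h'' \<and> (\<forall>x\<in>U. (\<Sum>b\<in>Basis. h'' x b b) = 0))"

(* Twice continuously differentiable, with harmonic restriction to every complex line
   (for v = 0 the second condition holds trivially). *)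
definition pluriharmonic_on :: "(complex ^ 'n) set \<Rightarrow> (complex ^ 'n \<Rightarrow> real) \<Rightarrow> bool" where
  "pluriharmonic_on U h \<longleftrightarrow>
     open U \<and> (\<exists>h' h''. C2_derivs_on U h h' h'') \<and>
     (\<forall>a v. harmonic_on {\<zeta>. a + \<zeta> *s v \<in> U} (\<lambda>\<zeta>. h (a + \<zeta> *s v)))"

subsection \<open>q-pseudoconvexity\<close>

(* vec.subspace and vec.dim are taken over the scalar field complex. *)
definition complex_affine_subspace :: "nat \<Rightarrow> (complex ^ 'n) set \<Rightarrow> bool" where
  "complex_affine_subspace d P \<longleftrightarrow> (\<exists>a S. vec.subspace S \<and> vec.dim S = d \<and> P = (+) a ` S)"

definition q_plurisubharmonic_on ::
  "nat \<Rightarrow> (complex ^ 'n) set \<Rightarrow> (complex ^ 'n \<Rightarrow> ereal) \<Rightarrow> bool" where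
  "q_plurisubharmonic_on q W u \<longleftrightarrow>
     usc_on W u \<and> (\<forall>z\<in>W. u z < \<infinity>) \<and>
     (\<forall>P c r U h.
        complex_affine_subspace (q + 1) P \<and> 0 < r \<and> cball c r \<subseteq> W \<and>
        cball c r \<subseteq> U \<and> pluriharmonic_on U h \<and>
        (\<forall>z \<in> sphere c r \<inter> P. u z \<le> ereal (h z)) \<longrightarrow>
        (\<forall>z \<in> cball c r \<inter> P. u z \<le> ereal (h z)))"

definition q_pseudoconvex :: "nat \<Rightarrow> (complex ^ 'n) set \<Rightarrow> bool" where
  "q_pseudoconvex q W \<longleftrightarrow> open W \<and> q_plurisubharmonic_on q W (\<lambda>z. - ext_ln (bdry_dist W z))"

(* The nonvanishing condition is needed because ln 0 = 0 in HOL. *)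
definition Omega :: "(real ^ 'n) set \<Rightarrow> (complex ^ 'n) set" where
  "Omega V = {z. (\<forall>i. z $ i \<noteq> 0) \<and> (\<chi> i. ln (cmod (z $ i))) \<in> V}"

end

theory Submission
  imports Defs
begin

text \<open>Let \<open>u = - ln d(\<cdot>, \<partial>W)\<close>. If \<open>u\<close> violates \<open>q\<close>-convexity (or \<open>q\<close>-plurisubharmonicity), then
  at some point \<open>u\<close> lies below a pluriharmonic function minus \<open>\<epsilon> \<bar>\<zeta>\<bar>\<^sup>2\<close> on a \<open>(q + 1)\<close>-dimensional plane.
  Moving this plane towards a nearest boundary point, over the distance prescribed by that function,
  gives a quadratic family in \<open>W\<close> that touches the boundary at one point and stays away from it
  quadratically. Such touching families are transported by \<open>exp\<close> between the tube over \<open>V\<close> and \<open>Omega V\<close>;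
  a real family over \<open>V\<close> extends to a holomorphic one over the complexified parameter space.

  Conversely, given a touching family \<open>F\<^sub>\<tau>\<close>, maximise \<open>u(w) + \<bar>\<zeta>\<bar>\<^sup>2 - K \<bar>w - F\<^sub>\<tau>(\<zeta>)\<bar>\<^sup>2\<close>. For small \<open>\<tau>\<close> and
  large \<open>K\<close> the maximum is interior, and there \<open>u\<close> violates the condition on the tangent plane of the
  family. In the real case the family is parametrised by a complex space, and the sum of the Hessian
  over \<open>\<eta>\<close> and \<open>\<i> \<eta>\<close> is negative, so that the Hessian is negative on a real \<open>(q + 1)\<close>-dimensional
  subspace.\<close>

subsection \<open>Boundary distance and touching families\<close>

text \<open>\<open>exp_vec\<close> is no isometry, so the boundary distances of \<open>V\<close> and
  \<open>Omega V\<close> do not determine each other pointwise. Contact with the boundary does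
  survive a change of coordinates, provided that it is strict enough to absorb the distortion; the
  strictness comes from the term \<epsilon> that an interior maximum yields. The second derivative
  of \<open>exp\<close> enters the quadratic part as a product of complex linear maps, and so keeps
  the sign change under multiplication by \<i> on which both directions rest.

  The boundary distance has no Hessian in general: second order information is always a one-sided
  bound by a quadratic function, and the way back from a family to the distance has to be a
  maximisation. The tangent plane found there might have too small a dimension; maximality excludes
  this, since along a kernel direction the base point stands still while the quadratic summand
  favours moving. A nearest boundary point of \<open>Omega V\<close> may a priori lie on a
  coordinate hyperplane, where logarithmic coordinates do not exist; this case is refuted
  separately.\<close>

definition log_dist :: "'a::metric_space set \<Rightarrow> 'a \<Rightarrow> real" where
  "log_dist W x = - ln (infdist x (- W))"

text \<open>A quadratic family over \<open>S\<close> lies in \<open>W\<close>, except that it hits the complement at \<open>w\<close> for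
  \<open>\<zeta> = 0\<close>, and \<open>\<nu>\<close> pushes it into \<open>W\<close>. The room \<open>c (\<bar>\<zeta>\<bar>\<^sup>2 + \<tau>)\<close> around it absorbs the third order
  terms of a coordinate change, so that the quadratic jets \<open>A\<close>, \<open>Q\<close> carry all the information.\<close>
definition touches ::
  "'b::real_normed_vector set \<Rightarrow> 'a::real_normed_vector set \<Rightarrow> 'b \<Rightarrow> ('a \<Rightarrow> 'b) \<Rightarrow>
   ('a \<Rightarrow> 'a \<Rightarrow> 'b) \<Rightarrow> 'b \<Rightarrow> bool" where
  "touches W S w A Q \<nu> \<longleftrightarrow> w \<notin> W \<and>
     (\<exists>c>0. \<exists>\<sigma>>0. \<forall>\<zeta>\<in>S. \<forall>\<tau>>0. (norm \<zeta>)\<^sup>2 + \<tau> \<le> \<sigma> \<longrightarrow>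
        ball (w + A \<zeta> + Q \<zeta> \<zeta> + \<tau> *\<^sub>R \<nu>) (c * ((norm \<zeta>)\<^sup>2 + \<tau>)) \<subseteq> W)"

lemma touchesI:
  assumes "w \<notin> W" "c > 0" "\<sigma> > 0"
    "\<And>\<zeta> \<tau>. \<zeta> \<in> S \<Longrightarrow> \<tau> > 0 \<Longrightarrow> (norm \<zeta>)\<^sup>2 + \<tau> \<le> \<sigma> \<Longrightarrow>
       ball (w + A \<zeta> + Q \<zeta> \<zeta> + \<tau> *\<^sub>R \<nu>) (c * ((norm \<zeta>)\<^sup>2 + \<tau>)) \<subseteq> W"
  shows "touches W S w A Q \<nu>"
  using assms unfolding touches_def by blast

section \<open>Distance to the complement\<close>

lemma infdist_compl_pos:
  assumes "open W" "W \<noteq> UNIV" "x \<in> W"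
  shows "infdist x (- W) > 0"
  using assms by (intro infdist_pos_not_in_closed) auto

lemma ball_infdist_compl: "ball x (infdist x (- W)) \<subseteq> W"
  using infdist_le[of _ "- W" x] by (force simp: not_le)

lemma le_infdist_compl:
  assumes "ball x r \<subseteq> W" "W \<noteq> UNIV"
  shows "r \<le> infdist x (- W)"
proof -
  have ne: "- W \<noteq> {}" using assms by auto
  show ?thesis
    unfolding infdist_notempty[OF ne]
    using assms by (intro cINF_greatest ne) (force simp: subset_iff not_less[symmetric])
qed

lemma infdist_compl_attained:
  fixes W :: "'a::heine_borel set"
  assumes "open W" "W \<noteq> UNIV"
  obtains y where "y \<notin> W" "infdist x (- W) = dist x y"
  using infdist_attains_inf[of "- W" x] assms by fastforce

text \<open>The segment from \<open>x\<close> to a nearest point of the complement crosses the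
  frontier. This replaces the frontier in \<open>bdry_dist\<close> by the complement, whose distance
  is the radius of the largest open ball about \<open>x\<close> inside \<open>W\<close>.\<close>

lemma infdist_frontier:
  fixes W :: "'a::euclidean_space set"
  assumes W: "open W" "W \<noteq> UNIV" "x \<in> W"
  shows "infdist x (frontier W) = infdist x (- W)"
proof (rule antisym)
  obtain y where y: "y \<notin> W" "infdist x (- W) = dist x y"
    using infdist_compl_attained[OF W(1,2)] by blast
  have "closed_segment x y \<inter> frontier W \<noteq> {}"
    using y W by (intro connected_Int_frontier) auto
  then obtain z where z: "z \<in> closed_segment x y" "z \<in> frontier W" by blast
  have "dist x z \<le> dist x y"
    using dist_in_closed_segment[OF z(1)] by (simp add: dist_commute)
  then show "infdist x (frontier W) \<le> infdist x (- W)"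
    using infdist_le2[OF z(2)] y by simp
next
  have "frontier W \<noteq> {}" using W frontier_eq_empty by blast
  then show "infdist x (- W) \<le> infdist x (frontier W)"
    using W by (intro infdist_mono) (auto simp: frontier_def interior_open)
qed

lemma neg_ext_ln_bdry_dist:
  fixes W :: "'a::euclidean_space set"
  assumes W: "open W" "W \<noteq> UNIV" "x \<in> W"
  shows "- ext_ln (bdry_dist W x) = ereal (log_dist W x)"
proof -
  have ne: "frontier W \<noteq> {}" using W frontier_eq_empty by blast
  have "bdry_dist W x = ereal (infdist x (frontier W))"
    unfolding bdry_dist_def infdist_notempty[OF ne]
  proof (subst ereal_INF)
    show "\<bar>INF a\<in>frontier W. ereal (dist x a)\<bar> \<noteq> \<infinity>"
    proof -
      obtain a where a: "a \<in> frontier W" using ne by blast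
      have "(INF a\<in>frontier W. ereal (dist x a)) \<le> ereal (dist x a)"
        using a by (rule INF_lower)
      moreover have "0 \<le> (INF a\<in>frontier W. ereal (dist x a))"
        by (rule INF_greatest) simp
      ultimately show ?thesis by auto
    qed
  qed simp
  then show ?thesis
    using infdist_compl_pos[OF W] infdist_frontier[OF W]
    by (simp add: ext_ln_def log_dist_def)
qed

lemma neg_ext_ln_bdry_dist_UNIV [simp]: "- ext_ln (bdry_dist UNIV x) = - \<infinity>"
  by (simp add: bdry_dist_def ext_ln_def top_ereal_def)

lemma continuous_on_log_dist:
  assumes "open W" "W \<noteq> UNIV"
  shows "continuous_on W (log_dist W)"
  unfolding log_dist_def
  by (intro continuous_intros) (use infdist_compl_pos[OF assms] in force)

lemma usc_on_neg_ext_ln_bdry_dist: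
  fixes W :: "'a::euclidean_space set"
  assumes "open W"
  shows "usc_on W (\<lambda>x. - ext_ln (bdry_dist W x))"
proof (cases "W = UNIV")
  case True
  then show ?thesis by (simp add: usc_on_def)
next
  case False
  have "openin (top_of_set W) (W \<inter> (\<lambda>x. ereal (log_dist W x)) -` {..<c})" for c
    by (rule continuous_openin_preimage_gen)
       (intro continuous_on_ereal continuous_on_log_dist assms False, simp)
  moreover have "{x \<in> W. - ext_ln (bdry_dist W x) < c} = W \<inter> (\<lambda>x. ereal (log_dist W x)) -` {..<c}" for c
    using neg_ext_ln_bdry_dist[OF assms False] by auto
  ultimately show ?thesis by (simp add: usc_on_def)
qed

lemma neg_ext_ln_bdry_dist_less_top:
  fixes W :: "'a::euclidean_space set"
  assumes "open W" "x \<in> W"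
  shows "- ext_ln (bdry_dist W x) < \<infinity>"
  using neg_ext_ln_bdry_dist[OF assms(1) _ assms(2)] by (cases "W = UNIV") auto

section \<open>Interior maxima\<close>

text \<open>A violation on a ball is traded for a local bound: the added term
  \<open>\<epsilon> * (norm (x - c))\<^sup>2\<close> is too small to move the maximum of
  \<open>u - g\<close> to the sphere, and carried to the other side it leaves a bound with a
  strictly concave quadratic term.\<close>

lemma interior_max_of_violation:
  fixes u g :: "'a::euclidean_space \<Rightarrow> real"
  assumes P: "closed P" and u: "continuous_on (cball c r) u" and g: "continuous_on (cball c r) g"
    and le: "\<And>x. x \<in> sphere c r \<inter> P \<Longrightarrow> u x \<le> g x"
    and y: "y \<in> cball c r \<inter> P" "u y > g y"
  obtains x \<epsilon> where "x \<in> ball c r \<inter> P" "\<epsilon> > 0"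
    "\<And>x'. x' \<in> cball c r \<inter> P \<Longrightarrow>
       u x' - g x' + \<epsilon> * (norm (x' - c))\<^sup>2 \<le> u x - g x + \<epsilon> * (norm (x - c))\<^sup>2"
proof -
  \<comment> \<open>The excess at \<open>y\<close> has to beat the value
    \<open>\<epsilon> * r\<^sup>2\<close> on the sphere; the summand 1 makes this strict.\<close>
  define \<epsilon> where "\<epsilon> = (u y - g y) / (r\<^sup>2 + 1)"
  have \<epsilon>: "\<epsilon> > 0" using y by (simp add: \<epsilon>_def add_nonneg_pos)
  have lt: "\<epsilon> * r\<^sup>2 < u y - g y"
  proof -
    have "(u y - g y) * r\<^sup>2 < (u y - g y) * (r\<^sup>2 + 1)" using y by (intro mult_strict_left_mono) auto
    then show ?thesis by (simp add: \<epsilon>_def divide_less_eq add_nonneg_pos)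
  qed
  define f where "f x = u x - g x + \<epsilon> * (norm (x - c))\<^sup>2" for x
  have "compact (cball c r \<inter> P)" using P by (intro compact_Int_closed) auto
  moreover have "continuous_on (cball c r \<inter> P) f"
    unfolding f_def by (intro continuous_intros continuous_on_subset[OF u] continuous_on_subset[OF g]) auto
  ultimately obtain x where x: "x \<in> cball c r \<inter> P" "\<And>x'. x' \<in> cball c r \<inter> P \<Longrightarrow> f x' \<le> f x"
    using continuous_attains_sup[of "cball c r \<inter> P" f] y by blast
  have "f y \<le> f x" using x y by blast
  moreover have "f y \<ge> u y - g y" using \<epsilon> by (simp add: f_def)
  ultimately have "f x > \<epsilon> * r\<^sup>2" using lt by linarith
  moreover have "f x \<le> \<epsilon> * r\<^sup>2" if "x \<in> sphere c r"
    using le[of x] that x(1) by (auto simp: f_def dist_norm norm_minus_commute)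
  ultimately have "x \<in> ball c r \<inter> P" using x(1) by force
  then show thesis using that \<epsilon> x(2) unfolding f_def by blast
qed

text \<open>At the shift \<tau> the family stays at a distance of order
  \<open>(norm \<zeta>)\<^sup>2 + \<tau>\<close> from the complement, but at
  \<open>\<zeta> = 0\<close> it comes within \<open>\<tau> * norm \<nu>\<close> of \<open>w\<close>.
  So \<open>log_dist\<close> is large at the centre and, where
  \<open>norm \<zeta> = \<rho>'\<close>, bounded above uniformly in \<tau>, which keeps the maximum
  away from there; the penalty takes care of the remaining boundary. The bound claimed is this
  maximality, expanded around \<open>(\<zeta>1, w1)\<close> with
  \<open>r = w1 - F \<zeta>1\<close>.\<close>

lemma touches_penalised_max:
  fixes A :: "'a::euclidean_space \<Rightarrow> 'b::euclidean_space"
  assumes t: "touches W S w A Q \<nu>" and W: "open W" and S: "closed S" "0 \<in> S"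
    and A: "bounded_linear A" and Q: "bounded_bilinear Q" and \<rho>: "\<rho> > 0"
  obtains \<zeta>1 w1 r K e where "\<zeta>1 \<in> S" "norm \<zeta>1 < \<rho>" "w1 \<in> W" "K > 0" "e > 0"
    "\<And>\<zeta> \<omega>. \<zeta>1 + \<zeta> \<in> S \<Longrightarrow> norm \<zeta> < e \<Longrightarrow> norm \<omega> < e \<Longrightarrow>
       w1 + \<omega> \<in> W \<and> log_dist W (w1 + \<omega>) \<le> log_dist W w1 - 2 * (\<zeta>1 \<bullet> \<zeta>) - (norm \<zeta>)\<^sup>2
         + K * (norm (r + \<omega> - (A \<zeta> + Q \<zeta>1 \<zeta> + Q \<zeta> \<zeta>1) - Q \<zeta> \<zeta>))\<^sup>2 - K * (norm r)\<^sup>2"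
proof -
  interpret A: bounded_linear A by fact
  interpret Q: bounded_bilinear Q by fact
  obtain c \<sigma> where w: "w \<notin> W" and c: "c > 0" "\<sigma> > 0" and
    sub: "\<And>\<zeta> \<tau>. \<zeta> \<in> S \<Longrightarrow> \<tau> > 0 \<Longrightarrow> (norm \<zeta>)\<^sup>2 + \<tau> \<le> \<sigma> \<Longrightarrow>
      ball (w + A \<zeta> + Q \<zeta> \<zeta> + \<tau> *\<^sub>R \<nu>) (c * ((norm \<zeta>)\<^sup>2 + \<tau>)) \<subseteq> W"
    using t unfolding touches_def by metis
  have WU: "W \<noteq> UNIV" using w by auto
  define \<rho>' where "\<rho>' = min (\<rho> / 2) (sqrt (\<sigma> / 2))"
  have \<rho>': "\<rho>' > 0" "\<rho>' < \<rho>" using \<rho> c by (auto simp: \<rho>'_def)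
  have "\<rho>'\<^sup>2 \<le> (sqrt (\<sigma> / 2))\<^sup>2" using \<rho>'(1) by (intro power_mono) (auto simp: \<rho>'_def)
  then have \<rho>'2: "\<rho>'\<^sup>2 \<le> \<sigma> / 2" using c by simp
  \<comment> \<open>An upper bound for the functional on \<open>norm \<zeta> = \<rho>'\<close> that
    involves neither \<tau> nor \<open>K\<close>, so that both can be adapted to it.\<close>
  define m where "m = - ln (c * \<rho>'\<^sup>2 / 2) + \<rho>'\<^sup>2"
  \<comment> \<open>Small enough that \<open>log_dist\<close> at the centre of the family is at
    least \<open>m + 1\<close>; the other half of \<sigma> is left to
    \<open>(norm \<zeta>)\<^sup>2\<close>.\<close>
  define \<tau> where "\<tau> = min (\<sigma> / 2) (exp (- m - 1) / (norm \<nu> + 1))"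
  have \<tau>: "\<tau> > 0" "\<tau> \<le> \<sigma> / 2"
    unfolding \<tau>_def using c by (auto simp: min_def add_nonneg_pos)
  have "\<tau> * norm \<nu> \<le> exp (- m - 1) / (norm \<nu> + 1) * (norm \<nu> + 1)"
    by (intro mult_mono) (auto simp: \<tau>_def)
  also have "\<dots> = exp (- m - 1)"
  proof -
    have "norm \<nu> + 1 \<noteq> 0" using norm_ge_zero[of \<nu>] by linarith
    then show ?thesis by (metis nonzero_eq_divide_eq)
  qed
  finally have \<tau>\<nu>: "\<tau> * norm \<nu> \<le> exp (- m - 1)" .
  define F where "F \<zeta> = w + A \<zeta> + Q \<zeta> \<zeta> + \<tau> *\<^sub>R \<nu>" for \<zeta>
  have F_cont [continuous_intros]: "continuous_on T F" for T
    unfolding F_def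
    by (intro continuous_intros A.continuous_on Q.continuous_on)
  have F_fst [continuous_intros]: "continuous_on T (\<lambda>p. F (fst p))" for T :: "('a \<times> 'b) set"
    by (rule continuous_on_compose2[OF F_cont[of UNIV]]) (auto intro: continuous_intros)
  \<comment> \<open>Half of the available room: every \<open>v\<close> in \<open>D\<close> keeps the
    other half as distance to the complement.\<close>
  define D where "D = {(\<zeta>, v). \<zeta> \<in> S \<and> norm \<zeta> \<le> \<rho>' \<and> norm (v - F \<zeta>) \<le> c * ((norm \<zeta>)\<^sup>2 + \<tau>) / 2}"
  have small: "(norm \<zeta>)\<^sup>2 + \<tau> \<le> \<sigma>" if "norm \<zeta> \<le> \<rho>'" for \<zeta> :: 'a
    using that \<rho>'2 \<tau> power_mono[of "norm \<zeta>" \<rho>' 2] by auto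
  have D_dist: "v \<in> W" "infdist v (- W) \<ge> c * ((norm \<zeta>)\<^sup>2 + \<tau>) / 2" if "(\<zeta>, v) \<in> D" for \<zeta> v
  proof -
    have p: "c * ((norm \<zeta>)\<^sup>2 + \<tau>) / 2 > 0" using c \<tau> by (simp add: add_nonneg_pos)
    have "ball v (c * ((norm \<zeta>)\<^sup>2 + \<tau>) / 2) \<subseteq> ball (F \<zeta>) (c * ((norm \<zeta>)\<^sup>2 + \<tau>))"
      using that dist_triangle_less_add[of "F \<zeta>" v "c * ((norm \<zeta>)\<^sup>2 + \<tau>) / 2"]
      by (subst ball_subset_ball_iff) (auto simp: D_def dist_norm)
    also have "\<dots> \<subseteq> W" unfolding F_def using that \<tau> small
      by (intro sub) (auto simp: D_def)
    finally have *: "ball v (c * ((norm \<zeta>)\<^sup>2 + \<tau>) / 2) \<subseteq> W" .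
    then show "v \<in> W" using p by (meson centre_in_ball subsetD)
    show "infdist v (- W) \<ge> c * ((norm \<zeta>)\<^sup>2 + \<tau>) / 2"
      by (rule le_infdist_compl[OF * WU])
  qed
  have F0: "(0, F 0) \<in> D" using S c \<tau> \<rho>' by (simp add: D_def)
  have up: "log_dist W v \<le> - ln (c * ((norm \<zeta>)\<^sup>2 + \<tau>) / 2)" if "(\<zeta>, v) \<in> D" for \<zeta> v
  proof -
    have "c * ((norm \<zeta>)\<^sup>2 + \<tau>) / 2 > 0" using c \<tau> by (simp add: add_nonneg_pos)
    then show ?thesis using D_dist(2)[OF that] unfolding log_dist_def by (simp only: neg_le_iff_le ln_mono)
  qed
  have "infdist (F 0) (- W) \<le> dist (F 0) w" using w by (intro infdist_le) simp
  also have "\<dots> = \<tau> * norm \<nu>" using \<tau> by (simp add: F_def dist_norm A.zero Q.zero_left)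
  finally have "infdist (F 0) (- W) \<le> exp (- m - 1)" using \<tau>\<nu> by simp
  moreover have "infdist (F 0) (- W) > 0"
    using infdist_compl_pos[OF W WU] D_dist(1)[OF F0] by simp
  ultimately have "ln (infdist (F 0) (- W)) \<le> - m - 1"
    by (metis ln_exp ln_le_cancel_iff exp_gt_zero)
  then have F0_val: "log_dist W (F 0) \<ge> m + 1" by (simp add: log_dist_def)
  \<comment> \<open>On the lateral boundary of \<open>D\<close> the deviation is at least
    \<open>c * \<tau> / 2\<close>, and this \<open>K\<close> makes the penalty push the functional
    down to at most \<open>m\<close>.\<close>
  define K where "K = (\<bar>- ln (c * \<tau> / 2) + \<rho>'\<^sup>2 - m\<bar> + 1) / (c * \<tau> / 2)\<^sup>2"
  have K: "K > 0" using c \<tau> by (simp add: K_def)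
  define \<Psi> where "\<Psi> = (\<lambda>(\<zeta>, v). log_dist W v + (norm \<zeta>)\<^sup>2 - K * (norm (v - F \<zeta>))\<^sup>2)"
  have "closed D"
  proof -
    have "D = {p. fst p \<in> S} \<inter> {p. norm (fst p) \<le> \<rho>'} \<inter>
        {p. norm (snd p - F (fst p)) \<le> c * ((norm (fst p))\<^sup>2 + \<tau>) / 2}"
      by (auto simp: D_def)
    moreover have "closed {p::'a \<times> 'b. fst p \<in> S}"
      using closed_vimage_fst[OF S(1)] by (simp add: vimage_def)
    ultimately show ?thesis
      by (auto intro!: closed_Int closed_Collect_le continuous_intros)
  qed
  moreover have "bounded D"
  proof -
    have "compact (F ` cball 0 \<rho>')" by (intro compact_continuous_image continuous_intros) auto
    then obtain b where b: "\<And>\<zeta>. norm \<zeta> \<le> \<rho>' \<Longrightarrow> norm (F \<zeta>) \<le> b"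
      by (metis compact_imp_bounded bounded_iff image_eqI mem_cball_0)
    have "norm v \<le> b + c * \<sigma> / 2" if "(\<zeta>, v) \<in> D" for \<zeta> v
    proof -
      have "norm v \<le> norm (F \<zeta>) + norm (v - F \<zeta>)" by norm
      also have "\<dots> \<le> b + c * ((norm \<zeta>)\<^sup>2 + \<tau>) / 2" using that b by (intro add_mono) (auto simp: D_def)
      also have "\<dots> \<le> b + c * \<sigma> / 2" using small[of \<zeta>] that c by (auto simp: D_def)
      finally show ?thesis .
    qed
    then have "D \<subseteq> cball 0 \<rho>' \<times> cball 0 (b + c * \<sigma> / 2)" by (force simp: D_def)
    then show ?thesis using bounded_Times bounded_cball bounded_subset by metis
  qed
  ultimately have "compact D" by (simp add: compact_eq_bounded_closed)
  moreover have "continuous_on D \<Psi>"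
    unfolding \<Psi>_def case_prod_unfold
    by (intro continuous_intros continuous_on_compose2[OF continuous_on_log_dist[OF W WU]]) (use D_dist in auto)
  ultimately obtain p where p: "p \<in> D" "\<And>p'. p' \<in> D \<Longrightarrow> \<Psi> p' \<le> \<Psi> p"
    using continuous_attains_sup[of D \<Psi>] F0 by blast
  obtain \<zeta>1 w1 where pe: "p = (\<zeta>1, w1)" by (cases p)
  have pD: "(\<zeta>1, w1) \<in> D" using p pe by simp
  have big: "\<Psi> (\<zeta>1, w1) \<ge> m + 1"
    using p(2)[OF F0] F0_val by (simp add: pe \<Psi>_def)
  have \<zeta>1: "\<zeta>1 \<in> S" "norm \<zeta>1 \<le> \<rho>'" and w1: "norm (w1 - F \<zeta>1) \<le> c * ((norm \<zeta>1)\<^sup>2 + \<tau>) / 2"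
    using pD by (auto simp: D_def)
  have int1: "norm \<zeta>1 < \<rho>'"
  proof (rule ccontr)
    assume "\<not> ?thesis"
    then have eq: "norm \<zeta>1 = \<rho>'" using \<zeta>1 by simp
    have "\<Psi> (\<zeta>1, w1) \<le> log_dist W w1 + \<rho>'\<^sup>2" using K by (simp add: \<Psi>_def eq)
    also have "\<dots> \<le> - ln (c * (\<rho>'\<^sup>2 + \<tau>) / 2) + \<rho>'\<^sup>2" using up[OF pD] eq by simp
    also have "\<dots> \<le> m" unfolding m_def using c \<rho>' \<tau> by (simp add: add_pos_pos)
    finally show False using big by simp
  qed
  have int2: "norm (w1 - F \<zeta>1) < c * ((norm \<zeta>1)\<^sup>2 + \<tau>) / 2"
  proof (rule ccontr)
    assume "\<not> ?thesis"
    then have eq: "norm (w1 - F \<zeta>1) = c * ((norm \<zeta>1)\<^sup>2 + \<tau>) / 2" using w1 by simp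
    have l: "log_dist W w1 \<le> - ln (c * \<tau> / 2)"
      using up[OF pD] c \<tau> by (smt (verit) divide_pos_pos ln_le_cancel_iff mult_left_mono
          mult_pos_pos zero_le_power2 divide_right_mono)
    have "(c * \<tau> / 2)\<^sup>2 \<le> (norm (w1 - F \<zeta>1))\<^sup>2"
      unfolding eq using c \<tau> by (intro power_mono) (auto intro!: mult_left_mono)
    then have "K * (c * \<tau> / 2)\<^sup>2 \<le> K * (norm (w1 - F \<zeta>1))\<^sup>2" using K by simp
    moreover have "K * (c * \<tau> / 2)\<^sup>2 = \<bar>- ln (c * \<tau> / 2) + \<rho>'\<^sup>2 - m\<bar> + 1"
      unfolding K_def using c \<tau> by simp
    moreover have "(norm \<zeta>1)\<^sup>2 \<le> \<rho>'\<^sup>2" using \<zeta>1 by (intro power_mono) auto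
    ultimately have "\<Psi> (\<zeta>1, w1) \<le> m" using l unfolding \<Psi>_def by simp
    then show False using big by simp
  qed
  \<comment> \<open>The strict inequalities of \<open>D\<close> without the constraint to
    \<open>S\<close>, so that the set is open in the full product.\<close>
  define N where "N = {p :: 'a \<times> 'b. norm (fst p) < \<rho>' \<and> norm (snd p - F (fst p)) < c * ((norm (fst p))\<^sup>2 + \<tau>) / 2}"
  have "open N" unfolding N_def
    by (intro open_Collect_conj open_Collect_less continuous_intros) auto
  moreover have "(\<zeta>1, w1) \<in> N" using int1 int2 by (simp add: N_def)
  ultimately obtain e where e: "e > 0" "ball (\<zeta>1, w1) e \<subseteq> N" by (meson open_contains_ball)
  define r where "r = w1 - F \<zeta>1"
  have fin: "w1 + \<omega> \<in> W \<and> log_dist W (w1 + \<omega>) \<le> log_dist W w1 - 2 * (\<zeta>1 \<bullet> \<zeta>) - (norm \<zeta>)\<^sup>2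
         + K * (norm (r + \<omega> - (A \<zeta> + Q \<zeta>1 \<zeta> + Q \<zeta> \<zeta>1) - Q \<zeta> \<zeta>))\<^sup>2 - K * (norm r)\<^sup>2"
    if h: "\<zeta>1 + \<zeta> \<in> S" "norm \<zeta> < e / 2" "norm \<omega> < e / 2" for \<zeta> \<omega>
  proof -
    have "dist (\<zeta>1, w1) (\<zeta>1 + \<zeta>, w1 + \<omega>) \<le> norm \<zeta> + norm \<omega>"
      using norm_Pair_le[of \<zeta> \<omega>] by (simp add: dist_norm norm_minus_commute dist_commute norm_Pair)
    then have "(\<zeta>1 + \<zeta>, w1 + \<omega>) \<in> N" using h e by (intro subsetD[OF e(2)]) (simp add: mem_ball)
    then have inD: "(\<zeta>1 + \<zeta>, w1 + \<omega>) \<in> D" using h by (auto simp: N_def D_def)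
    have "\<Psi> (\<zeta>1 + \<zeta>, w1 + \<omega>) \<le> \<Psi> (\<zeta>1, w1)" using p(2)[OF inD] pe by simp
    moreover have "w1 + \<omega> - F (\<zeta>1 + \<zeta>) = r + \<omega> - (A \<zeta> + Q \<zeta>1 \<zeta> + Q \<zeta> \<zeta>1) - Q \<zeta> \<zeta>"
      by (simp add: r_def F_def A.add Q.add_left Q.add_right)
    moreover have "(norm (\<zeta>1 + \<zeta>))\<^sup>2 = (norm \<zeta>1)\<^sup>2 + 2 * (\<zeta>1 \<bullet> \<zeta>) + (norm \<zeta>)\<^sup>2"
      by (simp add: power2_norm_eq_inner inner_add_left inner_add_right inner_commute)
    ultimately have "log_dist W (w1 + \<omega>) \<le> log_dist W w1 - 2 * (\<zeta>1 \<bullet> \<zeta>) - (norm \<zeta>)\<^sup>2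
         + K * (norm (r + \<omega> - (A \<zeta> + Q \<zeta>1 \<zeta> + Q \<zeta> \<zeta>1) - Q \<zeta> \<zeta>))\<^sup>2 - K * (norm r)\<^sup>2"
      unfolding \<Psi>_def by (simp add: r_def)
    then show ?thesis using D_dist(1)[OF inD] by simp
  qed
  show thesis
    by (rule that[of \<zeta>1 w1 K "e / 2" r]) (use \<zeta>1 int1 \<rho>' D_dist[OF pD] K e fin in auto)
qed

section \<open>Second order jets of the exponential\<close>

text \<open>With \<open>p\<close> of first and \<open>r\<close> of second order in \<open>s\<close>,
  the terms \<open>p * r\<close> and \<open>r\<^sup>2 / 2\<close> of the Taylor polynomial have at
  least third order and join the remainder.\<close>

lemma exp_quadratic_error:
  assumes "a \<ge> 0"
  obtains K :: real where "K \<ge> 0"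
    "\<And>s p r. 0 \<le> s \<Longrightarrow> s \<le> 1 \<Longrightarrow> cmod p \<le> a * s \<Longrightarrow> cmod r \<le> a * s\<^sup>2 \<Longrightarrow>
       cmod (exp (p + r) - (1 + p + r + p\<^sup>2 / 2)) \<le> K * s ^ 3"
proof -
  \<comment> \<open>The first summand is the Taylor remainder at modulus at most
    \<open>2 * a * s\<close>, divided by \<open>fact 2\<close>; the second bounds the two dropped
    products.\<close>
  define K where "K = exp (2 * a) * (2 * a) ^ 3 / 2 + 2 * a\<^sup>2"
  have "cmod (exp (p + r) - (1 + p + r + p\<^sup>2 / 2)) \<le> K * s ^ 3"
    if s: "0 \<le> s" "s \<le> 1" and p: "cmod p \<le> a * s" and r: "cmod r \<le> a * s\<^sup>2" for s p r
  proof -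
    have s2: "s\<^sup>2 \<le> s" using s by (simp add: power2_eq_square mult_left_le)
    have z: "cmod (p + r) \<le> 2 * a * s"
    proof -
      have "cmod (p + r) \<le> a * s + a * s\<^sup>2" using norm_triangle_ineq[of p r] p r by linarith
      also have "a * s\<^sup>2 \<le> a * s" using s2 assms by (intro mult_left_mono)
      finally show ?thesis by simp
    qed
    have z1: "cmod (p + r) \<le> 2 * a"
      using z s assms by (smt (verit) mult_left_le)
    have "cmod (exp (p + r) - (\<Sum>i\<le>2. (p + r) ^ i / fact i)) \<le> exp (cmod (p + r)) * (cmod (p + r)) ^ 3 / 2"
      using Taylor_exp_field[of "p + r" 2] by (simp add: numeral_eq_Suc)
    also have "\<dots> \<le> exp (2 * a) * (2 * a * s) ^ 3 / 2"
      using z z1 by (intro divide_right_mono mult_mono power_mono) auto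
    finally have 1: "cmod (exp (p + r) - (\<Sum>i\<le>2. (p + r) ^ i / fact i)) \<le> exp (2 * a) * (2 * a * s) ^ 3 / 2" .
    have eq: "(\<Sum>i\<le>2. (p + r) ^ i / fact i) - (1 + p + r + p\<^sup>2 / 2) = p * r + r\<^sup>2 / 2"
    proof -
      have "(\<Sum>i\<le>2. (p + r) ^ i / fact i) = 1 + (p + r) + (p + r)\<^sup>2 / 2"
        by (simp add: numeral_2_eq_2)
      then show ?thesis by (simp add: power2_sum add_divide_distrib)
    qed
    have "cmod (p * r + r\<^sup>2 / 2) \<le> cmod p * cmod r + (cmod r)\<^sup>2 / 2"
      using norm_triangle_ineq[of "p * r" "r\<^sup>2 / 2"] by (simp add: norm_mult norm_power norm_divide)
    also have "\<dots> \<le> (a * s) * (a * s\<^sup>2) + (a * s\<^sup>2)\<^sup>2 / 2"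
      using p r s assms by (intro add_mono mult_mono divide_right_mono power_mono) auto
    also have "\<dots> = a\<^sup>2 * s ^ 3 + a\<^sup>2 * (s ^ 3 * s) / 2" by (simp add: power2_eq_square power3_eq_cube)
    also have "\<dots> \<le> a\<^sup>2 * s ^ 3 + a\<^sup>2 * (s ^ 3 * 1) / 2"
      using s by (intro add_mono divide_right_mono mult_left_mono) auto
    also have "\<dots> \<le> 2 * a\<^sup>2 * s ^ 3" using s by simp
    finally have 2: "cmod (p * r + r\<^sup>2 / 2) \<le> 2 * a\<^sup>2 * s ^ 3" .
    have *: "exp (p + r) - (1 + p + r + p\<^sup>2 / 2) =
        (exp (p + r) - (\<Sum>i\<le>2. (p + r) ^ i / fact i)) + (p * r + r\<^sup>2 / 2)"
      unfolding eq[symmetric] by simp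
    have "cmod (exp (p + r) - (1 + p + r + p\<^sup>2 / 2)) \<le>
        exp (2 * a) * (2 * a * s) ^ 3 / 2 + 2 * a\<^sup>2 * s ^ 3"
      unfolding * by (rule norm_triangle_mono[OF 1 2])
    also have "\<dots> = K * s ^ 3" by (simp add: K_def power_mult_distrib distrib_right)
    finally show ?thesis .
  qed
  moreover have "K \<ge> 0" using assms by (simp add: K_def)
  ultimately show thesis using that by blast
qed

lemma norm_quadratic_bounds:
  assumes "bounded_linear A" "bounded_bilinear Q"
  obtains a where "a > 0" "\<And>\<zeta>. norm (A \<zeta>) \<le> a * norm \<zeta>"
    "\<And>\<zeta>. norm (Q \<zeta> \<zeta>) \<le> a * (norm \<zeta>)\<^sup>2" "a \<ge> b"
proof -
  obtain a1 where a1: "\<And>\<zeta>. norm (A \<zeta>) \<le> norm \<zeta> * a1" "a1 > 0"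
    using bounded_linear.pos_bounded[OF assms(1)] by blast
  obtain a2 where a2: "\<And>\<zeta> \<zeta>'. norm (Q \<zeta> \<zeta>') \<le> norm \<zeta> * norm \<zeta>' * a2" "a2 > 0"
    using bounded_bilinear.pos_bounded[OF assms(2)] by blast
  define a where "a = max (max a1 a2) b"
  have "norm (A \<zeta>) \<le> a * norm \<zeta>" for \<zeta>
  proof -
    have "norm \<zeta> * a1 \<le> norm \<zeta> * a" by (intro mult_left_mono) (auto simp: a_def)
    then show ?thesis using a1(1)[of \<zeta>] by (simp add: mult.commute)
  qed
  moreover have "norm (Q \<zeta> \<zeta>) \<le> a * (norm \<zeta>)\<^sup>2" for \<zeta>
  proof -
    have "norm \<zeta> * norm \<zeta> * a2 \<le> norm \<zeta> * norm \<zeta> * a" by (intro mult_left_mono) (auto simp: a_def)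
    then show ?thesis using a2(1)[of \<zeta> \<zeta>] by (simp add: mult.commute power2_eq_square)
  qed
  ultimately show thesis using that[of a] a1 a2 by (auto simp: a_def)
qed

text \<open>This root is the parabolic scale of the estimates below: \<zeta> has first order in it
  and \<tau> second order, so the room is quadratic and the errors are cubic.\<close>

lemma le_sqrt_power2_add:
  fixes n \<tau> :: real
  assumes "\<tau> \<ge> 0" "n \<ge> 0"
  shows "n \<le> sqrt (n\<^sup>2 + \<tau>)" "(sqrt (n\<^sup>2 + \<tau>))\<^sup>2 = n\<^sup>2 + \<tau>"
  using assms by (auto intro: real_le_rsqrt)

text \<open>The complex number on the left is the second order jet of
  \<open>exp (- f \<zeta> - H \<zeta> \<zeta> - \<tau>)\<close>, whose modulus is exactly
  \<open>exp (- Re (f \<zeta>) - H \<zeta> \<zeta> - \<tau>)\<close>. The gain from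
  \<open>\<epsilon> * (norm \<zeta>)\<^sup>2\<close> and from \<tau> is quadratic in the parabolic
  scale and absorbs the cubic error together with the room.\<close>

lemma quadratic_jet_less_exp:
  fixes f :: "'a::real_normed_vector \<Rightarrow> complex" and H :: "'a \<Rightarrow> 'a \<Rightarrow> real"
  assumes f: "bounded_linear f" and H: "bounded_bilinear H" and \<epsilon>: "\<epsilon> > 0"
  obtains c \<sigma> where "c > 0" "\<sigma> > 0"
    "\<And>\<zeta> \<tau>. \<tau> > 0 \<Longrightarrow> (norm \<zeta>)\<^sup>2 + \<tau> \<le> \<sigma> \<Longrightarrow>
       cmod (1 - f \<zeta> + (f \<zeta>)\<^sup>2 / 2 - of_real (H \<zeta> \<zeta>) - of_real \<tau>) + c * ((norm \<zeta>)\<^sup>2 + \<tau>)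
       \<le> exp (- Re (f \<zeta>) - H \<zeta> \<zeta> + \<epsilon> * (norm \<zeta>)\<^sup>2)"
proof -
  obtain a where a: "a > 0" "\<And>\<zeta>. cmod (f \<zeta>) \<le> a * norm \<zeta>" "\<And>\<zeta>. \<bar>H \<zeta> \<zeta>\<bar> \<le> a * (norm \<zeta>)\<^sup>2" "a \<ge> 1"
    using norm_quadratic_bounds[OF f H, of 1] by (metis real_norm_def)
  obtain K where K: "K \<ge> 0" "\<And>s p r. 0 \<le> s \<Longrightarrow> s \<le> 1 \<Longrightarrow> cmod p \<le> a * s \<Longrightarrow> cmod r \<le> a * s\<^sup>2 \<Longrightarrow>
       cmod (exp (p + r) - (1 + p + r + p\<^sup>2 / 2)) \<le> K * s ^ 3"
    using exp_quadratic_error[of a] a by auto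
  \<comment> \<open>\<open>exp (- 2 * a)\<close> bounds the factor \<open>E\<close> below;
    \<epsilon> and 1/2 are the rates gained from \<open>(norm \<zeta>)\<^sup>2\<close> and from
    \<tau>.\<close>
  define m where "m = exp (- 2 * a) * min \<epsilon> (1/2)"
  have m: "m > 0" using \<epsilon> by (simp add: m_def)
  define L where "L = K + 1"
  have L: "L > 0" "K \<le> L" using K by (auto simp: L_def)
  \<comment> \<open>Half of \<open>m\<close> is spent on the cubic error, the other half becomes the
    constant \<open>c\<close>.\<close>
  define s0 where "s0 = min 1 (m / (2 * L))"
  have s0: "s0 > 0" "s0 \<le> 1" "K * s0 \<le> m / 2"
  proof -
    have "K * s0 \<le> L * (m / (2 * L))" using L m by (intro mult_mono) (auto simp: s0_def)
    then show "K * s0 \<le> m / 2" using L by simp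
  qed (use L m in \<open>auto simp: s0_def\<close>)
  show thesis
  proof (rule that[of "m / 2" "s0\<^sup>2"])
    fix \<zeta> :: 'a and \<tau> :: real assume \<tau>: "\<tau> > 0" and small: "(norm \<zeta>)\<^sup>2 + \<tau> \<le> s0\<^sup>2"
    define s where "s = sqrt ((norm \<zeta>)\<^sup>2 + \<tau>)"
    have s: "norm \<zeta> \<le> s" "s\<^sup>2 = (norm \<zeta>)\<^sup>2 + \<tau>" "0 \<le> s"
      using le_sqrt_power2_add[of \<tau> "norm \<zeta>"] \<tau> by (auto simp: s_def)
    have ss: "s \<le> s0" by (rule power2_le_imp_le) (use small s0 s(2) in auto)
    have \<tau>1: "\<tau> \<le> 1"
    proof -
      have "s0\<^sup>2 \<le> 1" using s0 by (simp add: power_le_one)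
      then show ?thesis using small zero_le_power2[of "norm \<zeta>"] by linarith
    qed
    define E where "E = exp (- Re (f \<zeta>) - H \<zeta> \<zeta>)"
    have E: "E \<ge> exp (- 2 * a)"
    proof -
      have "Re (f \<zeta>) \<le> a * norm \<zeta>" using a(2)[of \<zeta>] complex_Re_le_cmod[of "f \<zeta>"] by linarith
      also have "\<dots> \<le> a * 1" using a s ss s0 by (intro mult_left_mono) auto
      finally have 1: "Re (f \<zeta>) \<le> a" by simp
      have "norm \<zeta> \<le> 1" using s ss s0 by simp
      then have "a * (norm \<zeta>)\<^sup>2 \<le> a * 1" using a by (intro mult_left_mono) (auto simp: power_le_one)
      then have "H \<zeta> \<zeta> \<le> a" using a(3)[of \<zeta>] by linarith
      with 1 show ?thesis unfolding E_def by simp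
    qed
    define p r where "p = - f \<zeta>" and "r = - of_real (H \<zeta> \<zeta>) - (of_real \<tau> :: complex)"
    have p: "cmod p \<le> a * s"
      using order.trans[OF a(2)[of \<zeta>] mult_left_mono[OF s(1), of a]] a(1) by (simp add: p_def)
    have r: "cmod r \<le> a * s\<^sup>2"
    proof -
      have "r = of_real (- H \<zeta> \<zeta> - \<tau>)" by (simp add: r_def)
      then have "cmod r \<le> \<bar>H \<zeta> \<zeta>\<bar> + \<tau>" using \<tau> by (simp only: norm_of_real)
      also have "\<dots> \<le> a * (norm \<zeta>)\<^sup>2 + a * \<tau>"
        using a(3)[of \<zeta>] a(4) \<tau> by (intro add_mono) (auto simp: mult_le_cancel_right1)
      finally show ?thesis by (simp add: s algebra_simps)
    qed
    have ex: "cmod (exp (p + r)) = E * exp (- \<tau>)"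
      by (simp add: norm_exp_eq_Re p_def r_def E_def flip: exp_add)
    have "cmod (1 + p + r + p\<^sup>2 / 2) \<le> cmod (exp (p + r)) + K * s ^ 3"
      using K(2)[OF s(3) _ p r] ss s0
        norm_triangle_ineq3[of "1 + p + r + p\<^sup>2 / 2" "exp (p + r)"] by (simp add: norm_minus_commute)
    also have "K * s ^ 3 \<le> m / 2 * s\<^sup>2"
    proof -
      have "K * s ^ 3 = (K * s) * s\<^sup>2" by (simp add: power2_eq_square power3_eq_cube)
      also have "\<dots> \<le> (K * s0) * s\<^sup>2" using ss K by (intro mult_right_mono mult_left_mono) auto
      also have "\<dots> \<le> m / 2 * s\<^sup>2" using s0 by (intro mult_right_mono) auto
      finally show ?thesis .
    qed
    also have "cmod (exp (p + r)) \<le> E * (1 - \<tau> / 2)"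
    proof -
      have "exp (- \<tau>) \<le> 1 - \<tau> / 2"
      proof -
        have "1 + \<tau> \<le> exp \<tau>" by (rule exp_ge_add_one_self)
        then have "exp (- \<tau>) \<le> 1 / (1 + \<tau>)" using \<tau> by (simp add: exp_minus divide_simps)
        also have "\<dots> \<le> 1 - \<tau> / 2" using \<tau> \<tau>1 by (simp add: divide_simps algebra_simps mult_left_le)
        finally show ?thesis .
      qed
      then show ?thesis unfolding ex by (intro mult_left_mono) (auto simp: E_def)
    qed
    also have "1 + p + r + p\<^sup>2 / 2 = 1 - f \<zeta> + (f \<zeta>)\<^sup>2 / 2 - of_real (H \<zeta> \<zeta>) - of_real \<tau>"
      by (simp add: p_def r_def)
    finally have 1: "cmod (1 - f \<zeta> + (f \<zeta>)\<^sup>2 / 2 - of_real (H \<zeta> \<zeta>) - of_real \<tau>)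
      \<le> E * (1 - \<tau> / 2) + m / 2 * s\<^sup>2" by simp
    have "m * s\<^sup>2 = exp (- 2 * a) * (min \<epsilon> (1/2) * (norm \<zeta>)\<^sup>2 + min \<epsilon> (1/2) * \<tau>)"
      by (simp add: m_def s algebra_simps)
    also have "\<dots> \<le> E * (\<epsilon> * (norm \<zeta>)\<^sup>2 + \<tau> / 2)"
    proof (intro mult_mono add_mono E)
      have "min \<epsilon> (1/2) * \<tau> \<le> (1/2) * \<tau>" using \<tau> by (intro mult_right_mono) auto
      then show "min \<epsilon> (1/2) * \<tau> \<le> \<tau> / 2" by simp
    qed (use \<epsilon> \<tau> in \<open>auto simp: E_def intro!: mult_right_mono\<close>)
    finally have 2: "m * s\<^sup>2 \<le> E * (\<epsilon> * (norm \<zeta>)\<^sup>2 + \<tau> / 2)" .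
    have "E * (1 - \<tau> / 2) + m * s\<^sup>2 \<le> E * (1 + \<epsilon> * (norm \<zeta>)\<^sup>2)"
      using 2 by (simp add: algebra_simps)
    also have "\<dots> \<le> E * exp (\<epsilon> * (norm \<zeta>)\<^sup>2)"
      by (intro mult_left_mono) (auto simp: E_def)
    also have "\<dots> = exp (- Re (f \<zeta>) - H \<zeta> \<zeta> + \<epsilon> * (norm \<zeta>)\<^sup>2)" by (simp add: E_def flip: exp_add)
    finally show "cmod (1 - f \<zeta> + (f \<zeta>)\<^sup>2 / 2 - of_real (H \<zeta> \<zeta>) - of_real \<tau>) + m / 2 * ((norm \<zeta>)\<^sup>2 + \<tau>)
       \<le> exp (- Re (f \<zeta>) - H \<zeta> \<zeta> + \<epsilon> * (norm \<zeta>)\<^sup>2)"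
      using 1 unfolding s(2) by linarith
  qed (use m s0 in auto)
qed

subsection \<open>Exponential coordinates\<close>

definition Re_vec :: "complex ^ 'n \<Rightarrow> real ^ 'n" where
  "Re_vec z = (\<chi> i. Re (z $ i))"

definition Im_vec :: "complex ^ 'n \<Rightarrow> real ^ 'n" where
  "Im_vec z = (\<chi> i. Im (z $ i))"

definition of_real_vec :: "real ^ 'n \<Rightarrow> complex ^ 'n" where
  "of_real_vec x = (\<chi> i. of_real (x $ i))"

definition exp_vec :: "complex ^ 'n \<Rightarrow> complex ^ 'n" where
  "exp_vec z = (\<chi> i. exp (z $ i))"

lemma norm_vec_le_of_component_le:
  fixes x :: "'a::real_normed_vector ^ 'n"
  assumes "\<And>i. norm (x $ i) \<le> b"
  shows "norm x \<le> real CARD('n) * b"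
proof -
  have "norm x \<le> (\<Sum>i\<in>UNIV. norm (x $ i))"
    unfolding norm_vec_def by (rule L2_set_le_sum) simp
  also have "\<dots> \<le> (\<Sum>i\<in>(UNIV::'n set). b)" by (intro sum_mono assms)
  finally show ?thesis by simp
qed

lemma abs_ln_cmod_one_plus:
  assumes "cmod \<theta> \<le> 1 / 2"
  shows "\<bar>ln (cmod (1 + \<theta>))\<bar> \<le> 2 * cmod \<theta>"
proof -
  define t where "t = cmod (1 + \<theta>) - 1"
  have t: "\<bar>t\<bar> \<le> cmod \<theta>"
    unfolding t_def by (metis add_diff_cancel_left' norm_one norm_triangle_ineq3)
  have "\<bar>ln (1 + t)\<bar> \<le> \<bar>t\<bar> + 2 * t\<^sup>2"
    using abs_ln_one_plus_x_minus_x_bound[of t] t assms by simp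
  also have "2 * t\<^sup>2 = 2 * \<bar>t\<bar> * \<bar>t\<bar>" by (simp add: power2_eq_square)
  also have "\<bar>t\<bar> + \<dots> \<le> \<bar>t\<bar> + 1 * \<bar>t\<bar>" using t assms by (intro add_mono mult_right_mono) auto
  also have "\<dots> \<le> 2 * cmod \<theta>" using t by simp
  finally show ?thesis by (simp add: t_def)
qed

lemma abs_exp_minus_one:
  fixes t :: real
  assumes "\<bar>t\<bar> \<le> 1"
  shows "\<bar>exp t - 1\<bar> \<le> 3 * \<bar>t\<bar>"
proof -
  have "\<bar>exp t - 1\<bar> \<le> exp \<bar>t\<bar> * \<bar>t\<bar>" using Taylor_exp_field[of t 0] by simp
  also have "\<dots> \<le> exp 1 * \<bar>t\<bar>" using assms by (intro mult_right_mono) auto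
  also have "\<dots> \<le> 3 * \<bar>t\<bar>" using exp_le by (intro mult_right_mono) auto
  finally show ?thesis .
qed

lemma mem_Omega: "z \<in> Omega V \<longleftrightarrow> (\<forall>i. z $ i \<noteq> 0) \<and> (\<chi> i. ln (cmod (z $ i))) \<in> V"
  by (simp add: Omega_def)

lemma exp_vec_mem_Omega [simp]: "exp_vec z \<in> Omega V \<longleftrightarrow> Re_vec z \<in> V"
  by (simp add: mem_Omega exp_vec_def Re_vec_def norm_exp_eq_Re)

text \<open>Products of vectors are componentwise, so the expression subtracted is the second order
  jet of \<open>exp_vec\<close> along the quadratic family, and the error is cubic in the parabolic
  scale. The bound by \<open>ln M\<close> keeps the components of the exponential between
  \<open>1 / M\<close> and \<open>M\<close> in modulus.\<close>

lemma exp_jet_estimate: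
  fixes P :: "'a::real_normed_vector \<Rightarrow> complex ^ 'n" and R :: "'a \<Rightarrow> 'a \<Rightarrow> complex ^ 'n"
  assumes P: "bounded_linear P" and R: "bounded_bilinear R"
  obtains K M where "K > 0" "M \<ge> 1"
    "\<And>\<zeta> \<tau> i. \<tau> > 0 \<Longrightarrow> (norm \<zeta>)\<^sup>2 + \<tau> \<le> 1 \<Longrightarrow>
       cmod (exp ((y + P \<zeta> + R \<zeta> \<zeta> + \<tau> *\<^sub>R \<mu>) $ i) -
         (exp_vec y * (1 + P \<zeta> + R \<zeta> \<zeta> + \<tau> *\<^sub>R \<mu> + (1/2) *\<^sub>R (P \<zeta> * P \<zeta>))) $ i)
         \<le> K * sqrt ((norm \<zeta>)\<^sup>2 + \<tau>) * ((norm \<zeta>)\<^sup>2 + \<tau>)"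
    "\<And>\<zeta> \<tau> i. \<tau> > 0 \<Longrightarrow> (norm \<zeta>)\<^sup>2 + \<tau> \<le> 1 \<Longrightarrow>
       \<bar>Re ((y + P \<zeta> + R \<zeta> \<zeta> + \<tau> *\<^sub>R \<mu>) $ i)\<bar> \<le> ln M"
proof -
  obtain a where a: "a > 0" "\<And>\<zeta>. norm (P \<zeta>) \<le> a * norm \<zeta>" "\<And>\<zeta>. norm (R \<zeta> \<zeta>) \<le> a * (norm \<zeta>)\<^sup>2"
    "a \<ge> norm \<mu>"
    using norm_quadratic_bounds[OF P R, of "norm \<mu>"] by metis
  obtain K where K: "K \<ge> 0" "\<And>s p r. 0 \<le> s \<Longrightarrow> s \<le> 1 \<Longrightarrow> cmod p \<le> a * s \<Longrightarrow> cmod r \<le> a * s\<^sup>2 \<Longrightarrow>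
       cmod (exp (p + r) - (1 + p + r + p\<^sup>2 / 2)) \<le> K * s ^ 3"
    using exp_quadratic_error[of a] a by auto
  define M where "M = exp (norm y + 2 * a)"
  have bds: "cmod (P \<zeta> $ i) \<le> a * sqrt ((norm \<zeta>)\<^sup>2 + \<tau>)"
      "cmod ((R \<zeta> \<zeta> + \<tau> *\<^sub>R \<mu>) $ i) \<le> a * (sqrt ((norm \<zeta>)\<^sup>2 + \<tau>))\<^sup>2"
    if "\<tau> > 0" for \<zeta> i and \<tau> :: real
  proof -
    have s: "norm \<zeta> \<le> sqrt ((norm \<zeta>)\<^sup>2 + \<tau>)" "(sqrt ((norm \<zeta>)\<^sup>2 + \<tau>))\<^sup>2 = (norm \<zeta>)\<^sup>2 + \<tau>"
      using le_sqrt_power2_add[of \<tau> "norm \<zeta>"] that by auto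
    have "cmod (P \<zeta> $ i) \<le> a * norm \<zeta>" using Finite_Cartesian_Product.norm_nth_le[of "P \<zeta>" i] a(2)[of \<zeta>] by linarith
    also have "\<dots> \<le> a * sqrt ((norm \<zeta>)\<^sup>2 + \<tau>)" using s a by (intro mult_left_mono) auto
    finally show "cmod (P \<zeta> $ i) \<le> a * sqrt ((norm \<zeta>)\<^sup>2 + \<tau>)" .
    have "cmod ((R \<zeta> \<zeta> + \<tau> *\<^sub>R \<mu>) $ i) \<le> norm (R \<zeta> \<zeta> + \<tau> *\<^sub>R \<mu>)" by (rule Finite_Cartesian_Product.norm_nth_le)
    also have "\<dots> \<le> norm (R \<zeta> \<zeta>) + \<tau> * norm \<mu>"
      using norm_triangle_ineq[of "R \<zeta> \<zeta>" "\<tau> *\<^sub>R \<mu>"] that by simp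
    also have "\<dots> \<le> a * (norm \<zeta>)\<^sup>2 + \<tau> * a" using a that by (intro add_mono mult_left_mono) auto
    finally show "cmod ((R \<zeta> \<zeta> + \<tau> *\<^sub>R \<mu>) $ i) \<le> a * (sqrt ((norm \<zeta>)\<^sup>2 + \<tau>))\<^sup>2"
      unfolding s(2) by (simp add: algebra_simps)
  qed
  show thesis
  proof (rule that[of "exp (norm y) * K + 1" M])
    fix \<zeta> :: 'a and i and \<tau> :: real assume \<tau>: "\<tau> > 0" and small: "(norm \<zeta>)\<^sup>2 + \<tau> \<le> 1"
    define s where "s = sqrt ((norm \<zeta>)\<^sup>2 + \<tau>)"
    have s: "0 \<le> s" "s \<le> 1" "s\<^sup>2 = (norm \<zeta>)\<^sup>2 + \<tau>" using small \<tau> by (auto simp: s_def)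
    have p: "cmod (P \<zeta> $ i) \<le> a * s" and r: "cmod ((R \<zeta> \<zeta> + \<tau> *\<^sub>R \<mu>) $ i) \<le> a * s\<^sup>2"
      using bds[OF \<tau>] by (auto simp: s_def)
    have y: "\<bar>Re (y $ i)\<bar> \<le> norm y"
      using abs_Re_le_cmod Finite_Cartesian_Product.norm_nth_le order_trans by blast
    let ?E = "exp (P \<zeta> $ i + (R \<zeta> \<zeta> + \<tau> *\<^sub>R \<mu>) $ i) - (1 + P \<zeta> $ i + (R \<zeta> \<zeta> + \<tau> *\<^sub>R \<mu>) $ i + (P \<zeta> $ i)\<^sup>2 / 2)"
    have "exp ((y + P \<zeta> + R \<zeta> \<zeta> + \<tau> *\<^sub>R \<mu>) $ i) -
         (exp_vec y * (1 + P \<zeta> + R \<zeta> \<zeta> + \<tau> *\<^sub>R \<mu> + (1/2) *\<^sub>R (P \<zeta> * P \<zeta>))) $ i = exp (y $ i) * ?E"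
      by (simp add: exp_vec_def power2_eq_square algebra_simps exp_add)
    then have "cmod (exp ((y + P \<zeta> + R \<zeta> \<zeta> + \<tau> *\<^sub>R \<mu>) $ i) -
         (exp_vec y * (1 + P \<zeta> + R \<zeta> \<zeta> + \<tau> *\<^sub>R \<mu> + (1/2) *\<^sub>R (P \<zeta> * P \<zeta>))) $ i) = exp (Re (y $ i)) * cmod ?E"
      by (simp add: norm_mult norm_exp_eq_Re)
    also have "\<dots> \<le> exp (norm y) * (K * s ^ 3)"
      using y K(2)[OF s(1,2) p r] by (intro mult_mono) auto
    also have "\<dots> = (exp (norm y) * K) * (s * s\<^sup>2)" by (simp add: power3_eq_cube power2_eq_square)
    also have "\<dots> \<le> (exp (norm y) * K + 1) * (s * s\<^sup>2)" using s(1) by (intro mult_right_mono mult_nonneg_nonneg) auto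
    finally show "cmod (exp ((y + P \<zeta> + R \<zeta> \<zeta> + \<tau> *\<^sub>R \<mu>) $ i) -
         (exp_vec y * (1 + P \<zeta> + R \<zeta> \<zeta> + \<tau> *\<^sub>R \<mu> + (1/2) *\<^sub>R (P \<zeta> * P \<zeta>))) $ i)
         \<le> (exp (norm y) * K + 1) * sqrt ((norm \<zeta>)\<^sup>2 + \<tau>) * ((norm \<zeta>)\<^sup>2 + \<tau>)"
      by (simp add: s(1) s(3)[symmetric] mult.assoc)
    have "a * s \<le> a * 1" "a * s\<^sup>2 \<le> a * 1" using s a(1) small by (auto intro!: mult_left_mono)
    then have "\<bar>Re (P \<zeta> $ i)\<bar> \<le> a" "\<bar>Re ((R \<zeta> \<zeta> + \<tau> *\<^sub>R \<mu>) $ i)\<bar> \<le> a"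
      using p r abs_Re_le_cmod by (metis mult.right_neutral order_trans)+
    then show "\<bar>Re ((y + P \<zeta> + R \<zeta> \<zeta> + \<tau> *\<^sub>R \<mu>) $ i)\<bar> \<le> ln M"
      using y unfolding M_def by simp
  next
    show "exp (norm y) * K + 1 > 0" using K by (simp add: add_nonneg_pos)
    show "M \<ge> 1" using a by (simp add: M_def)
  qed
qed

text \<open>The jet differs from the true image of the family by a cubic error, and
  \<open>exp_vec\<close> distorts small displacements near \<open>y\<close> by bounded factors. So
  for small \<zeta> and \<tau> a smaller constant \<open>c\<close> survives in either direction. The
  term \<open>(1/2) *\<^sub>R (P \<zeta> * P \<zeta>')\<close> comes from the second derivative of
  \<open>exp\<close>.\<close>

lemma touches_exp:
  fixes P :: "'a::real_normed_vector \<Rightarrow> complex ^ 'n" and R :: "'a \<Rightarrow> 'a \<Rightarrow> complex ^ 'n"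
  assumes P: "bounded_linear P" and R: "bounded_bilinear R"
  shows "touches V S (Re_vec y) (\<lambda>\<zeta>. Re_vec (P \<zeta>)) (\<lambda>\<zeta> \<zeta>'. Re_vec (R \<zeta> \<zeta>')) (Re_vec \<mu>) \<longleftrightarrow>
    touches (Omega V) S (exp_vec y) (\<lambda>\<zeta>. exp_vec y * P \<zeta>)
      (\<lambda>\<zeta> \<zeta>'. exp_vec y * (R \<zeta> \<zeta>' + (1/2) *\<^sub>R (P \<zeta> * P \<zeta>'))) (exp_vec y * \<mu>)"
    (is "?L \<longleftrightarrow> ?R")
proof -
  define Z where "Z \<zeta> \<tau> = y + P \<zeta> + R \<zeta> \<zeta> + \<tau> *\<^sub>R \<mu>" for \<zeta> \<tau>
  define G where "G \<zeta> \<tau> = exp_vec y * (1 + P \<zeta> + R \<zeta> \<zeta> + \<tau> *\<^sub>R \<mu> + (1/2) *\<^sub>R (P \<zeta> * P \<zeta>))" for \<zeta> \<tau>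
  obtain K M where K: "K > 0" and M: "M \<ge> 1" and
    KG: "\<And>\<zeta> \<tau> i. \<tau> > 0 \<Longrightarrow> (norm \<zeta>)\<^sup>2 + \<tau> \<le> 1 \<Longrightarrow>
       cmod (exp (Z \<zeta> \<tau> $ i) - G \<zeta> \<tau> $ i) \<le> K * sqrt ((norm \<zeta>)\<^sup>2 + \<tau>) * ((norm \<zeta>)\<^sup>2 + \<tau>)" and
    MZ: "\<And>\<zeta> \<tau> i. \<tau> > 0 \<Longrightarrow> (norm \<zeta>)\<^sup>2 + \<tau> \<le> 1 \<Longrightarrow> \<bar>Re (Z \<zeta> \<tau> $ i)\<bar> \<le> ln M"
    using exp_jet_estimate[OF P R, of y \<mu>] unfolding Z_def G_def by metis
  have Z_eq: "Re_vec y + Re_vec (P \<zeta>) + Re_vec (R \<zeta> \<zeta>) + \<tau> *\<^sub>R Re_vec \<mu> = Re_vec (Z \<zeta> \<tau>)" for \<zeta> \<tau>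
    by (simp add: Re_vec_def Z_def vec_eq_iff)
  have G_eq: "exp_vec y + exp_vec y * P \<zeta> + exp_vec y * (R \<zeta> \<zeta> + (1/2) *\<^sub>R (P \<zeta> * P \<zeta>)) + \<tau> *\<^sub>R (exp_vec y * \<mu>)
      = G \<zeta> \<tau>" for \<zeta> \<tau>
    by (simp add: G_def vec_eq_iff algebra_simps)
  define N where "N = real CARD('n)"
  have N: "N \<ge> 1" unfolding N_def by (simp add: Suc_leI)
  have Ks: "K * sqrt \<sigma> \<le> b" if "\<sigma> \<le> (b / K)\<^sup>2" "b > 0" for \<sigma> b
  proof -
    have "sqrt \<sigma> \<le> b / K" using that K by (simp add: real_le_lsqrt)
    then show ?thesis using K by (simp add: field_simps)
  qed
  have expZ: "cmod (exp (Z \<zeta> \<tau> $ i)) \<le> M" "cmod (exp (Z \<zeta> \<tau> $ i)) \<ge> 1 / M"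
    if "\<tau> > 0" "(norm \<zeta>)\<^sup>2 + \<tau> \<le> 1" for \<zeta> \<tau> i
  proof -
    have "exp (Re (Z \<zeta> \<tau> $ i)) \<le> exp (ln M)" "exp (Re (Z \<zeta> \<tau> $ i)) \<ge> exp (- ln M)"
      using MZ[OF that, of i] by (simp_all only: exp_le_cancel_iff)
    then show "cmod (exp (Z \<zeta> \<tau> $ i)) \<le> M" "cmod (exp (Z \<zeta> \<tau> $ i)) \<ge> 1 / M"
      using M by (simp_all add: norm_exp_eq_Re exp_minus inverse_eq_divide)
  qed
  show ?thesis
  proof
    assume ?R
    then obtain c \<sigma>0 where w: "exp_vec y \<notin> Omega V" and c: "c > 0" "\<sigma>0 > 0" and
      sub: "\<And>\<zeta> \<tau>. \<zeta> \<in> S \<Longrightarrow> \<tau> > 0 \<Longrightarrow> (norm \<zeta>)\<^sup>2 + \<tau> \<le> \<sigma>0 \<Longrightarrow>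
        ball (G \<zeta> \<tau>) (c * ((norm \<zeta>)\<^sup>2 + \<tau>)) \<subseteq> Omega V"
      unfolding touches_def G_eq by metis
    \<comment> \<open>\<open>N\<close> passes from components to the norm, \<open>M\<close> bounds
      the components of the exponential and 3 comes from \<open>abs_exp_minus_one\<close>. This uses
      up \<open>c / 2\<close>, and the jet error controlled by \<open>b\<close> uses
      \<open>c / 4\<close>.\<close>
    define c' where "c' = min 1 (c / (6 * M * N))"
    define b where "b = c / (4 * N)"
    define \<sigma>1 where "\<sigma>1 = min 1 (min \<sigma>0 ((b / K)\<^sup>2))"
    have pos: "c' > 0" "\<sigma>1 > 0" "b > 0" using c M N K by (auto simp: c'_def \<sigma>1_def b_def)
    have c'N: "N * (3 * M * c') \<le> c / 2"
    proof -
      have "N * (3 * M * c') \<le> N * (3 * M * (c / (6 * M * N)))"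
        using M N by (intro mult_left_mono) (auto simp: c'_def)
      also have "\<dots> = c / 2" using M N by simp
      finally show ?thesis .
    qed
    have "ball (Re_vec (Z \<zeta> \<tau>)) (c' * ((norm \<zeta>)\<^sup>2 + \<tau>)) \<subseteq> V"
      if \<zeta>: "\<zeta> \<in> S" and \<tau>: "\<tau> > 0" and small: "(norm \<zeta>)\<^sup>2 + \<tau> \<le> \<sigma>1" for \<zeta> \<tau>
    proof
      fix x assume x: "x \<in> ball (Re_vec (Z \<zeta> \<tau>)) (c' * ((norm \<zeta>)\<^sup>2 + \<tau>))"
      define \<sigma> where "\<sigma> = (norm \<zeta>)\<^sup>2 + \<tau>"
      have \<sigma>: "\<sigma> > 0" "\<sigma> \<le> 1" "\<sigma> \<le> \<sigma>0" "\<sigma> \<le> (b / K)\<^sup>2"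
        using small \<tau> by (auto simp: \<sigma>_def \<sigma>1_def add_nonneg_pos)
      \<comment> \<open>Lifts \<open>x\<close> into the tube with the imaginary part of the family,
        so that only the real displacement \<open>t\<close> separates the two in each
        component.\<close>
      define z where "z = (\<chi> i. Complex (x $ i) (Im (Z \<zeta> \<tau> $ i)))"
      have "cmod ((G \<zeta> \<tau> - exp_vec z) $ i) \<le> (3 * M * c' + b) * \<sigma>" for i
      proof -
        define t where "t = x $ i - Re (Z \<zeta> \<tau> $ i)"
        have "\<bar>t\<bar> \<le> norm (x - Re_vec (Z \<zeta> \<tau>))"
          using Finite_Cartesian_Product.norm_nth_le[of "x - Re_vec (Z \<zeta> \<tau>)" i] by (simp add: t_def Re_vec_def)
        also have "\<dots> \<le> c' * \<sigma>" using x by (simp add: \<sigma>_def dist_norm norm_minus_commute)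
        finally have t: "\<bar>t\<bar> \<le> c' * \<sigma>" .
        also have "\<dots> \<le> 1 * 1" using \<sigma> pos by (intro mult_mono) (auto simp: c'_def)
        finally have t1: "\<bar>t\<bar> \<le> 1" by simp
        have "z $ i = Z \<zeta> \<tau> $ i + of_real t" by (simp add: z_def t_def complex_eq_iff)
        then have "exp_vec z $ i - exp (Z \<zeta> \<tau> $ i) = exp (Z \<zeta> \<tau> $ i) * of_real (exp t - 1)"
          by (simp add: exp_vec_def exp_add exp_of_real algebra_simps)
        then have "cmod (exp_vec z $ i - exp (Z \<zeta> \<tau> $ i)) = cmod (exp (Z \<zeta> \<tau> $ i)) * \<bar>exp t - 1\<bar>"
          by (simp only: norm_mult norm_of_real)
        also have "\<dots> \<le> M * (3 * (c' * \<sigma>))"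
          using expZ(1)[OF \<tau>, of \<zeta> i] \<sigma> abs_exp_minus_one[OF t1] t M
          by (intro mult_mono) (auto simp: \<sigma>_def)
        finally have 1: "cmod (exp_vec z $ i - exp (Z \<zeta> \<tau> $ i)) \<le> M * (3 * (c' * \<sigma>))" .
        have "cmod (exp (Z \<zeta> \<tau> $ i) - G \<zeta> \<tau> $ i) \<le> K * sqrt \<sigma> * \<sigma>"
          using KG[OF \<tau>, of \<zeta> i] \<sigma> by (simp add: \<sigma>_def)
        also have "\<dots> \<le> b * \<sigma>" using Ks[OF \<sigma>(4) pos(3)] \<sigma> by (intro mult_right_mono) auto
        finally have 2: "cmod (exp (Z \<zeta> \<tau> $ i) - G \<zeta> \<tau> $ i) \<le> b * \<sigma>" .
        have "cmod ((G \<zeta> \<tau> - exp_vec z) $ i) \<le> M * (3 * (c' * \<sigma>)) + b * \<sigma>"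
          using norm_triangle_ineq[of "exp_vec z $ i - exp (Z \<zeta> \<tau> $ i)" "exp (Z \<zeta> \<tau> $ i) - G \<zeta> \<tau> $ i"] 1 2
          by (simp add: norm_minus_commute)
        then show ?thesis by (simp add: algebra_simps)
      qed
      then have "norm (G \<zeta> \<tau> - exp_vec z) \<le> N * ((3 * M * c' + b) * \<sigma>)"
        unfolding N_def by (rule norm_vec_le_of_component_le)
      also have "\<dots> = (N * (3 * M * c') + N * b) * \<sigma>" by (simp add: algebra_simps)
      also have "\<dots> \<le> (c / 2 + c / 4) * \<sigma>"
        using c'N N \<sigma> by (intro mult_right_mono add_mono) (auto simp: b_def)
      also have "\<dots> < c * \<sigma>" using c \<sigma> by simp
      finally have "exp_vec z \<in> ball (G \<zeta> \<tau>) (c * \<sigma>)" by (simp add: dist_norm)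
      then have "exp_vec z \<in> Omega V" using sub[OF \<zeta> \<tau>] \<sigma>(3) by (auto simp: \<sigma>_def)
      moreover have "Re_vec z = x" by (simp add: Re_vec_def z_def vec_eq_iff)
      ultimately show "x \<in> V" by simp
    qed
    then show ?L
      by (intro touchesI[of _ _ c' \<sigma>1] pos) (use w in \<open>auto simp: Z_eq\<close>)
  next
    assume ?L
    then obtain c \<sigma>0 where w: "Re_vec y \<notin> V" and c: "c > 0" "\<sigma>0 > 0" and
      sub: "\<And>\<zeta> \<tau>. \<zeta> \<in> S \<Longrightarrow> \<tau> > 0 \<Longrightarrow> (norm \<zeta>)\<^sup>2 + \<tau> \<le> \<sigma>0 \<Longrightarrow>
        ball (Re_vec (Z \<zeta> \<tau>)) (c * ((norm \<zeta>)\<^sup>2 + \<tau>)) \<subseteq> V"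
      unfolding touches_def Z_eq by metis
    \<comment> \<open>The first bound makes the relative error \<theta> at most 1/2, where
      \<open>abs_ln_cmod_one_plus\<close> applies; the second limits the displacement in
      \<open>V\<close> to half of the room.\<close>
    define c' where "c' = min (1 / (4 * M)) (c / (8 * M * N))"
    define \<sigma>1 where "\<sigma>1 = min 1 (min \<sigma>0 ((c' / K)\<^sup>2))"
    have c': "c' > 0" using c M N by (auto simp: c'_def)
    have pos: "\<sigma>1 > 0" using c c' K by (auto simp: \<sigma>1_def)
    have c'M: "M * (2 * c') \<le> 1 / 2" "N * (2 * (M * (2 * c'))) \<le> c / 2"
    proof -
      have "M * (2 * c') \<le> M * (2 * (1 / (4 * M)))" using M by (intro mult_left_mono) (auto simp: c'_def)
      then show "M * (2 * c') \<le> 1 / 2" using M by simp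
      have "N * (2 * (M * (2 * c'))) \<le> N * (2 * (M * (2 * (c / (8 * M * N)))))"
        using M N by (intro mult_left_mono) (auto simp: c'_def)
      then show "N * (2 * (M * (2 * c'))) \<le> c / 2" using M N by simp
    qed
    have "ball (G \<zeta> \<tau>) (c' * ((norm \<zeta>)\<^sup>2 + \<tau>)) \<subseteq> Omega V"
      if \<zeta>: "\<zeta> \<in> S" and \<tau>: "\<tau> > 0" and small: "(norm \<zeta>)\<^sup>2 + \<tau> \<le> \<sigma>1" for \<zeta> \<tau>
    proof
      fix v assume v: "v \<in> ball (G \<zeta> \<tau>) (c' * ((norm \<zeta>)\<^sup>2 + \<tau>))"
      define \<sigma> where "\<sigma> = (norm \<zeta>)\<^sup>2 + \<tau>"
      have \<sigma>: "\<sigma> > 0" "\<sigma> \<le> 1" "\<sigma> \<le> \<sigma>0" "\<sigma> \<le> (c' / K)\<^sup>2"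
        using small \<tau> by (auto simp: \<sigma>_def \<sigma>1_def add_nonneg_pos)
      \<comment> \<open>The deviation relative to the true exponential: in logarithmic coordinates
        it becomes the additive term \<open>ln (cmod (1 + \<theta> i))\<close>.\<close>
      define \<theta> where "\<theta> i = v $ i / exp (Z \<zeta> \<tau> $ i) - 1" for i
      have v_eq: "v $ i = exp (Z \<zeta> \<tau> $ i) * (1 + \<theta> i)" for i by (simp add: \<theta>_def)
      have \<theta>: "cmod (\<theta> i) \<le> M * (2 * c') * \<sigma>" for i
      proof -
        have "cmod (G \<zeta> \<tau> $ i - v $ i) \<le> c' * \<sigma>"
          using Finite_Cartesian_Product.norm_nth_le[of "G \<zeta> \<tau> - v" i] v by (simp add: \<sigma>_def dist_norm)
        moreover have "cmod (exp (Z \<zeta> \<tau> $ i) - G \<zeta> \<tau> $ i) \<le> K * sqrt \<sigma> * \<sigma>"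
          using KG[OF \<tau>, of \<zeta> i] \<sigma> by (simp add: \<sigma>_def)
        moreover have "K * sqrt \<sigma> * \<sigma> \<le> c' * \<sigma>" using Ks[OF \<sigma>(4) c'] \<sigma> by (intro mult_right_mono) auto
        ultimately have 1: "cmod (v $ i - exp (Z \<zeta> \<tau> $ i)) \<le> 2 * c' * \<sigma>"
          using norm_triangle_ineq[of "exp (Z \<zeta> \<tau> $ i) - G \<zeta> \<tau> $ i" "G \<zeta> \<tau> $ i - v $ i"]
          by (simp add: norm_minus_commute)
        have "\<theta> i = (v $ i - exp (Z \<zeta> \<tau> $ i)) / exp (Z \<zeta> \<tau> $ i)"
          by (simp add: \<theta>_def diff_divide_distrib)
        then have "cmod (\<theta> i) = cmod (v $ i - exp (Z \<zeta> \<tau> $ i)) / cmod (exp (Z \<zeta> \<tau> $ i))"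
          by (simp add: norm_divide)
        also have "\<dots> \<le> (2 * c' * \<sigma>) / (1 / M)"
          using 1 expZ(2)[OF \<tau>, of \<zeta> i] \<sigma> c' M by (intro frac_le) (auto simp: \<sigma>_def)
        finally show ?thesis by (simp add: mult_ac)
      qed
      have \<theta>2: "cmod (\<theta> i) \<le> 1 / 2" for i
      proof -
        have "M * (2 * c') * \<sigma> \<le> M * (2 * c') * 1" using \<sigma> M c' by (intro mult_left_mono) auto
        then show ?thesis using \<theta>[of i] c'M(1) by linarith
      qed
      have nz: "1 + \<theta> i \<noteq> 0" for i
      proof
        assume "1 + \<theta> i = 0"
        then have "\<theta> i = - 1" by (simp add: add_eq_0_iff)
        then show False using \<theta>2[of i] by simp
      qed
      define x where "x = (\<chi> i. ln (cmod (v $ i)))"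
      have "norm ((Re_vec (Z \<zeta> \<tau>) - x) $ i) \<le> 2 * (M * (2 * c') * \<sigma>)" for i
      proof -
        have "ln (cmod (v $ i)) = Re (Z \<zeta> \<tau> $ i) + ln (cmod (1 + \<theta> i))"
          using nz[of i] by (simp add: v_eq norm_mult ln_mult norm_exp_eq_Re)
        then have "norm ((Re_vec (Z \<zeta> \<tau>) - x) $ i) = \<bar>ln (cmod (1 + \<theta> i))\<bar>"
          by (simp add: x_def Re_vec_def)
        also have "\<dots> \<le> 2 * cmod (\<theta> i)" by (rule abs_ln_cmod_one_plus[OF \<theta>2])
        finally show ?thesis using \<theta>[of i] by linarith
      qed
      then have "norm (Re_vec (Z \<zeta> \<tau>) - x) \<le> N * (2 * (M * (2 * c') * \<sigma>))"
        unfolding N_def by (rule norm_vec_le_of_component_le)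
      also have "\<dots> = (N * (2 * (M * (2 * c')))) * \<sigma>" by simp
      also have "\<dots> \<le> c / 2 * \<sigma>" using c'M(2) \<sigma> by (intro mult_right_mono) auto
      also have "\<dots> < c * \<sigma>" using c \<sigma> by simp
      finally have "x \<in> ball (Re_vec (Z \<zeta> \<tau>)) (c * \<sigma>)" by (simp add: dist_norm)
      then have "x \<in> V" using sub[OF \<zeta> \<tau>] \<sigma>(3) by (auto simp: \<sigma>_def)
      then show "v \<in> Omega V" using nz by (simp add: mem_Omega x_def v_eq)
    qed
    then show ?R
      by (intro touchesI[of _ _ c' \<sigma>1] pos c') (use w in \<open>auto simp: G_eq\<close>)
  qed
qed

subsection \<open>Violations obtained from touching families\<close>

lemma scaleR_eq_vector_scalar_mult: "(c *\<^sub>R (z :: complex ^ 'n)) = complex_of_real c *s z"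
  by (simp add: vec_eq_iff) (simp add: scaleR_conv_of_real)

lemma bounded_bilinear_add:
  fixes f g :: "'a::euclidean_space \<Rightarrow> 'b::euclidean_space \<Rightarrow> 'c::real_normed_vector"
  assumes "bounded_bilinear f" "bounded_bilinear g"
  shows "bounded_bilinear (\<lambda>x y. f x y + g x y)"
  using assms unfolding bilinear_conv_bounded_bilinear[symmetric] bilinear_def
  by (auto intro: linear_compose_add)

lemma subspace_of_complex_subspace:
  fixes S :: "(complex ^ 'n) set"
  assumes "vec.subspace S"
  shows "subspace S"
  using assms unfolding subspace_def vec.subspace_def scaleR_eq_vector_scalar_mult by blast

lemma bounded_linear_vector_scalar_mult: "bounded_linear (\<lambda>\<zeta>. \<zeta> *s (v :: complex ^ 'n))"
  by (rule linear_conv_bounded_linear[THEN iffD1], rule linearI)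
     (simp_all add: vec_eq_iff algebra_simps)

lemma bounded_linear_Blinfun_bilinear:
  assumes "bounded_bilinear \<gamma>"
  shows "bounded_linear (\<lambda>u. Blinfun (\<gamma> u))"
proof -
  have "\<gamma> = (\<lambda>u. blinfun_apply (Blinfun (\<gamma> u)))"
    by (rule ext)
       (rule bounded_linear_Blinfun_apply[OF bounded_bilinear.bounded_linear_right[OF assms], symmetric])
  from transfer_bounded_bilinear_bounded_linearI[OF this] show ?thesis
    using assms by simp
qed

lemma C2_derivs_on_quadratic:
  fixes \<beta> :: "'a::euclidean_space \<Rightarrow> 'a \<Rightarrow> real"
  assumes l: "bounded_linear l" and \<beta>: "bounded_bilinear \<beta>"
  shows "C2_derivs_on U (\<lambda>x. k + l (x - p) + \<beta> (x - p) (x - p))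
    (\<lambda>x. Blinfun (\<lambda>v. l v + (\<beta> (x - p) v + \<beta> v (x - p))))
    (\<lambda>x. Blinfun (\<lambda>u. Blinfun (\<lambda>v. \<beta> u v + \<beta> v u)))"
proof -
  interpret l: bounded_linear l by fact
  interpret \<beta>: bounded_bilinear \<beta> by fact
  define \<gamma> where "\<gamma> u v = \<beta> u v + \<beta> v u" for u v
  have b\<gamma>: "bounded_bilinear \<gamma>"
    unfolding \<gamma>_def by (intro bounded_bilinear_add \<beta> \<beta>.flip)
  note bl = bounded_bilinear.bounded_linear_right[OF b\<gamma>]
  note bT = bounded_linear_Blinfun_bilinear[OF b\<gamma>]
  have split: "Blinfun (\<lambda>v. l v + \<gamma> (x - p) v) = Blinfun l + Blinfun (\<gamma> (x - p))" for x
    by (rule blinfun_eqI)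
       (simp add: bounded_linear_Blinfun_apply bl l blinfun.add_left bounded_linear_add)
  have 1: "((\<lambda>x. k + l (x - p) + \<beta> (x - p) (x - p)) has_derivative
      blinfun_apply (Blinfun (\<lambda>v. l v + \<gamma> (x - p) v))) (at x)" for x
  proof -
    have "((\<lambda>x. k + l (x - p) + \<beta> (x - p) (x - p)) has_derivative
      (\<lambda>v. l v + \<gamma> (x - p) v)) (at x)"
      unfolding \<gamma>_def
      by (auto intro!: derivative_eq_intros l.has_derivative \<beta>.FDERIV simp: fun_eq_iff)
    then show ?thesis using l bl by (simp add: bounded_linear_Blinfun_apply bounded_linear_add)
  qed
  have 2: "((\<lambda>x. Blinfun (\<lambda>v. l v + \<gamma> (x - p) v)) has_derivative
      blinfun_apply (Blinfun (\<lambda>u. Blinfun (\<gamma> u)))) (at x)" for x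
    unfolding split bounded_linear_Blinfun_apply[OF bT]
    by (auto intro!: derivative_eq_intros bounded_linear.has_derivative[OF bT])
  show ?thesis
    unfolding C2_derivs_on_def \<gamma>_def[symmetric] using 1 2 by simp
qed

lemma harmonic_on_quadratic:
  fixes \<beta> :: "'a::euclidean_space \<Rightarrow> 'a \<Rightarrow> real"
  assumes l: "bounded_linear l" and \<beta>: "bounded_bilinear \<beta>" and "(\<Sum>b\<in>Basis. \<beta> b b) = 0"
  shows "harmonic_on UNIV (\<lambda>x. k + l x + \<beta> x x)"
proof -
  interpret \<beta>: bounded_bilinear \<beta> by fact
  have b: "bounded_bilinear (\<lambda>u v. \<beta> u v + \<beta> v u)" by (intro bounded_bilinear_add \<beta> \<beta>.flip)
  have "blinfun_apply (blinfun_apply (Blinfun (\<lambda>u. Blinfun (\<lambda>v. \<beta> u v + \<beta> v u))) b) b = 2 * \<beta> b b" for b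
    by (simp add: bounded_linear_Blinfun_apply bounded_linear_Blinfun_bilinear[OF b]
        bounded_bilinear.bounded_linear_right[OF b])
  moreover have "C2_derivs_on UNIV (\<lambda>x. k + l x + \<beta> x x)
    (\<lambda>x. Blinfun (\<lambda>v. l v + (\<beta> x v + \<beta> v x)))
    (\<lambda>x. Blinfun (\<lambda>u. Blinfun (\<lambda>v. \<beta> u v + \<beta> v u)))"
    using C2_derivs_on_quadratic[OF l \<beta>, of UNIV k 0] by simp
  ultimately show ?thesis
    unfolding harmonic_on_def using assms(3) by (auto simp flip: sum_distrib_left intro!: exI)
qed

text \<open>On a complex line the Laplacian of the quadratic part is a multiple of its sum over the
  basis 1 and \<i>, which cancels by the sign change. These polynomials are the barriers in the
  complex case.\<close>

lemma pluriharmonic_on_quadratic: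
  fixes \<beta> :: "complex ^ 'n \<Rightarrow> complex ^ 'n \<Rightarrow> real"
  assumes l: "bounded_linear l" and \<beta>: "bounded_bilinear \<beta>"
    and i: "\<And>v. \<beta> (\<i> *s v) (\<i> *s v) = - \<beta> v v"
  shows "pluriharmonic_on UNIV (\<lambda>x. k + l (x - p) + \<beta> (x - p) (x - p))"
proof -
  interpret l: bounded_linear l by fact
  interpret \<beta>: bounded_bilinear \<beta> by fact
  have "harmonic_on UNIV (\<lambda>\<zeta>. k + l (a + \<zeta> *s v - p) + \<beta> (a + \<zeta> *s v - p) (a + \<zeta> *s v - p))" for a v
  proof -
    note sv = bounded_linear_vector_scalar_mult[of v]
    have b1: "bounded_linear (\<lambda>\<zeta>. l (\<zeta> *s v) + (\<beta> (a - p) (\<zeta> *s v) + \<beta> (\<zeta> *s v) (a - p)))"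
      by (intro bounded_linear_add bounded_linear_compose[OF l sv]
          bounded_linear_compose[OF \<beta>.bounded_linear_left sv] bounded_linear_compose[OF \<beta>.bounded_linear_right sv])
    have b2: "bounded_bilinear (\<lambda>\<zeta> \<zeta>'. \<beta> (\<zeta> *s v) (\<zeta>' *s v))"
      by (rule \<beta>.comp[OF sv sv])
    have b3: "(\<Sum>b\<in>Basis. \<beta> (b *s v) (b *s v)) = 0"
      by (simp add: Basis_complex_def i)
    have "(\<lambda>\<zeta>. k + l (a + \<zeta> *s v - p) + \<beta> (a + \<zeta> *s v - p) (a + \<zeta> *s v - p)) =
      (\<lambda>\<zeta>. (k + l (a - p) + \<beta> (a - p) (a - p)) + (l (\<zeta> *s v) + (\<beta> (a - p) (\<zeta> *s v) + \<beta> (\<zeta> *s v) (a - p)))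
        + \<beta> (\<zeta> *s v) (\<zeta> *s v))"
    proof
      fix \<zeta>
      have "a + \<zeta> *s v - p = (a - p) + \<zeta> *s v" by simp
      then show "k + l (a + \<zeta> *s v - p) + \<beta> (a + \<zeta> *s v - p) (a + \<zeta> *s v - p) =
        (k + l (a - p) + \<beta> (a - p) (a - p)) + (l (\<zeta> *s v) + (\<beta> (a - p) (\<zeta> *s v) + \<beta> (\<zeta> *s v) (a - p)))
        + \<beta> (\<zeta> *s v) (\<zeta> *s v)"
        by (simp only: l.add \<beta>.add_left \<beta>.add_right)
    qed
    then show ?thesis using harmonic_on_quadratic[OF b1 b2 b3] by simp
  qed
  then show ?thesis
    unfolding pluriharmonic_on_def using C2_derivs_on_quadratic[OF l \<beta>, of UNIV k p] by auto
qed

section \<open>Tangent planes at the penalised maximum\<close>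

text \<open>Taking for \<omega> the differential
  \<open>A \<zeta> + Q \<zeta>1 \<zeta> + Q \<zeta> \<zeta>1\<close> of the family at
  \<open>\<zeta>1\<close> removes all first order terms from the penalty and leaves
  \<open>r - Q \<zeta> \<zeta>\<close>. The last conclusion is the case \<open>\<omega> = 0\<close>
  along the kernel of this differential; it is what forces injectivity on the subspaces used
  later.\<close>

lemma touches_tangent_max:
  fixes A :: "complex ^ 'n \<Rightarrow> 'b::euclidean_space"
  assumes t: "touches W S w A Q \<nu>" and W: "open W" and S: "vec.subspace S"
    and A: "bounded_linear A" and Q: "bounded_bilinear Q"
  obtains \<zeta>1 w1 r K C e where "\<zeta>1 \<in> S" "K > 0" "C \<ge> 0" "e > 0" "ball w1 e \<subseteq> W"
    "\<And>\<zeta>. \<zeta> \<in> S \<Longrightarrow> norm \<zeta> < e \<Longrightarrow>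
       log_dist W (w1 + (A \<zeta> + Q \<zeta>1 \<zeta> + Q \<zeta> \<zeta>1)) \<le> log_dist W w1 - 2 * (\<zeta>1 \<bullet> \<zeta>) - (norm \<zeta>)\<^sup>2
         - 2 * K * (r \<bullet> Q \<zeta> \<zeta>) + C * (norm \<zeta>) ^ 4"
    "\<And>\<zeta>. \<zeta> \<in> S \<Longrightarrow> A \<zeta> + Q \<zeta>1 \<zeta> + Q \<zeta> \<zeta>1 = 0 \<Longrightarrow> (norm \<zeta>)\<^sup>2 + 2 * K * (r \<bullet> Q \<zeta> \<zeta>) \<le> 0"
proof -
  interpret A: bounded_linear A by fact
  interpret Q: bounded_bilinear Q by fact
  have S': "subspace S" by (rule subspace_of_complex_subspace[OF S])
  obtain \<zeta>1 w1 r K e where \<zeta>1: "\<zeta>1 \<in> S" and w1: "w1 \<in> W" and K: "K > 0" and e: "e > 0" and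
    main: "\<And>\<zeta> \<omega>. \<zeta>1 + \<zeta> \<in> S \<Longrightarrow> norm \<zeta> < e \<Longrightarrow> norm \<omega> < e \<Longrightarrow>
       w1 + \<omega> \<in> W \<and> log_dist W (w1 + \<omega>) \<le> log_dist W w1 - 2 * (\<zeta>1 \<bullet> \<zeta>) - (norm \<zeta>)\<^sup>2
         + K * (norm (r + \<omega> - (A \<zeta> + Q \<zeta>1 \<zeta> + Q \<zeta> \<zeta>1) - Q \<zeta> \<zeta>))\<^sup>2 - K * (norm r)\<^sup>2"
    using touches_penalised_max[OF t W closed_subspace[OF S'] subspace_0[OF S'] A Q zero_less_one]
    by metis
  define Y where "Y \<zeta> = A \<zeta> + Q \<zeta>1 \<zeta> + Q \<zeta> \<zeta>1" for \<zeta>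
  have Y: "bounded_linear Y"
    unfolding Y_def by (intro bounded_linear_add A Q.bounded_linear_left Q.bounded_linear_right)
  obtain bY where bY: "bY > 0" "\<And>\<zeta>. norm (Y \<zeta>) \<le> norm \<zeta> * bY"
    using bounded_linear.pos_bounded[OF Y] by blast
  obtain b where b: "b > 0" "\<And>\<zeta> \<zeta>'. norm (Q \<zeta> \<zeta>') \<le> norm \<zeta> * norm \<zeta>' * b"
    using Q.pos_bounded by blast
  define C where "C = K * b\<^sup>2"
  have C: "C \<ge> 0" using K by (simp add: C_def)
  define e' where "e' = min e (e / bY)"
  have e': "e' > 0" "e' \<le> e" using e bY by (auto simp: e'_def)
  have est: "K * (norm (r - Q \<zeta> \<zeta>))\<^sup>2 - K * (norm r)\<^sup>2 \<le> - 2 * K * (r \<bullet> Q \<zeta> \<zeta>) + C * (norm \<zeta>) ^ 4" for \<zeta>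
  proof -
    have "(norm (Q \<zeta> \<zeta>))\<^sup>2 \<le> (norm \<zeta> * norm \<zeta> * b)\<^sup>2" using b by (intro power_mono) auto
    also have "\<dots> = b\<^sup>2 * (norm \<zeta>) ^ 4" by (simp add: power_mult_distrib power2_eq_square power4_eq_xxxx)
    finally have "K * (norm (Q \<zeta> \<zeta>))\<^sup>2 \<le> K * (b\<^sup>2 * (norm \<zeta>) ^ 4)" using K by simp
    moreover have *: "(norm (r - Q \<zeta> \<zeta>))\<^sup>2 = (norm r)\<^sup>2 - 2 * (r \<bullet> Q \<zeta> \<zeta>) + (norm (Q \<zeta> \<zeta>))\<^sup>2"
      by (simp add: power2_norm_eq_inner inner_diff_left inner_diff_right inner_commute)
    ultimately show ?thesis by (simp only: *) (simp add: C_def algebra_simps)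
  qed
  have small: "norm (Y \<zeta>) < e" if "norm \<zeta> < e'" for \<zeta>
  proof -
    have "norm \<zeta> < e / bY" using that by (simp add: e'_def)
    then have "norm \<zeta> * bY < e" using bY by (simp add: pos_less_divide_eq)
    then show ?thesis using bY(2)[of \<zeta>] by linarith
  qed
  have ker: "(norm \<zeta>)\<^sup>2 + 2 * K * (r \<bullet> Q \<zeta> \<zeta>) \<le> 0" if \<zeta>: "\<zeta> \<in> S" "Y \<zeta> = 0" for \<zeta>
  proof -
    define D where "D = (norm \<zeta>)\<^sup>2 + 2 * K * (r \<bullet> Q \<zeta> \<zeta>)"
    have step: "t\<^sup>2 * D \<le> C * (norm \<zeta>) ^ 4 * t ^ 4 - 2 * t * (\<zeta>1 \<bullet> \<zeta>)" if t: "\<bar>t\<bar> * norm \<zeta> < e" for t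
    proof -
      have inS: "\<zeta>1 + t *\<^sub>R \<zeta> \<in> S" using S' \<zeta>1 \<zeta> by (simp add: subspace_add subspace_scale)
      have Yt: "A (t *\<^sub>R \<zeta>) + Q \<zeta>1 (t *\<^sub>R \<zeta>) + Q (t *\<^sub>R \<zeta>) \<zeta>1 = 0"
        using \<zeta>(2) by (simp add: Y_def A.scaleR Q.scaleR_left Q.scaleR_right flip: scaleR_add_right)
      have "log_dist W w1 \<le> log_dist W w1 - 2 * (\<zeta>1 \<bullet> (t *\<^sub>R \<zeta>)) - (norm (t *\<^sub>R \<zeta>))\<^sup>2
         + K * (norm (r - Q (t *\<^sub>R \<zeta>) (t *\<^sub>R \<zeta>)))\<^sup>2 - K * (norm r)\<^sup>2"
        using main[OF inS, of 0] t e unfolding Yt by simp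
      then have "0 \<le> - 2 * (\<zeta>1 \<bullet> (t *\<^sub>R \<zeta>)) - (norm (t *\<^sub>R \<zeta>))\<^sup>2
          - 2 * K * (r \<bullet> Q (t *\<^sub>R \<zeta>) (t *\<^sub>R \<zeta>)) + C * (norm (t *\<^sub>R \<zeta>)) ^ 4"
        using est[of "t *\<^sub>R \<zeta>"] by linarith
      then show ?thesis
        by (simp add: D_def Q.scaleR_left Q.scaleR_right power_mult_distrib power2_eq_square algebra_simps)
    qed
    \<comment> \<open>Adding the bounds for \<open>t\<close> and \<open>- t\<close> cancels the
      linear term.\<close>
    have D_le: "D \<le> C * (norm \<zeta>) ^ 4 * t\<^sup>2" if t: "0 < t" "t * norm \<zeta> < e" for t
    proof -
      have "2 * (t\<^sup>2 * D) \<le> 2 * (C * (norm \<zeta>) ^ 4 * t ^ 4)"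
        using step[of t] step[of "- t"] t by simp
      also have "\<dots> = 2 * (t\<^sup>2 * (C * (norm \<zeta>) ^ 4 * t\<^sup>2))" by (simp add: power2_eq_square power4_eq_xxxx)
      finally show ?thesis using t by simp
    qed
    have "((\<lambda>t. C * (norm \<zeta>) ^ 4 * t\<^sup>2) \<longlongrightarrow> C * (norm \<zeta>) ^ 4 * 0\<^sup>2) (at_right 0)"
      by (intro tendsto_intros)
    moreover have "\<forall>\<^sub>F t in at_right 0. D \<le> C * (norm \<zeta>) ^ 4 * t\<^sup>2"
    proof -
      have "\<forall>\<^sub>F t in at_right (0::real). t \<in> {0<..<e / (norm \<zeta> + 1)}"
        using e by (intro eventually_at_right_real) (simp add: add_nonneg_pos)
      then show ?thesis
      proof eventually_elim
        case (elim t)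
        then have "t * (norm \<zeta> + 1) < e" by (simp add: pos_less_divide_eq add_nonneg_pos)
        then show ?case using elim by (intro D_le) (auto simp: algebra_simps)
      qed
    qed
    ultimately have "D \<le> C * (norm \<zeta>) ^ 4 * 0\<^sup>2" by (rule tendsto_lowerbound) simp
    then show ?thesis by (simp add: D_def)
  qed
  show thesis
  proof (rule that[of \<zeta>1 K C e' w1 r])
    show "ball w1 e' \<subseteq> W"
    proof
      fix x assume "x \<in> ball w1 e'"
      then have "norm (x - w1) < e" using e' by (simp add: dist_norm norm_minus_commute)
      then show "x \<in> W" using main[of 0 "x - w1"] \<zeta>1 e by simp
    qed
    show "log_dist W (w1 + (A \<zeta> + Q \<zeta>1 \<zeta> + Q \<zeta> \<zeta>1)) \<le> log_dist W w1 - 2 * (\<zeta>1 \<bullet> \<zeta>) - (norm \<zeta>)\<^sup>2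
         - 2 * K * (r \<bullet> Q \<zeta> \<zeta>) + C * (norm \<zeta>) ^ 4" if "\<zeta> \<in> S" "norm \<zeta> < e'" for \<zeta>
    proof -
      have "\<zeta>1 + \<zeta> \<in> S" using S' \<zeta>1 that by (simp add: subspace_add)
      then have "log_dist W (w1 + Y \<zeta>) \<le> log_dist W w1 - 2 * (\<zeta>1 \<bullet> \<zeta>) - (norm \<zeta>)\<^sup>2
         + K * (norm (r - Q \<zeta> \<zeta>))\<^sup>2 - K * (norm r)\<^sup>2"
        using main[of \<zeta> "Y \<zeta>"] small that e' by (simp add: Y_def)
      then show ?thesis using est[of \<zeta>] unfolding Y_def by linarith
    qed
  qed (use \<zeta>1 K C e' ker in \<open>auto simp: Y_def\<close>)
qed

text \<open>Near 0 half of the quadratic decay dominates the quartic term, and the left inverse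
  \<open>L\<close> makes \<open>norm \<zeta>\<close> comparable to \<open>norm (Y \<zeta>)\<close>.
  So a small sphere carries a uniform gap \<gamma>; lowering the barrier by \<gamma> keeps it valid
  on the sphere and breaks it at the centre.\<close>

lemma sphere_gap_of_quadratic_decay:
  fixes Y :: "'a::euclidean_space \<Rightarrow> 'b::euclidean_space"
  assumes Y: "bounded_linear Y" and L: "bounded_linear L" and LY: "\<And>\<zeta>. \<zeta> \<in> N \<Longrightarrow> L (Y \<zeta>) = \<zeta>"
    and \<kappa>: "\<kappa> > 0" and e: "e > 0" "e' > 0" and C: "C \<ge> 0"
    and f: "\<And>\<zeta>. \<zeta> \<in> N \<Longrightarrow> norm \<zeta> < e \<Longrightarrow> f (Y \<zeta>) \<le> g \<zeta> - \<kappa> * (norm \<zeta>)\<^sup>2 + C * (norm \<zeta>) ^ 4"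
  obtains r \<gamma> :: real where "0 < r" "r < e'" "\<gamma> > 0"
    "\<And>\<omega>. \<omega> \<in> Y ` N \<Longrightarrow> norm \<omega> = r \<Longrightarrow> f \<omega> \<le> g (L \<omega>) - \<gamma>"
proof -
  obtain bY where bY: "bY > 0" "\<And>\<zeta>. norm (Y \<zeta>) \<le> norm \<zeta> * bY"
    using bounded_linear.pos_bounded[OF Y] by blast
  obtain bL where bL: "bL > 0" "\<And>\<omega>. norm (L \<omega>) \<le> norm \<omega> * bL"
    using bounded_linear.pos_bounded[OF L] by blast
  \<comment> \<open>Up to this radius \<open>C * (norm \<zeta>)\<^sup>2\<close> is at most
    \<open>\<kappa> / 2\<close>; the summand 1 covers \<open>C = 0\<close>.\<close>
  define d where "d = min (e / 2) (sqrt (\<kappa> / (2 * (C + 1))))"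
  have d: "d > 0" "d < e" using e \<kappa> C by (auto simp: d_def)
  have "d\<^sup>2 \<le> (sqrt (\<kappa> / (2 * (C + 1))))\<^sup>2" using d(1) by (intro power_mono) (auto simp: d_def)
  then have "d\<^sup>2 \<le> \<kappa> / (2 * (C + 1))" using \<kappa> C by simp
  then have "(C + 1) * d\<^sup>2 \<le> \<kappa> / 2" using C by (simp add: pos_le_divide_eq algebra_simps)
  then have Cd: "C * d\<^sup>2 \<le> \<kappa> / 2" proof -
    have "C * d\<^sup>2 \<le> (C + 1) * d\<^sup>2" by (simp add: distrib_right)
    then show ?thesis using \<open>(C + 1) * d\<^sup>2 \<le> \<kappa> / 2\<close> by linarith
  qed
  define r where "r = min (e' / 2) (d / bL)"
  have r: "r > 0" "r < e'" "r * bL \<le> d"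
    using e d bL by (auto simp: r_def min_def field_simps)
  show thesis
  proof (rule that[of r "\<kappa> / 2 * (r / bY)\<^sup>2"])
    fix \<omega> assume \<omega>: "\<omega> \<in> Y ` N" "norm \<omega> = r"
    then obtain \<zeta> where \<zeta>: "\<zeta> \<in> N" "\<omega> = Y \<zeta>" by blast
    have "norm \<zeta> \<le> d" using bL(2)[of \<omega>] LY[OF \<zeta>(1)] \<zeta> \<omega> r by simp
    then have "(norm \<zeta>)\<^sup>2 \<le> d\<^sup>2" by (intro power_mono) auto
    then have "C * (norm \<zeta>)\<^sup>2 \<le> \<kappa> / 2" using Cd mult_left_mono[OF _ C] by (meson order_trans)
    then have "C * (norm \<zeta>)\<^sup>2 * (norm \<zeta>)\<^sup>2 \<le> \<kappa> / 2 * (norm \<zeta>)\<^sup>2" by (intro mult_right_mono) auto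
    then have 1: "C * (norm \<zeta>) ^ 4 \<le> \<kappa> / 2 * (norm \<zeta>)\<^sup>2" by (simp add: power2_eq_square power4_eq_xxxx mult.assoc)
    have "r / bY \<le> norm \<zeta>" using bY(2)[of \<zeta>] \<zeta> \<omega> bY(1) by (simp add: pos_divide_le_eq)
    then have "(r / bY)\<^sup>2 \<le> (norm \<zeta>)\<^sup>2" using r bY by (intro power_mono) auto
    then have 2: "\<kappa> / 2 * (r / bY)\<^sup>2 \<le> \<kappa> / 2 * (norm \<zeta>)\<^sup>2" using \<kappa> by (intro mult_left_mono) auto
    have "f \<omega> \<le> g \<zeta> - \<kappa> * (norm \<zeta>)\<^sup>2 + C * (norm \<zeta>) ^ 4"
      using f[OF \<zeta>(1)] \<open>norm \<zeta> \<le> d\<close> d \<zeta> by simp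
    then show "f \<omega> \<le> g (L \<omega>) - \<kappa> / 2 * (r / bY)\<^sup>2"
      using 1 2 LY[OF \<zeta>(1)] \<zeta>(2) by simp
  qed (use r \<kappa> bY in auto)
qed

lemma complex_linear_iff:
  fixes f :: "complex ^ 'n \<Rightarrow> complex ^ 'm"
  shows "Vector_Spaces.linear (*s) (*s) f \<longleftrightarrow>
    (\<forall>x y. f (x + y) = f x + f y) \<and> (\<forall>c x. f (c *s x) = c *s f x)"
  by (simp add: Vector_Spaces.linear_iff vec.vector_space_axioms)

lemma bounded_linear_of_complex_linear:
  fixes f :: "complex ^ 'n \<Rightarrow> complex ^ 'm"
  assumes "Vector_Spaces.linear (*s) (*s) f"
  shows "bounded_linear f"
  using assms unfolding complex_linear_iff linear_conv_bounded_linear[symmetric]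
  by (intro linearI) (auto simp: scaleR_eq_vector_scalar_mult)

lemma norm_vector_scalar_mult [simp]: "norm (c *s (z :: complex ^ 'n)) = cmod c * norm z"
  by (simp add: norm_vec_def norm_mult L2_set_right_distrib)

text \<open>The term \<open>- 2 * K * (r \<bullet> Q \<zeta> \<zeta>)\<close> is the real part of a
  holomorphic quadratic form, hence can be moved into the pluriharmonic barrier. Only the decay
  \<open>- (norm \<zeta>)\<^sup>2\<close> remains, and it produces the gap on a small
  sphere.\<close>

lemma not_q_pseudoconvex_of_touches:
  fixes W :: "(complex ^ 'n) set" and A :: "complex ^ 'n \<Rightarrow> complex ^ 'n"
  assumes t: "touches W S w A Q \<nu>" and W: "open W" and S: "vec.subspace S" "vec.dim S = q + 1"
    and A: "bounded_linear A" "\<And>c \<zeta>. A (c *s \<zeta>) = c *s A \<zeta>" and Q: "bounded_bilinear Q"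
    "\<And>c \<zeta> \<zeta>'. Q (c *s \<zeta>) \<zeta>' = c *s Q \<zeta> \<zeta>'" "\<And>c \<zeta> \<zeta>'. Q \<zeta> (c *s \<zeta>') = c *s Q \<zeta> \<zeta>'"
  shows "\<not> q_pseudoconvex q W"
proof
  assume qp: "q_pseudoconvex q W"
  interpret A: bounded_linear A by fact
  interpret Q: bounded_bilinear Q by fact
  have WU: "W \<noteq> UNIV" using t by (auto simp: touches_def)
  obtain \<zeta>1 w1 r K C e where \<zeta>1: "\<zeta>1 \<in> S" and K: "K > 0" and C: "C \<ge> 0" and e: "e > 0" "ball w1 e \<subseteq> W" and
    main: "\<And>\<zeta>. \<zeta> \<in> S \<Longrightarrow> norm \<zeta> < e \<Longrightarrow>
       log_dist W (w1 + (A \<zeta> + Q \<zeta>1 \<zeta> + Q \<zeta> \<zeta>1)) \<le> log_dist W w1 - 2 * (\<zeta>1 \<bullet> \<zeta>) - (norm \<zeta>)\<^sup>2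
         - 2 * K * (r \<bullet> Q \<zeta> \<zeta>) + C * (norm \<zeta>) ^ 4" and
    ker: "\<And>\<zeta>. \<zeta> \<in> S \<Longrightarrow> A \<zeta> + Q \<zeta>1 \<zeta> + Q \<zeta> \<zeta>1 = 0 \<Longrightarrow> (norm \<zeta>)\<^sup>2 + 2 * K * (r \<bullet> Q \<zeta> \<zeta>) \<le> 0"
    using touches_tangent_max[OF t W S(1) A(1) Q(1)] by metis
  define Y where "Y \<zeta> = A \<zeta> + Q \<zeta>1 \<zeta> + Q \<zeta> \<zeta>1" for \<zeta>
  have Y: "Vector_Spaces.linear (*s) (*s) Y"
    unfolding complex_linear_iff Y_def
    by (simp add: A.add A(2) Q.add_left Q.add_right Q(2,3) vec.scale_right_distrib)
  have Yi: "Y (\<i> *s \<zeta>) = \<i> *s Y \<zeta>" for \<zeta> using Y by (simp add: complex_linear_iff)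
  have Qi: "Q (\<i> *s \<zeta>) (\<i> *s \<zeta>) = - Q \<zeta> \<zeta>" for \<zeta> by (simp add: Q(2,3))
  \<comment> \<open>The kernel inequalities for \<zeta> and \<open>\<i> *s \<zeta>\<close> have
    opposite \<open>Q\<close> terms, and their sum leaves only the norms.\<close>
  have zero: "\<zeta> = 0" if "\<zeta> \<in> S" "Y \<zeta> = 0" for \<zeta>
  proof -
    have "\<i> *s \<zeta> \<in> S" using that S(1) by (simp add: vec.subspace_scale)
    moreover have "Y (\<i> *s \<zeta>) = 0" using that Yi by simp
    ultimately have "(norm \<zeta>)\<^sup>2 - 2 * K * (r \<bullet> Q \<zeta> \<zeta>) \<le> 0"
      using ker[of "\<i> *s \<zeta>"] by (simp add: Y_def Qi)
    moreover have "(norm \<zeta>)\<^sup>2 + 2 * K * (r \<bullet> Q \<zeta> \<zeta>) \<le> 0"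
      using ker[of \<zeta>] that by (simp add: Y_def)
    ultimately have "(norm \<zeta>)\<^sup>2 \<le> 0" by linarith
    then show ?thesis by simp
  qed
  interpret Y: Vector_Spaces.linear "(*s)" "(*s)" Y by (rule Y)
  have inj: "inj_on Y S"
  proof (rule inj_onI)
    fix x y assume xy: "x \<in> S" "y \<in> S" "Y x = Y y"
    then have "Y (x - y) = 0" by (simp add: Y.diff)
    then have "x - y = 0" using zero vec.subspace_diff[OF S(1)] xy by blast
    then show "x = y" by simp
  qed
  obtain L where L: "Vector_Spaces.linear (*s) (*s) L" "\<And>\<zeta>. \<zeta> \<in> S \<Longrightarrow> L (Y \<zeta>) = \<zeta>"
    using vec.linear_exists_left_inverse_on[OF Y S(1) inj] by blast
  have bL: "bounded_linear L" by (rule bounded_linear_of_complex_linear[OF L(1)])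
  define g where "g \<zeta> = log_dist W w1 - 2 * (\<zeta>1 \<bullet> \<zeta>) - 2 * K * (r \<bullet> Q \<zeta> \<zeta>)" for \<zeta>
  obtain \<rho> \<gamma> where \<rho>: "0 < \<rho>" "\<rho> < e" "\<gamma> > 0" and
    gap: "\<And>\<omega>. \<omega> \<in> Y ` S \<Longrightarrow> norm \<omega> = \<rho> \<Longrightarrow> log_dist W (w1 + \<omega>) \<le> g (L \<omega>) - \<gamma>"
  proof -
    have "log_dist W (w1 + Y \<zeta>) \<le> g \<zeta> - 1 * (norm \<zeta>)\<^sup>2 + C * norm \<zeta> ^ 4" if "\<zeta> \<in> S" "norm \<zeta> < e" for \<zeta>
      using main[OF that] by (simp add: g_def Y_def)
    then show thesis
      using that sphere_gap_of_quadratic_decay[OF bounded_linear_of_complex_linear[OF Y] bL L(2) zero_less_one e(1) e(1) C,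
        where f = "\<lambda>\<omega>. log_dist W (w1 + \<omega>)" and g = g] by blast
  qed
  define h where "h w = (log_dist W w1 - \<gamma>) + - 2 * (\<zeta>1 \<bullet> L (w - w1)) + - 2 * K * (r \<bullet> Q (L (w - w1)) (L (w - w1)))" for w
  have h: "pluriharmonic_on UNIV h"
    unfolding h_def
  proof (rule pluriharmonic_on_quadratic[where l = "\<lambda>v. - 2 * (\<zeta>1 \<bullet> L v)"
        and \<beta> = "\<lambda>x y. - 2 * K * (r \<bullet> Q (L x) (L y))"])
    show "bounded_linear (\<lambda>x. - 2 * (\<zeta>1 \<bullet> L x))"
      by (intro bounded_linear_const_mult bounded_linear_inner_right_comp bL)
    show "bounded_bilinear (\<lambda>x y. - 2 * K * (r \<bullet> Q (L x) (L y)))"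
      using Q.comp[OF bL bL]
      unfolding bilinear_conv_bounded_bilinear[symmetric] bilinear_def linear_iff
      by (simp add: inner_add_right algebra_simps)
    show "- 2 * K * (r \<bullet> Q (L (\<i> *s v)) (L (\<i> *s v))) = - (- 2 * K * (r \<bullet> Q (L v) (L v)))" for v
      using L(1) by (simp add: complex_linear_iff Qi)
  qed
  have hg: "h (w1 + \<omega>) = g (L \<omega>) - \<gamma>" for \<omega> by (simp add: h_def g_def)
  define P where "P = (+) w1 ` (Y ` S)"
  have "vec.dim (Y ` S) = q + 1"
    using vec.dim_image_eq[OF Y, of S] inj S vec.span_eq_iff[THEN iffD2, OF S(1)] by simp
  moreover have "vec.subspace (Y ` S)" by (rule vec.linear_subspace_image[OF Y S(1)])
  ultimately have P: "complex_affine_subspace (q + 1) P"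
    unfolding complex_affine_subspace_def P_def by blast
  have sub: "cball w1 \<rho> \<subseteq> W" using e(2) \<rho>(2) by force
  have u: "- ext_ln (bdry_dist W z) = ereal (log_dist W z)" if "z \<in> cball w1 \<rho>" for z
    using neg_ext_ln_bdry_dist[OF W WU] sub that by blast
  have bd: "\<forall>z \<in> sphere w1 \<rho> \<inter> P. - ext_ln (bdry_dist W z) \<le> ereal (h z)"
  proof
    fix z assume z: "z \<in> sphere w1 \<rho> \<inter> P"
    then obtain \<omega> where \<omega>: "\<omega> \<in> Y ` S" "z = w1 + \<omega>" by (auto simp: P_def)
    then have "norm \<omega> = \<rho>" using z by (simp add: dist_norm)
    then have "log_dist W z \<le> h z" using gap[OF \<omega>(1)] hg \<omega>(2) by simp
    then show "- ext_ln (bdry_dist W z) \<le> ereal (h z)" using u z by auto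
  qed
  have "\<forall>z \<in> cball w1 \<rho> \<inter> P. - ext_ln (bdry_dist W z) \<le> ereal (h z)"
    using qp P \<rho> sub h bd unfolding q_pseudoconvex_def q_plurisubharmonic_on_def by blast
  moreover have "w1 \<in> cball w1 \<rho> \<inter> P"
    using \<rho> S(1) Y.zero by (auto simp: P_def image_iff vec.subspace_0 intro!: bexI[of _ 0])
  ultimately have "- ext_ln (bdry_dist W w1) \<le> ereal (h w1)" by blast
  then have "log_dist W w1 \<le> h w1" using u[of w1] \<rho> by simp
  then show False using hg[of 0] \<rho> linear_0[OF bounded_linear.linear[OF bL]] by (simp add: g_def Q.zero_left)
qed

text \<open>Orthogonality to a \<open>k\<close>-dimensional real subspace, imposed on
  \<open>x\<close> and on \<open>\<i> *s x\<close> at once, amounts to \<open>k\<close> complex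
  linear equations; these have a nonzero solution in \<open>S\<close> as long as
  \<open>k < vec.dim S\<close>. By \<open>neg\<close> one of \<open>x\<close> and
  \<open>\<i> *s x\<close> is negative for \<beta> and enlarges the subspace by one
  dimension.\<close>

lemma negative_real_subspace:
  fixes \<beta> :: "complex ^ 'n \<Rightarrow> complex ^ 'n \<Rightarrow> real"
  assumes \<beta>: "bounded_bilinear \<beta>" "\<And>x y. \<beta> x y = \<beta> y x"
    and neg: "\<And>x. x \<noteq> 0 \<Longrightarrow> \<beta> x x + \<beta> (\<i> *s x) (\<i> *s x) < 0"
    and S: "vec.subspace S" and k: "k \<le> vec.dim S"
  shows "\<exists>N. subspace N \<and> N \<subseteq> S \<and> dim N = k \<and> (\<forall>x\<in>N. x \<noteq> 0 \<longrightarrow> \<beta> x x < 0)"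
  using k
proof (induction k)
  case 0
  show ?case using S by (intro exI[of _ "{0}"]) (auto simp: vec.subspace_0)
next
  case (Suc k)
  interpret \<beta>: bounded_bilinear \<beta> by fact
  have S': "subspace S" by (rule subspace_of_complex_subspace[OF S])
  obtain N where N: "subspace N" "N \<subseteq> S" "dim N = k" "\<And>x. x \<in> N \<Longrightarrow> x \<noteq> 0 \<Longrightarrow> \<beta> x x < 0"
    using Suc by auto
  obtain B where B: "B \<subseteq> N" "independent B" "N \<subseteq> span B" "card B = k"
    using basis_exists[of N] N by metis
  have finB: "finite B" using B(2) by (rule independent_imp_finite)
  have "k < CARD('n)" using Suc.prems vec.dim_subset_UNIV[of S] by (simp add: vec.dimension_def card_cart_basis)
  \<comment> \<open>Labels the equations by coordinates, so that the system becomes a complex linear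
    endomorphism \<open>M\<close>.\<close>
  then obtain g :: "complex ^ 'n \<Rightarrow> 'n" where g: "inj_on g B"
    using card_le_inj[OF finB, of "UNIV :: 'n set"] B(4) by auto
  \<comment> \<open>The complex linear functional with real part \<open>\<beta> b\<close>; if
    \<open>x\<close> is a zero, then \<open>x\<close> and \<open>\<i> *s x\<close> are both
    orthogonal to \<open>b\<close>.\<close>
  define lam where "lam b x = Complex (\<beta> b x) (- \<beta> b (\<i> *s x))" for b x
  have lam_add: "lam b (x + y) = lam b x + lam b y" for b x y
    by (simp add: lam_def complex_eq_iff \<beta>.add_right vec.scale_right_distrib)
  have lam_scale: "lam b (c *s x) = c * lam b x" for b c x
  proof -
    have "c *s x = Re c *\<^sub>R x + Im c *\<^sub>R (\<i> *s x)"
      by (simp add: vec_eq_iff complex_eq_iff)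
    moreover have "\<i> *s (c *s x) = Re c *\<^sub>R (\<i> *s x) - Im c *\<^sub>R x"
      by (simp add: vec_eq_iff complex_eq_iff)
    ultimately show ?thesis
      by (simp add: lam_def complex_eq_iff \<beta>.add_right \<beta>.diff_right \<beta>.scaleR_right)
  qed
  define M where "M x = (\<chi> j. if j \<in> g ` B then lam (inv_into B g j) x else 0)" for x
  have M: "Vector_Spaces.linear (*s) (*s) M"
    unfolding complex_linear_iff by (auto simp: M_def vec_eq_iff lam_add lam_scale)
  interpret M: Vector_Spaces.linear "(*s)" "(*s)" M by (rule M)
  have "\<exists>x\<in>S. x \<noteq> 0 \<and> M x = 0"
  proof (rule ccontr)
    assume *: "\<not> ?thesis"
    have "inj_on M S"
    proof (rule inj_onI)
      fix x y assume xy: "x \<in> S" "y \<in> S" "M x = M y"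
      then have "M (x - y) = 0" by (simp add: M.diff)
      then show "x = y" using * xy vec.subspace_diff[OF S] by (metis eq_iff_diff_eq_0)
    qed
    then have "vec.dim (M ` S) = vec.dim S"
      using vec.dim_image_eq[OF M, of S] vec.span_eq_iff[THEN iffD2, OF S] by simp
    moreover have "vec.dim (M ` S) \<le> card ((\<lambda>j. axis j (1::complex)) ` g ` B)"
    proof (rule vec.dim_le_card)
      show "M ` S \<subseteq> vec.span ((\<lambda>j. axis j 1) ` g ` B)"
      proof
        fix y assume "y \<in> M ` S"
        then obtain x where y: "y = M x" by blast
        have "y = (\<Sum>j\<in>g ` B. y $ j *s axis j 1)"
        proof -
          have "(\<Sum>j\<in>g ` B. y $ j *s axis j 1) $ i = y $ i" for i
          proof -
            have "(\<Sum>j\<in>g ` B. y $ j *s axis j 1) $ i = (\<Sum>j\<in>g ` B. if j = i then y $ i else 0)"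
              by (simp add: axis_def if_distrib cong: if_cong sum.cong)
            also have "\<dots> = y $ i" using finB by (simp add: y M_def)
            finally show ?thesis .
          qed
          then show ?thesis by (simp add: vec_eq_iff)
        qed
        moreover have "(\<Sum>j\<in>g ` B. y $ j *s axis j 1) \<in> vec.span ((\<lambda>j. axis j 1) ` g ` B)"
          by (intro vec.span_sum vec.span_scale vec.span_base) auto
        ultimately show "y \<in> vec.span ((\<lambda>j. axis j 1) ` g ` B)" by simp
      qed
    qed (use finB in auto)
    moreover have "card ((\<lambda>j. axis j (1::complex)) ` g ` B) \<le> k"
      using card_image_le[of "g ` B" "\<lambda>j. axis j (1::complex)"] card_image_le[of B g] finB B(4) by simp
    ultimately show False using Suc.prems by simp
  qed
  then obtain x where x: "x \<in> S" "x \<noteq> 0" "M x = 0" by blast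
  have lam0: "lam b x = 0" if "b \<in> B" for b
  proof -
    have "M x $ g b = lam b x" using that g by (simp add: M_def)
    then show ?thesis using x by simp
  qed
  then have orthB: "\<beta> b x = 0" "\<beta> b (\<i> *s x) = 0" if "b \<in> B" for b
    using that by (auto simp: lam_def complex_eq_iff)
  obtain \<theta> where \<theta>: "\<theta> \<in> S" "\<beta> \<theta> \<theta> < 0" "\<And>b. b \<in> B \<Longrightarrow> \<beta> b \<theta> = 0"
  proof (cases "\<beta> x x < 0")
    case True
    then show ?thesis using that x orthB by blast
  next
    case False
    then have "\<beta> (\<i> *s x) (\<i> *s x) < 0" using neg[OF x(2)] by simp
    then show ?thesis using that[of "\<i> *s x"] x orthB vec.subspace_scale[OF S] by blast
  qed
  have orth: "\<beta> y \<theta> = 0" if "y \<in> N" for y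
  proof -
    have "y \<in> span B" using that B by blast
    then show ?thesis
      by (induction rule: span_induct_alt) (auto simp: \<beta>.zero_left \<beta>.add_left \<beta>.scaleR_left \<theta>)
  qed
  define N' where "N' = span (insert \<theta> N)"
  have "\<theta> \<notin> N" using orth \<theta>(2) by force
  then have "dim N' = Suc k" using N span_eq_iff[THEN iffD2, OF N(1)] by (simp add: N'_def dim_insert del: span_eq_iff)
  moreover have "N' \<subseteq> S" unfolding N'_def using N \<theta> S' by (intro span_minimal) auto
  moreover have "\<beta> y y < 0" if "y \<in> N'" "y \<noteq> 0" for y
  proof -
    obtain t where "y - t *\<^sub>R \<theta> \<in> span N" using \<open>y \<in> N'\<close> unfolding N'_def span_insert by blast
    then have n: "y - t *\<^sub>R \<theta> \<in> N" using span_eq_iff[THEN iffD2, OF N(1)] by (simp del: span_eq_iff)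
    define m where "m = y - t *\<^sub>R \<theta>"
    have y: "y = m + t *\<^sub>R \<theta>" by (simp add: m_def)
    have eq: "\<beta> y y = \<beta> m m + t\<^sup>2 * \<beta> \<theta> \<theta>"
    proof -
      have "\<beta> m \<theta> = 0" "\<beta> \<theta> m = 0" using orth[of m] n \<beta>(2)[of \<theta> m] by (simp_all add: m_def)
      then show ?thesis
        by (subst (1 2) y)
           (simp add: \<beta>.add_left \<beta>.add_right \<beta>.scaleR_left \<beta>.scaleR_right power2_eq_square)
    qed
    show ?thesis
    proof (cases "m = 0")
      case True
      then have "t \<noteq> 0" using y that by auto
      then show ?thesis using eq True \<theta>(2) by (simp add: \<beta>.zero_left mult_pos_neg)
    next
      case False
      then have "\<beta> m m < 0" using N(4) n by (simp add: m_def)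
      moreover have "t\<^sup>2 * \<beta> \<theta> \<theta> \<le> 0" using \<theta>(2) by (simp add: mult_nonneg_nonpos)
      ultimately show ?thesis using eq by linarith
    qed
  qed
  ultimately show ?case by (intro exI[of _ N']) (auto simp: N'_def)
qed

text \<open>Only affine barriers are at hand, so the quadratic term cannot be absorbed as in the
  complex case. The second order form \<beta>, however, takes values with sum
  \<open>- 2 * (norm \<zeta>)\<^sup>2\<close> on \<zeta> and \<open>\<i> *s \<zeta>\<close>; hence
  it is negative definite on a real subspace \<open>N\<close> of dimension \<open>q + 1\<close>, and
  the violation is found on the image of \<open>N\<close>.\<close>

lemma not_real_q_convex_of_touches:
  fixes V :: "(real ^ 'm) set" and A :: "complex ^ 'n \<Rightarrow> real ^ 'm"
  assumes t: "touches V S y A Q \<nu>" and V: "open V" and S: "vec.subspace S" "vec.dim S = q + 1"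
    and A: "bounded_linear A" and Q: "bounded_bilinear Q"
    and i: "\<And>\<zeta>. Q (\<i> *s \<zeta>) (\<i> *s \<zeta>) = - Q \<zeta> \<zeta>"
  shows "\<not> real_q_convex_set q V"
proof
  assume qc: "real_q_convex_set q V"
  interpret A: bounded_linear A by fact
  interpret Q: bounded_bilinear Q by fact
  have VU: "V \<noteq> UNIV" using t by (auto simp: touches_def)
  obtain \<zeta>1 w1 r K C e where \<zeta>1: "\<zeta>1 \<in> S" and K: "K > 0" and C: "C \<ge> 0" and e: "e > 0" "ball w1 e \<subseteq> V" and
    main: "\<And>\<zeta>. \<zeta> \<in> S \<Longrightarrow> norm \<zeta> < e \<Longrightarrow>
       log_dist V (w1 + (A \<zeta> + Q \<zeta>1 \<zeta> + Q \<zeta> \<zeta>1)) \<le> log_dist V w1 - 2 * (\<zeta>1 \<bullet> \<zeta>) - (norm \<zeta>)\<^sup>2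
         - 2 * K * (r \<bullet> Q \<zeta> \<zeta>) + C * (norm \<zeta>) ^ 4" and
    ker: "\<And>\<zeta>. \<zeta> \<in> S \<Longrightarrow> A \<zeta> + Q \<zeta>1 \<zeta> + Q \<zeta> \<zeta>1 = 0 \<Longrightarrow> (norm \<zeta>)\<^sup>2 + 2 * K * (r \<bullet> Q \<zeta> \<zeta>) \<le> 0"
    using touches_tangent_max[OF t V S(1) A(1) Q(1)] by metis
  define Y where "Y \<zeta> = A \<zeta> + Q \<zeta>1 \<zeta> + Q \<zeta> \<zeta>1" for \<zeta>
  have Y: "bounded_linear Y"
    unfolding Y_def by (intro bounded_linear_add A Q.bounded_linear_left Q.bounded_linear_right)
  interpret Y: bounded_linear Y by fact
  define \<beta> where "\<beta> a b = - (a \<bullet> b) - K * (r \<bullet> (Q a b + Q b a))" for a b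
  have \<beta>_diag: "\<beta> \<zeta> \<zeta> = - (norm \<zeta>)\<^sup>2 - 2 * K * (r \<bullet> Q \<zeta> \<zeta>)" for \<zeta>
    unfolding \<beta>_def inner_add_right by (simp add: power2_norm_eq_inner)
  have b\<beta>: "bounded_bilinear \<beta>"
    unfolding \<beta>_def bilinear_conv_bounded_bilinear[symmetric] bilinear_def linear_iff
    by (simp add: inner_add_right inner_add_left Q.add_left Q.add_right Q.scaleR_left Q.scaleR_right algebra_simps)
  interpret \<beta>: bounded_bilinear \<beta> by fact
  have "\<exists>N. subspace N \<and> N \<subseteq> S \<and> dim N = q + 1 \<and> (\<forall>x\<in>N. x \<noteq> 0 \<longrightarrow> \<beta> x x < 0)"
  proof (rule negative_real_subspace[OF b\<beta>])
    show "\<beta> x y = \<beta> y x" for x y by (simp add: \<beta>_def inner_commute add.commute)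
    show "\<beta> x x + \<beta> (\<i> *s x) (\<i> *s x) < 0" if "x \<noteq> 0" for x
      using that by (simp add: \<beta>_diag i)
  qed (use S in auto)
  then obtain N where N: "subspace N" "N \<subseteq> S" "dim N = q + 1" "\<And>x. x \<in> N \<Longrightarrow> x \<noteq> 0 \<Longrightarrow> \<beta> x x < 0"
    by blast
  \<comment> \<open>On the kernel, maximality yields \<open>\<beta> \<zeta> \<zeta> \<ge> 0\<close>,
    against negativity on \<open>N\<close>.\<close>
  have zero: "\<zeta> = 0" if "\<zeta> \<in> N" "Y \<zeta> = 0" for \<zeta>
  proof (rule ccontr)
    assume "\<zeta> \<noteq> 0"
    then have "\<beta> \<zeta> \<zeta> < 0" using N(4) that by blast
    then show False using ker[of \<zeta>] that N(2) by (auto simp: Y_def \<beta>_diag)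
  qed
  have inj: "inj_on Y N"
  proof (rule inj_onI)
    fix x y assume xy: "x \<in> N" "y \<in> N" "Y x = Y y"
    then have "Y (x - y) = 0" by (simp add: Y.diff)
    then have "x - y = 0" using zero subspace_diff[OF N(1)] xy by blast
    then show "x = y" by simp
  qed
  obtain L where L: "linear L" "\<And>\<zeta>. \<zeta> \<in> N \<Longrightarrow> L (Y \<zeta>) = \<zeta>"
    using linear_exists_left_inverse_on[OF Y.linear_axioms N(1) inj] by blast
  have bL: "bounded_linear L" using L(1) linear_conv_bounded_linear by blast
  \<comment> \<open>Minus the maximum of \<beta> on the unit sphere of \<open>N\<close>; homogeneity
    does the rest.\<close>
  obtain \<kappa> where \<kappa>: "\<kappa> > 0" "\<And>\<zeta>. \<zeta> \<in> N \<Longrightarrow> \<beta> \<zeta> \<zeta> \<le> - \<kappa> * (norm \<zeta>)\<^sup>2"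
  proof -
    have "compact (sphere 0 1 \<inter> N)" using closed_subspace[OF N(1)] by (intro compact_Int_closed) auto
    moreover have "sphere 0 1 \<inter> N \<noteq> {}"
    proof -
      have "\<not> N \<subseteq> {0}"
      proof
        assume "N \<subseteq> {0}"
        then show False using N(3) by (metis dim_eq_0 add_is_0 one_neq_zero)
      qed
      then obtain x where "x \<in> N" "x \<noteq> 0" by blast
      then have "inverse (norm x) *\<^sub>R x \<in> sphere 0 1 \<inter> N" using N(1) by (simp add: subspace_scale)
      then show ?thesis by blast
    qed
    moreover have "continuous_on (sphere 0 1 \<inter> N) (\<lambda>x. \<beta> x x)"
      by (intro \<beta>.continuous_on continuous_intros)
    ultimately obtain x where x: "x \<in> sphere 0 1 \<inter> N" "\<And>y. y \<in> sphere 0 1 \<inter> N \<Longrightarrow> \<beta> y y \<le> \<beta> x x"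
      using continuous_attains_sup[of "sphere 0 1 \<inter> N" "\<lambda>x. \<beta> x x"] by blast
    have "\<beta> x x < 0" using x(1) N(4) by force
    moreover have "\<beta> \<zeta> \<zeta> \<le> \<beta> x x * (norm \<zeta>)\<^sup>2" if "\<zeta> \<in> N" for \<zeta>
    proof (cases "\<zeta> = 0")
      case False
      define v where "v = inverse (norm \<zeta>) *\<^sub>R \<zeta>"
      have v: "v \<in> sphere 0 1 \<inter> N" using False N(1) that by (simp add: v_def subspace_scale)
      have eq: "\<zeta> = norm \<zeta> *\<^sub>R v" using False by (simp add: v_def)
      have "\<beta> \<zeta> \<zeta> = (norm \<zeta>)\<^sup>2 * \<beta> v v"
        unfolding power2_eq_square mult.assoc
        by (rule trans[OF arg_cong2[where f = \<beta>, OF eq eq]]) (simp only: \<beta>.scaleR_left \<beta>.scaleR_right real_scaleR_def)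
      also have "\<dots> \<le> (norm \<zeta>)\<^sup>2 * \<beta> x x" using x(2)[OF v] by (intro mult_left_mono) auto
      finally show ?thesis by (simp add: mult.commute)
    qed (simp add: \<beta>.zero_left)
    ultimately show thesis using that[of "- \<beta> x x"] by simp
  qed
  define g where "g \<zeta> = log_dist V w1 - 2 * (\<zeta>1 \<bullet> \<zeta>)" for \<zeta>
  obtain \<rho> \<gamma> where \<rho>: "0 < \<rho>" "\<rho> < e" "\<gamma> > 0" and
    gap: "\<And>\<omega>. \<omega> \<in> Y ` N \<Longrightarrow> norm \<omega> = \<rho> \<Longrightarrow> log_dist V (w1 + \<omega>) \<le> g (L \<omega>) - \<gamma>"
  proof -
    have "log_dist V (w1 + Y \<zeta>) \<le> g \<zeta> - \<kappa> * (norm \<zeta>)\<^sup>2 + C * norm \<zeta> ^ 4" if "\<zeta> \<in> N" "norm \<zeta> < e" for \<zeta>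
    proof -
      have "\<zeta> \<in> S" using that N(2) by blast
      then show ?thesis using main[of \<zeta>] that(2) \<kappa>(2)[OF that(1)] by (simp add: g_def Y_def \<beta>_diag)
    qed
    then show thesis
      using that sphere_gap_of_quadratic_decay[OF Y bL L(2) \<kappa>(1) e(1) e(1) C,
        where f = "\<lambda>\<omega>. log_dist V (w1 + \<omega>)" and g = g] by blast
  qed
  define l where "l w = g (L (w - w1)) - \<gamma>" for w
  define P where "P = (+) w1 ` (Y ` N)"
  have subY: "subspace (Y ` N)" by (rule linear_subspace_image[OF Y.linear_axioms N(1)])
  have "dim (Y ` N) = q + 1"
    using dim_image_eq[OF Y.linear_axioms, of N] inj N span_eq_iff[THEN iffD2, OF N(1)] by (simp del: span_eq_iff)
  then have P: "affine P" "aff_dim P = int (q + 1)"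
    unfolding P_def using subY
    by (auto simp: aff_dim_translation_eq aff_dim_subspace affine_translation[symmetric] subspace_imp_affine)
  have lP: "affine_fun_on P l"
    unfolding affine_fun_on_def
  proof (intro ballI allI)
    fix x y t
    have "(1 - t) *\<^sub>R x + t *\<^sub>R y - w1 = (1 - t) *\<^sub>R (x - w1) + t *\<^sub>R (y - w1)"
      by (simp add: algebra_simps)
    then have *: "L ((1 - t) *\<^sub>R x + t *\<^sub>R y - w1) = (1 - t) *\<^sub>R L (x - w1) + t *\<^sub>R L (y - w1)"
      using L(1) by (simp add: linear_add linear_scale)
    show "l ((1 - t) *\<^sub>R x + t *\<^sub>R y) = (1 - t) * l x + t * l y"
      unfolding l_def * by (simp add: g_def inner_add_right algebra_simps)
  qed
  have sub: "cball w1 \<rho> \<subseteq> V" using e(2) \<rho>(2) by force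
  have u: "- ext_ln (bdry_dist V z) = ereal (log_dist V z)" if "z \<in> cball w1 \<rho>" for z
    using neg_ext_ln_bdry_dist[OF V VU] sub that by blast
  have bd: "\<forall>z \<in> sphere w1 \<rho> \<inter> P. - ext_ln (bdry_dist V z) \<le> ereal (l z)"
  proof
    fix z assume z: "z \<in> sphere w1 \<rho> \<inter> P"
    then obtain \<omega> where \<omega>: "\<omega> \<in> Y ` N" "z = w1 + \<omega>" by (auto simp: P_def)
    then have "norm \<omega> = \<rho>" using z by (simp add: dist_norm)
    then have "log_dist V z \<le> l z" using gap[OF \<omega>(1)] \<omega>(2) by (simp add: l_def)
    then show "- ext_ln (bdry_dist V z) \<le> ereal (l z)" using u z by auto
  qed
  have "\<forall>z \<in> cball w1 \<rho> \<inter> P. - ext_ln (bdry_dist V z) \<le> ereal (l z)"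
    using qc P \<rho> sub lP bd unfolding real_q_convex_set_def real_q_convex_on_def by blast
  moreover have "w1 \<in> cball w1 \<rho> \<inter> P"
    using \<rho> subspace_0[OF subY] by (auto simp: P_def image_iff intro!: bexI[of _ 0])
  ultimately have "- ext_ln (bdry_dist V w1) \<le> ereal (l w1)" by blast
  then have "log_dist V w1 \<le> l w1" using u[of w1] \<rho> by simp
  then show False using \<rho> linear_0[OF L(1)] by (simp add: g_def l_def)
qed

subsection \<open>Touching families obtained from violations\<close>

text \<open>The mean value theorem on the segment, applied to \<open>h\<close> minus its linear and
  quadratic terms: the derivative of this difference is the first order remainder of
  \<open>h'\<close> at \<open>p\<close>, evaluated at \<zeta>.\<close>

lemma second_order_taylor:
  fixes p :: "'a::real_normed_vector"
  assumes C2: "C2_derivs_on U h h' h''" and U: "open U" "p \<in> U" and \<epsilon>: "\<epsilon> > 0"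
  obtains d where "d > 0"
    "\<And>\<zeta>. norm \<zeta> < d \<Longrightarrow> \<bar>h (p + \<zeta>) - h p - h' p \<zeta> - h'' p \<zeta> \<zeta> / 2\<bar> \<le> \<epsilon> * (norm \<zeta>)\<^sup>2"
proof -
  obtain d1 where d1: "d1 > 0" "ball p d1 \<subseteq> U" using U by (meson open_contains_ball)
  have "(h' has_derivative blinfun_apply (h'' p)) (at p)" using C2 U by (simp add: C2_derivs_on_def)
  then obtain d2 where d2: "d2 > 0"
    "\<And>y. norm (y - p) < d2 \<Longrightarrow> norm (h' y - h' p - h'' p (y - p)) \<le> \<epsilon> * norm (y - p)"
    unfolding has_derivative_at_alt using \<epsilon> by blast
  show thesis
  proof (rule that[of "min d1 d2"])
    show "min d1 d2 > 0" using d1 d2 by simp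
    fix \<zeta> :: 'a assume \<zeta>: "norm \<zeta> < min d1 d2"
    define \<phi> where "\<phi> t = h (p + t *\<^sub>R \<zeta>) - t * h' p \<zeta> - t\<^sup>2 / 2 * h'' p \<zeta> \<zeta>" for t
    have small: "norm (t *\<^sub>R \<zeta>) < min d1 d2" "norm (t *\<^sub>R \<zeta>) \<le> norm \<zeta>" if "0 \<le> t" "t \<le> 1" for t
    proof -
      show "norm (t *\<^sub>R \<zeta>) \<le> norm \<zeta>" using that by (simp add: mult_left_le_one_le)
      then show "norm (t *\<^sub>R \<zeta>) < min d1 d2" using \<zeta> by linarith
    qed
    have der: "DERIV \<phi> t :> h' (p + t *\<^sub>R \<zeta>) \<zeta> - h' p \<zeta> - t * h'' p \<zeta> \<zeta>" if "0 \<le> t" "t \<le> 1" for t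
    proof -
      have "p + t *\<^sub>R \<zeta> \<in> ball p d1" using small[OF that] by (simp add: dist_norm)
      then have "(h has_derivative blinfun_apply (h' (p + t *\<^sub>R \<zeta>))) (at (p + t *\<^sub>R \<zeta>))"
        using C2 d1 by (auto simp: C2_derivs_on_def)
      then have "((\<lambda>t. h (p + t *\<^sub>R \<zeta>)) has_derivative (\<lambda>s. h' (p + t *\<^sub>R \<zeta>) (s *\<^sub>R \<zeta>))) (at t)"
        by (rule has_derivative_compose[rotated]) (auto intro!: derivative_eq_intros)
      then have "((\<lambda>t. h (p + t *\<^sub>R \<zeta>)) has_field_derivative h' (p + t *\<^sub>R \<zeta>) \<zeta>) (at t)"
        by (simp add: has_field_derivative_def blinfun.scaleR_right mult.commute[of _ "blinfun_apply _ _"])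
      then show ?thesis
        unfolding \<phi>_def by (auto intro!: derivative_eq_intros)
    qed
    obtain t where t: "0 < t" "t < 1" "\<phi> 1 - \<phi> 0 = h' (p + t *\<^sub>R \<zeta>) \<zeta> - h' p \<zeta> - t * h'' p \<zeta> \<zeta>"
      using MVT2[OF zero_less_one, of \<phi> "\<lambda>t. h' (p + t *\<^sub>R \<zeta>) \<zeta> - h' p \<zeta> - t * h'' p \<zeta> \<zeta>"] der by auto
    have "\<phi> 1 - \<phi> 0 = h (p + \<zeta>) - h p - h' p \<zeta> - h'' p \<zeta> \<zeta> / 2" by (simp add: \<phi>_def)
    moreover have "\<phi> 1 - \<phi> 0 = (h' (p + t *\<^sub>R \<zeta>) - h' p - h'' p (t *\<^sub>R \<zeta>)) \<zeta>"
      unfolding t(3) by (simp add: blinfun.diff_left blinfun.scaleR_right blinfun.scaleR_left)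
    moreover have "norm ((h' (p + t *\<^sub>R \<zeta>) - h' p - h'' p (t *\<^sub>R \<zeta>)) \<zeta>)
        \<le> norm (h' (p + t *\<^sub>R \<zeta>) - h' p - h'' p (t *\<^sub>R \<zeta>)) * norm \<zeta>" by (rule norm_blinfun)
    moreover have "\<dots> \<le> (\<epsilon> * norm (t *\<^sub>R \<zeta>)) * norm \<zeta>"
      using d2(2)[of "p + t *\<^sub>R \<zeta>"] small[of t] t by (intro mult_right_mono) auto
    moreover have "\<dots> \<le> (\<epsilon> * norm \<zeta>) * norm \<zeta>"
      using small(2)[of t] t \<epsilon> by (intro mult_right_mono mult_left_mono) auto
    ultimately show "\<bar>h (p + \<zeta>) - h p - h' p \<zeta> - h'' p \<zeta> \<zeta> / 2\<bar> \<le> \<epsilon> * (norm \<zeta>)\<^sup>2"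
      by (simp only: real_norm_def power2_eq_square mult.assoc)
  qed
qed

text \<open>The harmonic restrictions come with derivatives \<open>k'\<close>, \<open>k''\<close> of
  their own, which are compared with \<open>h'\<close>, \<open>h''\<close> through values only.
  Summation over the four points \<plusminus> t v and \<plusminus> \<i> t v cancels the linear terms
  and leaves \<open>t\<^sup>2\<close> times the trace, up to Taylor errors.\<close>

lemma pluriharmonic_hessian:
  assumes h: "pluriharmonic_on U h" and C2: "C2_derivs_on U h h' h''" and p: "p \<in> U"
  shows "h'' p (\<i> *s v) (\<i> *s v) = - h'' p v v"
proof -
  have U: "open U" using h by (simp add: pluriharmonic_on_def)
  define T where "T = {\<zeta>. p + \<zeta> *s v \<in> U}"
  define k where "k = (\<lambda>\<zeta>. h (p + \<zeta> *s v))"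
  have "harmonic_on T k" using h by (simp add: pluriharmonic_on_def T_def k_def)
  then obtain k' k'' where T: "open T" and k: "C2_derivs_on T k k' k''"
    and tr: "\<And>\<zeta>. \<zeta> \<in> T \<Longrightarrow> (\<Sum>b\<in>Basis. k'' \<zeta> b b) = 0"
    unfolding harmonic_on_def by blast
  have T0: "0 \<in> T" using p by (simp add: T_def)
  have tr0: "k'' 0 1 1 + k'' 0 \<i> \<i> = 0" using tr[OF T0] by (simp add: Basis_complex_def)
  define E where "E = h'' p v v + h'' p (\<i> *s v) (\<i> *s v)"
  \<comment> \<open>Four Taylor errors for \<open>h\<close> and four for \<open>k\<close>, each with
    its own norm.\<close>
  have le: "\<bar>E\<bar> \<le> 4 * \<epsilon> * (1 + (norm v)\<^sup>2)" if \<epsilon>: "\<epsilon> > 0" for \<epsilon>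
  proof -
    obtain d1 where d1: "d1 > 0"
      "\<And>\<zeta>. norm \<zeta> < d1 \<Longrightarrow> \<bar>h (p + \<zeta>) - h p - h' p \<zeta> - h'' p \<zeta> \<zeta> / 2\<bar> \<le> \<epsilon> * (norm \<zeta>)\<^sup>2"
      using second_order_taylor[OF C2 U p \<epsilon>] by blast
    obtain d2 where d2: "d2 > 0"
      "\<And>\<zeta>. norm \<zeta> < d2 \<Longrightarrow> \<bar>k (0 + \<zeta>) - k 0 - k' 0 \<zeta> - k'' 0 \<zeta> \<zeta> / 2\<bar> \<le> \<epsilon> * (norm \<zeta>)\<^sup>2"
      using second_order_taylor[OF k T T0 \<epsilon>] by blast
    define t where "t = min (d1 / (norm v + 1)) d2 / 2"
    have t: "t > 0" using d1 d2 by (simp add: t_def add_nonneg_pos)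
    have t2: "t < d2" using d1 d2 t by (auto simp: t_def)
    have t1: "t * norm v < d1"
    proof -
      have "b > 0 \<Longrightarrow> min b d2 / 2 < b" for b :: real by (simp add: min_def)
      moreover have "d1 / (norm v + 1) > 0" using d1 by (simp add: add_nonneg_pos)
      ultimately have "t < d1 / (norm v + 1)" unfolding t_def by blast
      then have "t * (norm v + 1) < d1" by (simp add: pos_less_divide_eq add_nonneg_pos)
      then show ?thesis using t by (simp add: algebra_simps)
    qed
    have hb: "\<bar>h (p + \<zeta>) - h p - h' p \<zeta> - h'' p \<zeta> \<zeta> / 2\<bar> \<le> \<epsilon> * (t\<^sup>2 * (norm v)\<^sup>2)"
      if "norm \<zeta> = t * norm v" for \<zeta>
      using d1(2)[of \<zeta>] that t1 by (simp add: power_mult_distrib)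
    have kb: "\<bar>k \<zeta> - k 0 - k' 0 \<zeta> - k'' 0 \<zeta> \<zeta> / 2\<bar> \<le> \<epsilon> * t\<^sup>2" if "norm \<zeta> = t" for \<zeta>
      using d2(2)[of \<zeta>] that t2 by simp
    have kh: "k (t *\<^sub>R 1) = h (p + t *\<^sub>R v)" "k (- (t *\<^sub>R 1)) = h (p + - (t *\<^sub>R v))"
      "k (t *\<^sub>R \<i>) = h (p + t *\<^sub>R (\<i> *s v))" "k (- (t *\<^sub>R \<i>)) = h (p + - (t *\<^sub>R (\<i> *s v)))" "k 0 = h p"
      by (simp_all add: k_def scaleR_eq_vector_scalar_mult scaleR_conv_of_real vec.scale_minus_left)
    have hs: "h'' p (t *\<^sub>R x) (t *\<^sub>R x) = t\<^sup>2 * h'' p x x" "h'' p (- (t *\<^sub>R x)) (- (t *\<^sub>R x)) = t\<^sup>2 * h'' p x x"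
      "h' p (- (t *\<^sub>R x)) = - h' p (t *\<^sub>R x)" for x
      by (simp_all add: blinfun.scaleR_right blinfun.scaleR_left blinfun.minus_right blinfun.minus_left power2_eq_square)
    have ks: "k'' 0 (t *\<^sub>R x) (t *\<^sub>R x) = t\<^sup>2 * k'' 0 x x" "k'' 0 (- (t *\<^sub>R x)) (- (t *\<^sub>R x)) = t\<^sup>2 * k'' 0 x x"
      "k' 0 (- (t *\<^sub>R x)) = - k' 0 (t *\<^sub>R x)" for x
      by (simp_all add: blinfun.scaleR_right blinfun.scaleR_left blinfun.minus_right blinfun.minus_left power2_eq_square)
    have n: "norm (t *\<^sub>R v) = t * norm v" "norm (- (t *\<^sub>R v)) = t * norm v"
      "norm (t *\<^sub>R (\<i> *s v)) = t * norm v" "norm (- (t *\<^sub>R (\<i> *s v))) = t * norm v"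
      "norm (t *\<^sub>R (1::complex)) = t" "norm (- (t *\<^sub>R (1::complex))) = t"
      "norm (t *\<^sub>R \<i>) = t" "norm (- (t *\<^sub>R \<i>)) = t"
      using t by simp_all
    note h4 = hb[OF n(1), unfolded hs] hb[OF n(2), unfolded hs] hb[OF n(3), unfolded hs] hb[OF n(4), unfolded hs]
    note k4 = kb[OF n(5), unfolded ks kh] kb[OF n(6), unfolded ks kh] kb[OF n(7), unfolded ks kh] kb[OF n(8), unfolded ks kh]
    have tr': "t\<^sup>2 * k'' 0 1 1 + t\<^sup>2 * k'' 0 \<i> \<i> = 0"
      using tr0 by (simp flip: distrib_left)
    have "\<bar>t\<^sup>2 * h'' p v v + t\<^sup>2 * h'' p (\<i> *s v) (\<i> *s v)\<bar> \<le> 4 * (\<epsilon> * (t\<^sup>2 * (norm v)\<^sup>2)) + 4 * (\<epsilon> * t\<^sup>2)"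
      using h4[THEN abs_le_D1] h4[THEN abs_le_D2] k4[THEN abs_le_D1] k4[THEN abs_le_D2] tr'
      by (intro abs_leI) linarith+
    also have "\<dots> = t\<^sup>2 * (4 * \<epsilon> * (1 + (norm v)\<^sup>2))" by (simp add: algebra_simps)
    also have "\<bar>t\<^sup>2 * h'' p v v + t\<^sup>2 * h'' p (\<i> *s v) (\<i> *s v)\<bar> = t\<^sup>2 * \<bar>E\<bar>"
      unfolding E_def distrib_left[symmetric] by (simp add: abs_mult)
    finally show ?thesis using t by simp
  qed
  have "E = 0"
  proof (rule ccontr)
    assume "E \<noteq> 0"
    define D where "D = 1 + (norm v)\<^sup>2"
    have D: "D > 0" by (simp add: D_def add_pos_nonneg)
    have "\<bar>E\<bar> \<le> 4 * (\<bar>E\<bar> / (8 * D)) * D" unfolding D_def using \<open>E \<noteq> 0\<close> D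
      by (intro le) (simp add: D_def)
    also have "\<dots> = \<bar>E\<bar> / 2" using D by simp
    finally show False using \<open>E \<noteq> 0\<close> by simp
  qed
  then show ?thesis by (simp add: E_def)
qed

text \<open>At the interior maximum \<open>h\<close> is replaced by its second order jet. Half of
  \<epsilon> pays for the Taylor error, the gradient of the added quadratic goes into
  \<open>l\<close>, and \<open>H\<close> is half the Hessian of \<open>h\<close>.\<close>

lemma not_q_pseudoconvex_obtain:
  fixes W :: "(complex ^ 'n) set"
  assumes W: "open W" and nq: "\<not> q_pseudoconvex q W"
  obtains z S l H \<epsilon> \<rho> where "W \<noteq> UNIV" "z \<in> W" "vec.subspace S" "vec.dim S = q + 1"
    "bounded_linear l" "bounded_bilinear H" "\<And>\<zeta>. H (\<i> *s \<zeta>) (\<i> *s \<zeta>) = - H \<zeta> \<zeta>" "\<epsilon> > 0" "\<rho> > 0"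
    "\<And>\<zeta>. \<zeta> \<in> S \<Longrightarrow> norm \<zeta> \<le> \<rho> \<Longrightarrow> z + \<zeta> \<in> W \<and>
       log_dist W (z + \<zeta>) \<le> log_dist W z + l \<zeta> + H \<zeta> \<zeta> - \<epsilon> * (norm \<zeta>)\<^sup>2"
proof -
  \<comment> \<open>Semicontinuity and finiteness always hold, so it is the maximum property that
    fails. This also rules out \<open>W = UNIV\<close>, where the function is constantly
    -\<infinity>.\<close>
  obtain P c r U h y where P: "complex_affine_subspace (q + 1) P" and r: "0 < r" and cW: "cball c r \<subseteq> W"
    and cU: "cball c r \<subseteq> U" and h: "pluriharmonic_on U h"
    and bd: "\<And>z. z \<in> sphere c r \<inter> P \<Longrightarrow> - ext_ln (bdry_dist W z) \<le> ereal (h z)"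
    and y: "y \<in> cball c r \<inter> P" "\<not> - ext_ln (bdry_dist W y) \<le> ereal (h y)"
    using nq W usc_on_neg_ext_ln_bdry_dist[OF W] neg_ext_ln_bdry_dist_less_top[OF W]
    unfolding q_pseudoconvex_def q_plurisubharmonic_on_def by blast
  have WU: "W \<noteq> UNIV" using y(2) by auto
  have u: "- ext_ln (bdry_dist W z) = ereal (log_dist W z)" if "z \<in> cball c r" for z
    using neg_ext_ln_bdry_dist[OF W WU] cW that by blast
  obtain a S where S: "vec.subspace S" "vec.dim S = q + 1" and PS: "P = (+) a ` S"
    using P unfolding complex_affine_subspace_def by blast
  have S': "subspace S" by (rule subspace_of_complex_subspace[OF S(1)])
  have U: "open U" using h by (simp add: pluriharmonic_on_def)
  obtain h' h'' where C2: "C2_derivs_on U h h' h''" using h unfolding pluriharmonic_on_def by blast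
  have ch: "continuous_on (cball c r) h"
  proof (rule continuous_at_imp_continuous_on, rule ballI)
    fix x assume "x \<in> cball c r"
    then have "(h has_derivative blinfun_apply (h' x)) (at x)" using C2 cU by (auto simp: C2_derivs_on_def)
    then show "isCont h x" by (rule has_derivative_continuous)
  qed
  have clP: "closed P" unfolding PS by (intro closed_translation closed_subspace S')
  obtain x \<epsilon> where x: "x \<in> ball c r \<inter> P" and \<epsilon>: "\<epsilon> > 0" and
    mx: "\<And>x'. x' \<in> cball c r \<inter> P \<Longrightarrow>
       log_dist W x' - h x' + \<epsilon> * (norm (x' - c))\<^sup>2 \<le> log_dist W x - h x + \<epsilon> * (norm (x - c))\<^sup>2"
  proof (rule interior_max_of_violation[OF clP continuous_on_subset[OF continuous_on_log_dist[OF W WU] cW] ch _ y(1)])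
    show "log_dist W z \<le> h z" if "z \<in> sphere c r \<inter> P" for z
      using bd[OF that] u[of z] that by auto
    show "h y < log_dist W y" using y u[of y] by auto
  qed auto
  have xU: "x \<in> U" and xW: "x \<in> W" using x cU cW by (auto intro: less_imp_le)
  obtain d where d: "d > 0"
    "\<And>\<zeta>. norm \<zeta> < d \<Longrightarrow> \<bar>h (x + \<zeta>) - h x - h' x \<zeta> - h'' x \<zeta> \<zeta> / 2\<bar> \<le> \<epsilon> / 2 * (norm \<zeta>)\<^sup>2"
    using second_order_taylor[OF C2 U xU, of "\<epsilon> / 2"] \<epsilon> by auto
  define \<rho> where "\<rho> = min (d / 2) ((r - dist c x) / 2)"
  have \<rho>: "\<rho> > 0" "\<rho> < d" "\<rho> < r - dist c x" using d(1) x by (auto simp: \<rho>_def min_def)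
  define l where "l \<zeta> = h' x \<zeta> - 2 * \<epsilon> * ((x - c) \<bullet> \<zeta>)" for \<zeta>
  define H where "H \<zeta> \<zeta>' = h'' x \<zeta> \<zeta>' / 2" for \<zeta> \<zeta>'
  show thesis
  proof (rule that[of x S l H "\<epsilon> / 2" \<rho>])
    show "bounded_linear l" unfolding l_def
      by (intro bounded_linear_sub blinfun.bounded_linear_right bounded_linear_const_mult
          bounded_linear_inner_right)
    show "bounded_bilinear H" unfolding H_def bilinear_conv_bounded_bilinear[symmetric] bilinear_def linear_iff
      by (simp add: blinfun.add_left blinfun.add_right blinfun.scaleR_left blinfun.scaleR_right add_divide_distrib)
    show "H (\<i> *s \<zeta>) (\<i> *s \<zeta>) = - H \<zeta> \<zeta>" for \<zeta>
      using pluriharmonic_hessian[OF h C2 xU, of \<zeta>] by (simp add: H_def)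
    fix \<zeta> assume \<zeta>: "\<zeta> \<in> S" "norm \<zeta> \<le> \<rho>"
    obtain s where s: "s \<in> S" "x = a + s" using x PS by blast
    have "x + \<zeta> \<in> P" unfolding PS using s \<zeta> subspace_add[OF S' s(1) \<zeta>(1)] by (auto simp: add.assoc)
    moreover have "dist c (x + \<zeta>) \<le> dist c x + norm \<zeta>"
      using dist_triangle[of c "x + \<zeta>" x] by (simp add: dist_norm)
    ultimately have in_c: "x + \<zeta> \<in> cball c r \<inter> P" using \<zeta> \<rho> by simp
    have sq: "(norm (x + \<zeta> - c))\<^sup>2 = (norm (x - c))\<^sup>2 + 2 * ((x - c) \<bullet> \<zeta>) + (norm \<zeta>)\<^sup>2"
      by (simp add: power2_norm_eq_inner inner_diff_left inner_diff_right inner_add_left inner_add_right inner_commute)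
    have "\<epsilon> * (norm (x + \<zeta> - c))\<^sup>2 = \<epsilon> * (norm (x - c))\<^sup>2 + 2 * \<epsilon> * ((x - c) \<bullet> \<zeta>) + \<epsilon> * (norm \<zeta>)\<^sup>2"
      unfolding sq by (simp only: distrib_left mult.assoc mult.left_commute)
    then have "log_dist W (x + \<zeta>) \<le> log_dist W x + (h (x + \<zeta>) - h x) - 2 * \<epsilon> * ((x - c) \<bullet> \<zeta>) - \<epsilon> * (norm \<zeta>)\<^sup>2"
      using mx[OF in_c] by linarith
    moreover have "h (x + \<zeta>) - h x \<le> h' x \<zeta> + h'' x \<zeta> \<zeta> / 2 + \<epsilon> / 2 * (norm \<zeta>)\<^sup>2"
      using d(2)[of \<zeta>] \<zeta> \<rho> by linarith
    ultimately have "log_dist W (x + \<zeta>) \<le> log_dist W x + l \<zeta> + H \<zeta> \<zeta> - \<epsilon> / 2 * (norm \<zeta>)\<^sup>2"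
      by (simp add: l_def H_def)
    then show "x + \<zeta> \<in> W \<and> log_dist W (x + \<zeta>) \<le> log_dist W x + l \<zeta> + H \<zeta> \<zeta> - \<epsilon> / 2 * (norm \<zeta>)\<^sup>2"
      using in_c cW by auto
  qed (use WU S \<epsilon> \<rho> xW in auto)
qed

text \<open>A linear projection onto the direction space of \<open>P\<close> extends the linear part
  of \<open>l\<close>. Additivity of that part follows from affinity, because
  \<open>p + (s + s')\<close> is the midpoint of \<open>p + 2 *\<^sub>R s\<close> and
  \<open>p + 2 *\<^sub>R s'\<close>.\<close>

lemma affine_fun_on_extend:
  fixes P :: "'a::euclidean_space set"
  assumes P: "affine P" "p \<in> P" and l: "affine_fun_on P l"
  obtains m where "bounded_linear m" "\<And>x. x \<in> P \<Longrightarrow> l x = l p + m (x - p)"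
proof -
  define S where "S = (\<lambda>x. x - p) ` P"
  have S: "subspace S" unfolding S_def using affine_diffs_subspace_subtract[OF P] .
  have inS: "p + s \<in> P" if "s \<in> S" for s using that by (auto simp: S_def)
  have "\<exists>g. g ` UNIV \<subseteq> S \<and> linear g \<and> (\<forall>v\<in>S. g (id v) = v)"
    by (rule linear_exists_left_inverse_on[OF linear_id S]) simp
  then obtain g where g: "\<And>x. g x \<in> S" "linear g" "\<And>v. v \<in> S \<Longrightarrow> g v = v" by auto
  define k where "k s = l (p + s) - l p" for s
  have k_scale: "k (t *\<^sub>R s) = t * k s" if "s \<in> S" for s t
  proof -
    have "l ((1 - t) *\<^sub>R p + t *\<^sub>R (p + s)) = (1 - t) * l p + t * l (p + s)"
      using l P(2) inS[OF that] unfolding affine_fun_on_def by blast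
    moreover have "(1 - t) *\<^sub>R p + t *\<^sub>R (p + s) = p + t *\<^sub>R s" by (simp add: algebra_simps)
    ultimately show ?thesis by (simp add: k_def algebra_simps)
  qed
  have k_add: "k (s + s') = k s + k s'" if "s \<in> S" "s' \<in> S" for s s'
  proof -
    have "2 *\<^sub>R s \<in> S" "2 *\<^sub>R s' \<in> S" using S that by (auto intro: subspace_scale)
    then have "l ((1 - 1/2) *\<^sub>R (p + 2 *\<^sub>R s) + (1/2) *\<^sub>R (p + 2 *\<^sub>R s')) = (1 - 1/2) * l (p + 2 *\<^sub>R s) + (1/2) * l (p + 2 *\<^sub>R s')"
      using l inS unfolding affine_fun_on_def by blast
    moreover have "(1 - 1/2) *\<^sub>R (p + 2 *\<^sub>R s) + (1/2) *\<^sub>R (p + 2 *\<^sub>R s') = (1/2) *\<^sub>R p + (1/2) *\<^sub>R p + (s + s')"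
      by (simp add: scaleR_add_right)
    moreover have "(1/2) *\<^sub>R p + (1/2) *\<^sub>R p = p" by (simp flip: scaleR_add_left)
    ultimately have "l (p + (s + s')) = l (p + 2 *\<^sub>R s) / 2 + l (p + 2 *\<^sub>R s') / 2" by simp
    then have "2 * k (s + s') = k (2 *\<^sub>R s) + k (2 *\<^sub>R s')" by (simp add: k_def)
    then show ?thesis using k_scale that by simp
  qed
  show thesis
  proof (rule that[of "\<lambda>x. k (g x)"])
    show "bounded_linear (\<lambda>x. k (g x))"
      unfolding linear_conv_bounded_linear[symmetric]
      by (rule linearI) (simp_all add: linear_add[OF g(2)] linear_scale[OF g(2)] k_add k_scale g(1))
    show "l x = l p + k (g (x - p))" if "x \<in> P" for x
    proof -
      have "x - p \<in> S" using that by (simp add: S_def)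
      then show ?thesis using g(3) by (simp add: k_def)
    qed
  qed
qed

text \<open>The argument of the complex case; an affine function equals its first order jet, so no
  part of \<epsilon> is spent on a Taylor error.\<close>

lemma not_real_q_convex_obtain:
  fixes V :: "(real ^ 'n) set"
  assumes V: "open V" and nq: "\<not> real_q_convex_set q V"
  obtains x S l \<epsilon> \<rho> where "V \<noteq> UNIV" "x \<in> V" "subspace S" "dim S = q + 1"
    "bounded_linear l" "\<epsilon> > 0" "\<rho> > 0"
    "\<And>\<xi>. \<xi> \<in> S \<Longrightarrow> norm \<xi> \<le> \<rho> \<Longrightarrow> x + \<xi> \<in> V \<and>
       log_dist V (x + \<xi>) \<le> log_dist V x + l \<xi> - \<epsilon> * (norm \<xi>)\<^sup>2"
proof -
  obtain P c r l y where P: "affine P" "aff_dim P = int (q + 1)" and r: "0 < r" and cV: "cball c r \<subseteq> V"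
    and l: "affine_fun_on P l"
    and bd: "\<And>x. x \<in> sphere c r \<inter> P \<Longrightarrow> - ext_ln (bdry_dist V x) \<le> ereal (l x)"
    and y: "y \<in> cball c r \<inter> P" "\<not> - ext_ln (bdry_dist V y) \<le> ereal (l y)"
    using nq V usc_on_neg_ext_ln_bdry_dist[OF V] neg_ext_ln_bdry_dist_less_top[OF V]
    unfolding real_q_convex_set_def real_q_convex_on_def by blast
  have VU: "V \<noteq> UNIV" using y(2) by auto
  have u: "- ext_ln (bdry_dist V z) = ereal (log_dist V z)" if "z \<in> cball c r" for z
    using neg_ext_ln_bdry_dist[OF V VU] cV that by blast
  have yP: "y \<in> P" using y by simp
  obtain m where m: "bounded_linear m" "\<And>x. x \<in> P \<Longrightarrow> l x = l y + m (x - y)"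
    using affine_fun_on_extend[OF P(1) yP l] by blast
  interpret m: bounded_linear m by fact
  define g where "g x = l y + m (x - y)" for x
  have cg: "continuous_on (cball c r) g" unfolding g_def
    by (intro continuous_intros m.continuous_on)
  have clP: "closed P" using closed_affine_hull[of P] P(1) by (simp add: affine_hull_eq[THEN iffD2])
  obtain x \<epsilon> where x: "x \<in> ball c r \<inter> P" and \<epsilon>: "\<epsilon> > 0" and
    mx: "\<And>x'. x' \<in> cball c r \<inter> P \<Longrightarrow>
       log_dist V x' - g x' + \<epsilon> * (norm (x' - c))\<^sup>2 \<le> log_dist V x - g x + \<epsilon> * (norm (x - c))\<^sup>2"
  proof (rule interior_max_of_violation[OF clP continuous_on_subset[OF continuous_on_log_dist[OF V VU] cV] cg _ y(1)])
    show "log_dist V z \<le> g z" if "z \<in> sphere c r \<inter> P" for z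
      using bd[OF that] u[of z] m(2)[of z] that by (auto simp: g_def)
    show "g y < log_dist V y" using y u[of y] m(2)[of y] by (auto simp: g_def m.zero)
  qed auto
  have xV: "x \<in> V" using x cV by (auto intro: less_imp_le)
  define S where "S = (\<lambda>y. y - x) ` P"
  have S: "subspace S" unfolding S_def using affine_diffs_subspace_subtract[OF P(1)] x by simp
  have tr: "S = (+) (- x) ` P" by (auto simp: S_def)
  have "aff_dim S = int (q + 1)" unfolding tr by (simp only: aff_dim_translation_eq P(2))
  then have dS: "dim S = q + 1" using aff_dim_subspace[OF S] by simp
  define \<rho> where "\<rho> = (r - dist c x) / 2"
  have \<rho>: "\<rho> > 0" "\<rho> < r - dist c x" using x by (auto simp: \<rho>_def)
  define k where "k \<xi> = m \<xi> - 2 * \<epsilon> * ((x - c) \<bullet> \<xi>)" for \<xi>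
  show thesis
  proof (rule that[of x S k \<epsilon> \<rho>])
    show "bounded_linear k" unfolding k_def
      by (intro bounded_linear_sub m bounded_linear_const_mult bounded_linear_inner_right)
    fix \<xi> assume \<xi>: "\<xi> \<in> S" "norm \<xi> \<le> \<rho>"
    have "x + \<xi> \<in> P" using \<xi>(1) by (auto simp: S_def)
    moreover have "dist c (x + \<xi>) \<le> dist c x + norm \<xi>"
      using dist_triangle[of c "x + \<xi>" x] by (simp add: dist_norm)
    ultimately have in_c: "x + \<xi> \<in> cball c r \<inter> P" using \<xi> \<rho> by simp
    have sq: "(norm (x + \<xi> - c))\<^sup>2 = (norm (x - c))\<^sup>2 + 2 * ((x - c) \<bullet> \<xi>) + (norm \<xi>)\<^sup>2"
      by (simp add: power2_norm_eq_inner inner_diff_left inner_diff_right inner_add_left inner_add_right inner_commute)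
    have "\<epsilon> * (norm (x + \<xi> - c))\<^sup>2 = \<epsilon> * (norm (x - c))\<^sup>2 + 2 * \<epsilon> * ((x - c) \<bullet> \<xi>) + \<epsilon> * (norm \<xi>)\<^sup>2"
      unfolding sq by (simp only: distrib_left mult.assoc mult.left_commute)
    moreover have "g (x + \<xi>) - g x = m \<xi>" by (simp add: g_def m.add m.diff)
    ultimately have "log_dist V (x + \<xi>) \<le> log_dist V x + k \<xi> - \<epsilon> * (norm \<xi>)\<^sup>2"
      using mx[OF in_c] unfolding k_def by linarith
    then show "x + \<xi> \<in> V \<and> log_dist V (x + \<xi>) \<le> log_dist V x + k \<xi> - \<epsilon> * (norm \<xi>)\<^sup>2"
      using in_c cV by auto
  qed (use VU S dS \<epsilon> \<rho> xV in auto)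
qed

section \<open>Moving the plane to a nearest boundary point\<close>

lemma exp_neg_log_dist:
  assumes "open W" "W \<noteq> UNIV" "z \<in> W"
  shows "exp (- log_dist W z) = infdist z (- W)"
  using infdist_compl_pos[OF assms] by (simp add: log_dist_def)

lemma nearest_complement_point:
  fixes W :: "'a::euclidean_space set"
  assumes W: "open W" "W \<noteq> UNIV" "z \<in> W"
  obtains v where "norm v = 1" "z + infdist z (- W) *\<^sub>R v \<notin> W"
proof -
  obtain y where y: "y \<notin> W" "infdist z (- W) = dist z y"
    using infdist_compl_attained[OF W(1,2)] by blast
  have d: "infdist z (- W) > 0" by (rule infdist_compl_pos[OF W])
  show thesis
    by (rule that[of "(1 / infdist z (- W)) *\<^sub>R (y - z)"])
       (use y d in \<open>simp_all add: dist_norm norm_minus_commute\<close>)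
qed

text \<open>Completes \<open>l\<close> to the functional that enters the shift towards the boundary;
  compatibility with \<i> makes its square change sign under multiplication by \<i>.\<close>

lemma complex_linear_of_Re:
  fixes l :: "complex ^ 'n \<Rightarrow> real"
  assumes "bounded_linear l"
  defines "f \<equiv> \<lambda>\<zeta>. Complex (l \<zeta>) (- l (\<i> *s \<zeta>))"
  shows "bounded_linear f" "f (\<i> *s \<zeta>) = \<i> * f \<zeta>" "Re (f \<zeta>) = l \<zeta>"
proof -
  interpret bounded_linear l by fact
  have sc: "\<i> *s (r *\<^sub>R b) = r *\<^sub>R (\<i> *s b)" for r and b :: "complex ^ 'n"
    by (simp add: vec_eq_iff)
  have "linear f"
    by (rule linearI) (simp_all add: f_def complex_eq_iff add vec.scale_right_distrib scaleR sc)
  then show "bounded_linear f" by (simp add: linear_conv_bounded_linear)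
  show "f (\<i> *s \<zeta>) = \<i> * f \<zeta>" "Re (f \<zeta>) = l \<zeta>" by (simp_all add: f_def complex_eq_iff linear_neg[OF linear_axioms])
qed

text \<open>Each point \<open>z + \<zeta>\<close> is moved in the direction \<open>v\<close> by
  \<delta> times the jet of \<open>exp (- f \<zeta> - H \<zeta> \<zeta> - \<tau>)\<close>. The bound
  on \<open>log_dist\<close> says that the distance at \<open>z + \<zeta>\<close> is at least
  \<delta> times \<open>exp (- Re (f \<zeta>) - H \<zeta> \<zeta> + \<epsilon> * (norm
  \<zeta>)\<^sup>2)\<close>, so by \<open>quadratic_jet_less_exp\<close> the moved point and its
  room stay in \<open>W\<close>. For \<zeta> = 0 and \<tau> = 0 it is the nearest point
  itself.\<close>

lemma touches_of_log_dist_bound: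
  fixes W :: "(complex ^ 'n) set"
  assumes W: "open W" "W \<noteq> UNIV" "z \<in> W" and v: "norm v = 1" "z + infdist z (- W) *\<^sub>R v \<notin> W"
    and f: "bounded_linear f" and H: "bounded_bilinear H" and \<epsilon>: "\<epsilon> > 0" and \<rho>: "\<rho> > 0"
    and le: "\<And>\<zeta>. \<zeta> \<in> S \<Longrightarrow> norm \<zeta> \<le> \<rho> \<Longrightarrow> z + \<zeta> \<in> W \<and>
       log_dist W (z + \<zeta>) \<le> log_dist W z + Re (f \<zeta>) + H \<zeta> \<zeta> - \<epsilon> * (norm \<zeta>)\<^sup>2"
  defines "\<delta> \<equiv> infdist z (- W)"
  shows "touches W S (z + \<delta> *\<^sub>R v) (\<lambda>\<zeta>. \<zeta> - (of_real \<delta> * f \<zeta>) *s v)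
    (\<lambda>\<zeta> \<zeta>'. (of_real \<delta> * (f \<zeta> * f \<zeta>' / 2 - of_real (H \<zeta> \<zeta>'))) *s v) (- \<delta> *\<^sub>R v)"
proof -
  have \<delta>: "\<delta> > 0" unfolding \<delta>_def by (rule infdist_compl_pos[OF W])
  obtain c \<sigma> where c: "c > 0" "\<sigma> > 0" and jet:
    "\<And>\<zeta> \<tau>. \<tau> > 0 \<Longrightarrow> (norm \<zeta>)\<^sup>2 + \<tau> \<le> \<sigma> \<Longrightarrow>
       cmod (1 - f \<zeta> + (f \<zeta>)\<^sup>2 / 2 - of_real (H \<zeta> \<zeta>) - of_real \<tau>) + c * ((norm \<zeta>)\<^sup>2 + \<tau>)
       \<le> exp (- Re (f \<zeta>) - H \<zeta> \<zeta> + \<epsilon> * (norm \<zeta>)\<^sup>2)"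
    using quadratic_jet_less_exp[OF f H \<epsilon>] by blast
  show ?thesis
  proof (rule touchesI[of _ _ "\<delta> * c" "min \<sigma> (\<rho>\<^sup>2)"])
    show "z + \<delta> *\<^sub>R v \<notin> W" using v by (simp add: \<delta>_def)
    show "\<delta> * c > 0" "min \<sigma> (\<rho>\<^sup>2) > 0" using \<delta> c \<rho> by auto
    fix \<zeta> :: "complex ^ 'n" and \<tau> :: real
    assume \<zeta>: "\<zeta> \<in> S" and \<tau>: "\<tau> > 0" and small: "(norm \<zeta>)\<^sup>2 + \<tau> \<le> min \<sigma> (\<rho>\<^sup>2)"
    have "norm \<zeta> \<le> \<rho>" 
    proof (rule power2_le_imp_le)
      have "(norm \<zeta>)\<^sup>2 + \<tau> \<le> \<rho>\<^sup>2" using small by simp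
      then show "(norm \<zeta>)\<^sup>2 \<le> \<rho>\<^sup>2" using \<tau> by linarith
    qed (use \<rho> in simp)
    then have in_W: "z + \<zeta> \<in> W" and
      ld: "log_dist W (z + \<zeta>) \<le> log_dist W z + Re (f \<zeta>) + H \<zeta> \<zeta> - \<epsilon> * (norm \<zeta>)\<^sup>2"
      using le[OF \<zeta>] by auto
    define s where "s = 1 - f \<zeta> + (f \<zeta>)\<^sup>2 / 2 - of_real (H \<zeta> \<zeta>) - of_real \<tau>"
    define R where "R = exp (- Re (f \<zeta>) - H \<zeta> \<zeta> + \<epsilon> * (norm \<zeta>)\<^sup>2)"
    have "exp (- log_dist W z) * R \<le> exp (- log_dist W (z + \<zeta>))"
      unfolding R_def exp_add[symmetric] using ld by simp
    then have \<delta>R: "\<delta> * R \<le> infdist (z + \<zeta>) (- W)"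
      using exp_neg_log_dist[OF W] exp_neg_log_dist[OF W(1,2) in_W] by (simp add: \<delta>_def)
    have eq: "z + \<delta> *\<^sub>R v + (\<zeta> - (of_real \<delta> * f \<zeta>) *s v) +
        (of_real \<delta> * (f \<zeta> * f \<zeta> / 2 - of_real (H \<zeta> \<zeta>))) *s v + \<tau> *\<^sub>R (- \<delta> *\<^sub>R v) = z + \<zeta> + (of_real \<delta> * s) *s v"
      unfolding scaleR_eq_vector_scalar_mult s_def
      by (simp add: vec_eq_iff algebra_simps power2_eq_square)
    have "ball (z + \<zeta> + (of_real \<delta> * s) *s v) (\<delta> * c * ((norm \<zeta>)\<^sup>2 + \<tau>)) \<subseteq> ball (z + \<zeta>) (infdist (z + \<zeta>) (- W))"
    proof
      fix x assume x: "x \<in> ball (z + \<zeta> + (of_real \<delta> * s) *s v) (\<delta> * c * ((norm \<zeta>)\<^sup>2 + \<tau>))"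
      have "dist (z + \<zeta>) x \<le> dist (z + \<zeta>) (z + \<zeta> + (of_real \<delta> * s) *s v) + dist (z + \<zeta> + (of_real \<delta> * s) *s v) x"
        by (rule dist_triangle)
      also have "dist (z + \<zeta>) (z + \<zeta> + (of_real \<delta> * s) *s v) = \<delta> * cmod s"
        using \<delta> v by (simp add: dist_norm norm_mult)
      also have "\<delta> * cmod s + dist (z + \<zeta> + (of_real \<delta> * s) *s v) x < \<delta> * cmod s + \<delta> * (c * ((norm \<zeta>)\<^sup>2 + \<tau>))"
        using x by (simp add: mult.assoc)
      also have "\<dots> = \<delta> * (cmod s + c * ((norm \<zeta>)\<^sup>2 + \<tau>))" by (simp add: distrib_left)
      also have "\<dots> \<le> \<delta> * R"
        unfolding s_def R_def using jet[OF \<tau>, of \<zeta>] small \<delta> by (intro mult_left_mono) auto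
      also note \<delta>R
      finally show "x \<in> ball (z + \<zeta>) (infdist (z + \<zeta>) (- W))" by simp
    qed
    also have "\<dots> \<subseteq> W" by (rule ball_infdist_compl)
    finally show "ball (z + \<delta> *\<^sub>R v + (\<zeta> - (of_real \<delta> * f \<zeta>) *s v) +
        (of_real \<delta> * (f \<zeta> * f \<zeta> / 2 - of_real (H \<zeta> \<zeta>))) *s v + \<tau> *\<^sub>R (- \<delta> *\<^sub>R v)) (\<delta> * c * ((norm \<zeta>)\<^sup>2 + \<tau>)) \<subseteq> W"
      unfolding eq .
  qed
qed

section \<open>Coordinate hyperplanes in the complement of \<open>Omega V\<close>\<close>

lemma open_Omega:
  fixes V :: "(real ^ 'n) set"
  assumes "open V"
  shows "open (Omega V)"
proof -
  let ?T = "\<Inter>i. {z :: complex ^ 'n. z $ i \<noteq> 0}"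
  have "open {z :: complex ^ 'n. z $ i \<noteq> 0}" for i
    by (intro open_Collect_neq continuous_intros)
  then have "open ?T" by (intro open_INT) simp_all
  moreover have "continuous_on ?T (\<lambda>z. \<chi> i. ln (cmod (z $ i)))"
    by (intro continuous_intros) auto
  ultimately have "open (?T \<inter> (\<lambda>z. \<chi> i. ln (cmod (z $ i))) -` V)"
    using assms by (intro continuous_open_preimage)
  moreover have "Omega V = ?T \<inter> (\<lambda>z. \<chi> i. ln (cmod (z $ i))) -` V"
    by (auto simp: Omega_def)
  ultimately show ?thesis by simp
qed

text \<open>Setting the \<open>j\<close>-th coordinate to 0 leaves \<open>Omega V\<close>.\<close>

lemma infdist_compl_Omega_le:
  "infdist z (- Omega V) \<le> cmod (z $ j)"
proof -
  have "(\<chi> i. if i = j then 0 else z $ i) \<notin> Omega V" by (auto simp: mem_Omega)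
  then have "infdist z (- Omega V) \<le> dist z (\<chi> i. if i = j then 0 else z $ i)" by (intro infdist_le) simp
  also have "z - (\<chi> i. if i = j then 0 else z $ i) = axis j (z $ j)"
    by (simp add: vec_eq_iff axis_def)
  then have "dist z (\<chi> i. if i = j then 0 else z $ i) = cmod (z $ j)"
    by (simp add: dist_norm norm_eq_sqrt_inner inner_axis_axis)
  finally show ?thesis .
qed

text \<open>If a coordinate of the nearest point vanishes, then the boundary distance at \<open>z\<close> is
  \<open>\<bar>z\<^sub>j\<bar>\<close>, and \<open>- ln \<bar>z\<^sub>j\<bar>\<close> is pluriharmonic. Averaging the bound over the four points
  \<open>\<plusminus> \<eta>\<close>, \<open>\<plusminus> \<i> \<eta>\<close> leaves only the strictly negative term.\<close>
lemma nearest_point_Omega_nonzero: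
  assumes V: "open V" and z: "z \<in> Omega V" and v: "norm v = 1"
    and S: "vec.subspace S" "\<eta> \<in> S" "\<eta> \<noteq> 0"
    and l: "bounded_linear l" and H: "bounded_bilinear H" "\<And>\<zeta>. H (\<i> *s \<zeta>) (\<i> *s \<zeta>) = - H \<zeta> \<zeta>"
    and \<epsilon>: "\<epsilon> > 0" and \<rho>: "\<rho> > 0"
    and le: "\<And>\<zeta>. \<zeta> \<in> S \<Longrightarrow> norm \<zeta> \<le> \<rho> \<Longrightarrow> z + \<zeta> \<in> Omega V \<and>
       log_dist (Omega V) (z + \<zeta>) \<le> log_dist (Omega V) z + l \<zeta> + H \<zeta> \<zeta> - \<epsilon> * (norm \<zeta>)\<^sup>2"
  shows "(z + infdist z (- Omega V) *\<^sub>R v) $ j \<noteq> 0"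
proof
  assume zero: "(z + infdist z (- Omega V) *\<^sub>R v) $ j = 0"
  interpret l: bounded_linear l by fact
  interpret H: bounded_bilinear H by fact
  have W: "open (Omega V)" by (rule open_Omega[OF V])
  have "0 \<notin> Omega V" by (simp add: mem_Omega)
  then have WU: "Omega V \<noteq> UNIV" by blast
  define \<delta> where "\<delta> = infdist z (- Omega V)"
  have \<delta>: "\<delta> > 0" unfolding \<delta>_def by (rule infdist_compl_pos[OF W WU z])
  \<comment> \<open>Since \<open>v\<close> is a unit vector, the vanishing coordinate gives one
    inequality; the hyperplane gives the other.\<close>
  have zj: "cmod (z $ j) = \<delta>"
  proof (rule antisym)
    have "z $ j = - (\<delta> *\<^sub>R v $ j)" using zero by (simp add: \<delta>_def add_eq_0_iff)
    then have "cmod (z $ j) = \<delta> * cmod (v $ j)" using \<delta> by simp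
    also have "\<dots> \<le> \<delta> * 1" using \<delta> v Finite_Cartesian_Product.norm_nth_le[of v j] by (intro mult_left_mono) auto
    finally show "cmod (z $ j) \<le> \<delta>" by simp
    show "\<delta> \<le> cmod (z $ j)" unfolding \<delta>_def by (rule infdist_compl_Omega_le)
  qed
  then have zj0: "z $ j \<noteq> 0" using \<delta> by auto
  define s where "s = \<eta> $ j / z $ j"
  have ineq: "exp (- l \<zeta> - H \<zeta> \<zeta> + \<epsilon> * (norm \<zeta>)\<^sup>2) \<le> cmod (1 + \<zeta> $ j / z $ j)"
    if \<zeta>: "\<zeta> \<in> S" "norm \<zeta> \<le> \<rho>" for \<zeta>
  proof -
    have in_W: "z + \<zeta> \<in> Omega V" and
      ld: "log_dist (Omega V) (z + \<zeta>) \<le> log_dist (Omega V) z + l \<zeta> + H \<zeta> \<zeta> - \<epsilon> * (norm \<zeta>)\<^sup>2"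
      using le[OF \<zeta>] by auto
    have "exp (- log_dist (Omega V) z) * exp (- l \<zeta> - H \<zeta> \<zeta> + \<epsilon> * (norm \<zeta>)\<^sup>2) \<le> exp (- log_dist (Omega V) (z + \<zeta>))"
      unfolding exp_add[symmetric] using ld by simp
    then have "\<delta> * exp (- l \<zeta> - H \<zeta> \<zeta> + \<epsilon> * (norm \<zeta>)\<^sup>2) \<le> infdist (z + \<zeta>) (- Omega V)"
      using exp_neg_log_dist[OF W WU z] exp_neg_log_dist[OF W WU in_W] by (simp add: \<delta>_def)
    also have "\<dots> \<le> cmod ((z + \<zeta>) $ j)" by (rule infdist_compl_Omega_le)
    also have "(z + \<zeta>) $ j = z $ j * (1 + \<zeta> $ j / z $ j)" using zj0 by (simp add: distrib_left)
    also have "cmod \<dots> = \<delta> * cmod (1 + \<zeta> $ j / z $ j)" by (simp only: norm_mult zj)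
    finally show ?thesis using \<delta> by simp
  qed
  define N where "N = (norm \<eta>)\<^sup>2"
  have N: "N > 0" using S by (simp add: N_def)
  have key: "4 * \<epsilon> * N * t\<^sup>2 \<le> (cmod s) ^ 4 * t ^ 4" if t: "0 < t" "t * norm \<eta> \<le> \<rho>" for t
  proof -
    define a where "a = t *\<^sub>R \<eta>"
    define w where "w = t *\<^sub>R s"
    define E where "E = \<epsilon> * (norm a)\<^sup>2"
    have inS: "a \<in> S" "- a \<in> S" "\<i> *s a \<in> S" "- (\<i> *s a) \<in> S"
      using S by (simp_all add: a_def scaleR_eq_vector_scalar_mult vec.subspace_scale vec.subspace_neg)
    have n: "norm a \<le> \<rho>" "norm (- a) \<le> \<rho>" "norm (\<i> *s a) \<le> \<rho>" "norm (- (\<i> *s a)) \<le> \<rho>"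
      using t by (simp_all add: a_def)
    have wj: "a $ j / z $ j = w" "(- a) $ j / z $ j = - w"
      "(\<i> *s a) $ j / z $ j = \<i> * w" "(- (\<i> *s a)) $ j / z $ j = - (\<i> * w)"
      unfolding w_def s_def a_def vector_scaleR_component vector_uminus_component vector_smult_component
      by (simp_all add: scaleR_conv_of_real)
    have nE: "\<epsilon> * (norm a)\<^sup>2 = E" "\<epsilon> * (norm (- a))\<^sup>2 = E" "\<epsilon> * (norm (\<i> *s a))\<^sup>2 = E" "\<epsilon> * (norm (- (\<i> *s a)))\<^sup>2 = E"
      by (simp_all add: E_def)
    have lm: "l (- b) = - l b" "H (- b) (- b) = H b b" for b
      by (simp_all add: linear_neg[OF l.linear_axioms] H.minus_left H.minus_right)
    have i1: "exp (- l a - H a a + E) \<le> cmod (1 + w)"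
      using ineq[OF inS(1) n(1)] by (simp only: wj nE)
    have i2: "exp (l a - H a a + E) \<le> cmod (1 - w)"
      using ineq[OF inS(2) n(2)] by (simp only: wj nE lm minus_minus diff_conv_add_uminus)
    have i3: "exp (- l (\<i> *s a) + H a a + E) \<le> cmod (1 + \<i> * w)"
      using ineq[OF inS(3) n(3)] by (simp only: wj nE H(2) minus_minus diff_conv_add_uminus)
    have i4: "exp (l (\<i> *s a) + H a a + E) \<le> cmod (1 - \<i> * w)"
      using ineq[OF inS(4) n(4)] by (simp only: wj nE lm H(2) minus_minus diff_conv_add_uminus)
    \<comment> \<open>In the product of the four bounds the terms with \<open>l\<close> and
      \<open>H\<close> cancel, and the right-hand side becomes the modulus of
      \<open>1 - w ^ 4\<close>. A gain quadratic in \<open>t\<close> is thus bounded by a quartic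
      term, which is impossible as \<open>t\<close> tends to 0.\<close>
    have "exp (4 * E) = (exp (- l a - H a a + E) * exp (l a - H a a + E)) *
        (exp (- l (\<i> *s a) + H a a + E) * exp (l (\<i> *s a) + H a a + E))"
      unfolding exp_add[symmetric] by simp
    also have "\<dots> \<le> (cmod (1 + w) * cmod (1 - w)) * (cmod (1 + \<i> * w) * cmod (1 - \<i> * w))"
      by (intro mult_mono i1 i2 i3 i4) auto
    also have "\<dots> = cmod ((1 + w) * (1 - w) * ((1 + \<i> * w) * (1 - \<i> * w)))" by (simp add: norm_mult)
    also have "(1 + w) * (1 - w) * ((1 + \<i> * w) * (1 - \<i> * w)) = 1 - w ^ 4"
      by (simp add: algebra_simps power4_eq_xxxx)
    also have "cmod (1 - w ^ 4) \<le> 1 + (cmod w) ^ 4"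
      using norm_triangle_ineq4[of 1 "w ^ 4"] by (simp add: norm_power)
    finally have "exp (4 * E) \<le> 1 + (cmod w) ^ 4" .
    moreover have "1 + 4 * E \<le> exp (4 * E)" by (rule exp_ge_add_one_self)
    moreover have "(cmod w) ^ 4 = (cmod s) ^ 4 * t ^ 4" using t by (simp add: w_def power_mult_distrib)
    moreover have "4 * E = 4 * \<epsilon> * N * t\<^sup>2" by (simp add: E_def N_def a_def power_mult_distrib)
    ultimately show ?thesis by linarith
  qed
  have "((\<lambda>t. (cmod s) ^ 4 * t\<^sup>2) \<longlongrightarrow> (cmod s) ^ 4 * 0\<^sup>2) (at_right 0)" by (intro tendsto_intros)
  moreover have "\<forall>\<^sub>F t in at_right 0. 4 * \<epsilon> * N \<le> (cmod s) ^ 4 * t\<^sup>2"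
  proof -
    have "\<forall>\<^sub>F t in at_right (0::real). t \<in> {0<..<\<rho> / norm \<eta>}"
      using \<rho> S by (intro eventually_at_right_real) simp
    then show ?thesis
    proof eventually_elim
      case (elim t)
      then have t: "0 < t" "t * norm \<eta> \<le> \<rho>" using S by (auto simp: pos_less_divide_eq)
      have "t\<^sup>2 * (4 * \<epsilon> * N) \<le> t\<^sup>2 * ((cmod s) ^ 4 * t\<^sup>2)"
        using key[OF t] by (simp add: power2_eq_square power4_eq_xxxx mult_ac)
      then show ?case using t by simp
    qed
  qed
  ultimately have "4 * \<epsilon> * N \<le> (cmod s) ^ 4 * 0\<^sup>2" by (rule tendsto_lowerbound) simp
  then have "4 * \<epsilon> * N \<le> 0" by simp
  moreover have "4 * \<epsilon> * N > 0" using \<epsilon> N by simp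
  ultimately show False by linarith
qed

subsection \<open>The equivalence\<close>

definition complexification :: "(real ^ 'n) set \<Rightarrow> (complex ^ 'n) set" where
  "complexification S = {\<zeta>. Re_vec \<zeta> \<in> S \<and> Im_vec \<zeta> \<in> S}"

lemma Re_vec_simps [simp]:
  "Re_vec (x + y) = Re_vec x + Re_vec y" "Re_vec (x - y) = Re_vec x - Re_vec y"
  "Re_vec (r *\<^sub>R x) = r *\<^sub>R Re_vec x" "Re_vec (c *s x) = Re c *\<^sub>R Re_vec x - Im c *\<^sub>R Im_vec x"
  "Re_vec 0 = 0" "Re_vec (of_real_vec a) = a"
  by (simp_all add: Re_vec_def Im_vec_def of_real_vec_def vec_eq_iff)

lemma Im_vec_simps [simp]:
  "Im_vec (x + y) = Im_vec x + Im_vec y" "Im_vec (x - y) = Im_vec x - Im_vec y"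
  "Im_vec (r *\<^sub>R x) = r *\<^sub>R Im_vec x" "Im_vec (c *s x) = Re c *\<^sub>R Im_vec x + Im c *\<^sub>R Re_vec x"
  "Im_vec 0 = 0" "Im_vec (of_real_vec a) = 0"
  by (simp_all add: Re_vec_def Im_vec_def of_real_vec_def vec_eq_iff)

lemma Re_Im_vec_eq: "z = of_real_vec (Re_vec z) + \<i> *s of_real_vec (Im_vec z)"
  by (simp add: vec_eq_iff Re_vec_def Im_vec_def of_real_vec_def complex_eq_iff)

lemma power2_norm_Re_Im_vec: "(norm z)\<^sup>2 = (norm (Re_vec z))\<^sup>2 + (norm (Im_vec z))\<^sup>2"
  by (simp add: power2_norm_eq_inner inner_vec_def inner_complex_def Re_vec_def Im_vec_def sum.distrib)

lemma linear_Re_vec: "linear Re_vec"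
  by (rule linearI) simp_all

lemma subspace_complexification:
  assumes "subspace S"
  shows "vec.subspace (complexification S)"
  using assms unfolding vec.subspace_def complexification_def subspace_def
  by (simp add: subspace_diff[OF assms] subspace_scale[OF assms])

text \<open>A real basis of \<open>S\<close> is a complex basis of its complexification: a complex
  relation splits into real and imaginary parts, each of which is a real relation.\<close>

lemma dim_complexification:
  fixes S :: "(real ^ 'n) set"
  assumes S: "subspace S"
  shows "vec.dim (complexification S) = dim S"
proof -
  obtain B where B: "B \<subseteq> S" "independent B" "S \<subseteq> span B" "card B = dim S"
    using basis_exists[of S] by metis
  have finB: "finite B" using B(2) by (rule independent_imp_finite)
  have inj: "inj of_real_vec" by (metis Re_vec_simps(6) injI)
  have of_real_add: "of_real_vec (x + y) = of_real_vec x + of_real_vec y" for x y :: "real ^ 'n"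
    by (simp add: of_real_vec_def vec_eq_iff)
  have of_real_scale: "of_real_vec (r *\<^sub>R x) = of_real r *s of_real_vec x" for r and x :: "real ^ 'n"
    by (simp add: of_real_vec_def vec_eq_iff)
  have of_real_0: "of_real_vec 0 = (0 :: complex ^ 'n)" by (simp add: of_real_vec_def vec_eq_iff)
  show ?thesis
  proof (rule vec.dim_unique)
    show "of_real_vec ` B \<subseteq> complexification S"
      using B(1) subspace_0[OF S] by (auto simp: complexification_def)
    show "card (of_real_vec ` B) = dim S"
      using B(4) card_image[OF inj_on_subset[OF inj subset_UNIV, of B]] by simp
    have span: "of_real_vec x \<in> vec.span (of_real_vec ` B)" if "x \<in> S" for x
    proof -
      have "x \<in> span B" using that B(3) by blast
      then show ?thesis
        by (induction rule: span_induct_alt)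
           (simp_all add: of_real_0 of_real_add of_real_scale vec.span_add vec.span_scale vec.span_base vec.span_zero)
    qed
    show "complexification S \<subseteq> vec.span (of_real_vec ` B)"
    proof
      fix z assume "z \<in> complexification S"
      then have "of_real_vec (Re_vec z) + \<i> *s of_real_vec (Im_vec z) \<in> vec.span (of_real_vec ` B)"
        by (intro vec.span_add vec.span_scale span) (auto simp: complexification_def)
      then show "z \<in> vec.span (of_real_vec ` B)" using Re_Im_vec_eq[of z] by simp
    qed
    show "vec.independent (of_real_vec ` B)"
    proof (rule vec.independent_if_scalars_zero)
      show "finite (of_real_vec ` B)" using finB by simp
      fix f x assume sum0: "(\<Sum>x\<in>of_real_vec ` B. f x *s x) = (0 :: complex ^ 'n)" and x: "x \<in> of_real_vec ` B"
      obtain b where b: "b \<in> B" "x = of_real_vec b" using x by blast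
      have s: "(\<Sum>b\<in>B. f (of_real_vec b) *s of_real_vec b) = (0 :: complex ^ 'n)"
        using sum0 by (subst (asm) sum.reindex) (auto intro: inj_on_subset[OF inj])
      have "(\<Sum>b\<in>B. Re (f (of_real_vec b)) *\<^sub>R b) = Re_vec (\<Sum>b\<in>B. f (of_real_vec b) *s of_real_vec b)"
        by (simp add: linear_sum[OF linear_Re_vec])
      then have "Re (f x) = 0"
        using independentD[OF B(2) finB subset_refl, of "\<lambda>b. Re (f (of_real_vec b))" b] b s by simp
      moreover have li: "linear Im_vec" by (rule linearI) simp_all
      have "(\<Sum>b\<in>B. Im (f (of_real_vec b)) *\<^sub>R b) = Im_vec (\<Sum>b\<in>B. f (of_real_vec b) *s of_real_vec b)"
        by (simp add: linear_sum[OF li])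
      then have "Im (f x) = 0"
        using independentD[OF B(2) finB subset_refl, of "\<lambda>b. Im (f (of_real_vec b))" b] b s by simp
      ultimately show "f x = 0" by (simp add: complex_eq_iff)
    qed
  qed
qed

text \<open>The complex linear extension of \<open>l\<close> when \<open>l\<close> is real
  linear.\<close>

definition complexify :: "(real ^ 'n \<Rightarrow> real) \<Rightarrow> complex ^ 'n \<Rightarrow> complex" where
  "complexify l \<zeta> = Complex (l (Re_vec \<zeta>)) (l (Im_vec \<zeta>))"

text \<open>Bilinear rather than Hermitian, so that it is holomorphic in both arguments; on real
  vectors it is the inner product.\<close>

definition dot :: "complex ^ 'n \<Rightarrow> complex ^ 'n \<Rightarrow> complex" where
  "dot \<zeta> \<zeta>' = (\<Sum>i\<in>UNIV. \<zeta> $ i * \<zeta>' $ i)"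

lemma complexify_linear:
  assumes "linear l"
  shows "complexify l (x + y) = complexify l x + complexify l y" "complexify l (c *s x) = c * complexify l x"
  using assms by (simp_all add: complexify_def complex_eq_iff linear_add linear_diff linear_scale)

lemma dot_bilinear:
  "dot (x + x') y = dot x y + dot x' y" "dot x (y + y') = dot x y + dot x y'"
  "dot (c *s x) y = c * dot x y" "dot x (c *s y) = c * dot x y"
  by (simp_all add: dot_def sum.distrib algebra_simps sum_distrib_left)

lemma Re_dot_self: "Re (dot \<zeta> \<zeta>) = (norm (Re_vec \<zeta>))\<^sup>2 - (norm (Im_vec \<zeta>))\<^sup>2"
  by (simp add: dot_def power2_norm_eq_inner inner_vec_def Re_vec_def Im_vec_def sum_subtractf)

text \<open>The term \<open>dot \<zeta> \<zeta>'\<close> is paid for by the quadratic room left in the real directions; its real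
  part is negative in the imaginary directions, where the boundary of the tube is flat.\<close>
lemma tube_touches:
  fixes V :: "(real ^ 'n) set"
  assumes V: "open V" "V \<noteq> UNIV" "x \<in> V" and v: "norm v = 1" "x + infdist x (- V) *\<^sub>R v \<notin> V"
    and l: "bounded_linear l" and \<epsilon>: "\<epsilon> > 0" and \<rho>: "\<rho> > 0"
    and le: "\<And>\<xi>. \<xi> \<in> S \<Longrightarrow> norm \<xi> \<le> \<rho> \<Longrightarrow> x + \<xi> \<in> V \<and>
       log_dist V (x + \<xi>) \<le> log_dist V x + l \<xi> - \<epsilon> * (norm \<xi>)\<^sup>2"
  defines "\<delta> \<equiv> infdist x (- V)"
  obtains c1 :: real where "touches V (complexification S) (x + \<delta> *\<^sub>R v)
    (\<lambda>\<zeta>. Re_vec (\<zeta> - (of_real \<delta> * complexify l \<zeta>) *s of_real_vec v))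
    (\<lambda>\<zeta> \<zeta>'. Re_vec ((of_real \<delta> * (complexify l \<zeta> * complexify l \<zeta>' / 2 + of_real c1 * dot \<zeta> \<zeta>')) *s of_real_vec v))
    (- \<delta> *\<^sub>R v)"
proof -
  interpret l: bounded_linear l by fact
  have \<delta>: "\<delta> > 0" unfolding \<delta>_def by (rule infdist_compl_pos[OF V])
  have f: "bounded_linear (\<lambda>\<xi>. complex_of_real (l \<xi>))"
    by (rule bounded_linear_compose[OF bounded_linear_of_real l])
  have H: "bounded_bilinear (\<lambda>\<xi> \<xi>'. 0 :: real)" by unfold_locales (auto intro: exI[of _ 0])
  obtain c \<sigma> where c: "c > 0" "\<sigma> > 0" and jet0:
    "\<And>\<xi> \<tau>. \<tau> > 0 \<Longrightarrow> (norm \<xi>)\<^sup>2 + \<tau> \<le> \<sigma> \<Longrightarrow>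
       cmod (1 - of_real (l \<xi>) + (of_real (l \<xi>))\<^sup>2 / 2 - of_real 0 - of_real \<tau>) + c * ((norm \<xi>)\<^sup>2 + \<tau>)
       \<le> exp (- Re (of_real (l \<xi>)) - 0 + \<epsilon> * (norm \<xi>)\<^sup>2)"
    using quadratic_jet_less_exp[OF f H \<epsilon>] by metis
  have jet: "\<bar>1 - l \<xi> + (l \<xi>)\<^sup>2 / 2 - \<tau>\<bar> + c * ((norm \<xi>)\<^sup>2 + \<tau>) \<le> exp (- l \<xi> + \<epsilon> * (norm \<xi>)\<^sup>2)"
    if "\<tau> > 0" "(norm \<xi>)\<^sup>2 + \<tau> \<le> \<sigma>" for \<xi> \<tau>
  proof -
    have "1 - of_real (l \<xi>) + (of_real (l \<xi>))\<^sup>2 / 2 - of_real 0 - of_real \<tau> = complex_of_real (1 - l \<xi> + (l \<xi>)\<^sup>2 / 2 - \<tau>)"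
      by simp
    then show ?thesis using jet0[OF that] by (simp only: norm_of_real Re_complex_of_real diff_zero)
  qed
  obtain b where b: "b > 0" "\<And>\<xi>. \<bar>l \<xi>\<bar> \<le> norm \<xi> * b" using l.pos_bounded by auto
  \<comment> \<open>Half of the room in the real directions is given up, because there
    \<open>dot\<close> moves the point towards the boundary by a multiple of
    \<open>c1 * (norm \<xi>)\<^sup>2\<close>.\<close>
  define c1 where "c1 = c / 2"
  have c1: "c1 > 0" using c by (simp add: c1_def)
  define M where "M = 1 + b\<^sup>2 / 2 + c1"
  have M: "M \<ge> 1" using c1 by (simp add: M_def)
  \<comment> \<open>What remains as room: \<open>c1\<close> from \<xi>, \<open>c * c1\<close> from
    \<eta> and \<open>c\<close> from \<tau>.\<close>
  define m where "m = min c1 (c * c1)"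
  have m: "m > 0" "m \<le> c1" "m \<le> c * c1" "m \<le> c" using c c1 by (auto simp: m_def c1_def min_def)
  show thesis
  proof (rule that[of c1], rule touchesI[of _ _ "\<delta> * m" "min (\<sigma> / M) (\<rho>\<^sup>2)"])
    show "x + \<delta> *\<^sub>R v \<notin> V" using v by (simp add: \<delta>_def)
    show "\<delta> * m > 0" "min (\<sigma> / M) (\<rho>\<^sup>2) > 0" using \<delta> m c M \<rho> by auto
    fix \<zeta> :: "complex ^ 'n" and \<tau> :: real
    assume \<zeta>: "\<zeta> \<in> complexification S" and \<tau>: "\<tau> > 0" and small: "(norm \<zeta>)\<^sup>2 + \<tau> \<le> min (\<sigma> / M) (\<rho>\<^sup>2)"
    define \<xi> \<eta> where "\<xi> = Re_vec \<zeta>" and "\<eta> = Im_vec \<zeta>"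
    have \<xi>: "\<xi> \<in> S" using \<zeta> by (simp add: complexification_def \<xi>_def)
    have nn: "(norm \<zeta>)\<^sup>2 = (norm \<xi>)\<^sup>2 + (norm \<eta>)\<^sup>2" by (simp add: \<xi>_def \<eta>_def power2_norm_Re_Im_vec)
    \<comment> \<open>The real parts of the squares are negative in \<eta>: the imaginary directions
      act like an additional inward shift, so the real estimate is applied with
      \<open>\<tau>'\<close> in place of \<tau>.\<close>
    define \<tau>' where "\<tau>' = \<tau> + (l \<eta>)\<^sup>2 / 2 + c1 * (norm \<eta>)\<^sup>2"
    have \<tau>': "\<tau>' > 0" unfolding \<tau>'_def using \<tau> c1 by (simp add: add_pos_nonneg)
    have "norm \<xi> \<le> \<rho>"
    proof (rule power2_le_imp_le)
      have "(norm \<zeta>)\<^sup>2 + \<tau> \<le> \<rho>\<^sup>2" using small by simp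
      then show "(norm \<xi>)\<^sup>2 \<le> \<rho>\<^sup>2" using \<tau> zero_le_power2[of "norm \<eta>"] unfolding nn by linarith
    qed (use \<rho> in simp)
    then have in_V: "x + \<xi> \<in> V" and ld: "log_dist V (x + \<xi>) \<le> log_dist V x + l \<xi> - \<epsilon> * (norm \<xi>)\<^sup>2"
      using le[OF \<xi>] by auto
    have small': "(norm \<xi>)\<^sup>2 + \<tau>' \<le> \<sigma>"
    proof -
      have "(l \<eta>)\<^sup>2 \<le> (norm \<eta> * b)\<^sup>2" using b(2)[of \<eta>] by (simp add: abs_le_square_iff[symmetric] b(1) less_imp_le)
      then have "(norm \<xi>)\<^sup>2 + \<tau>' \<le> 1 * (norm \<xi>)\<^sup>2 + 1 * \<tau> + (b\<^sup>2 / 2 + c1) * (norm \<eta>)\<^sup>2"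
        unfolding \<tau>'_def by (simp add: power_mult_distrib algebra_simps)
      also have "\<dots> \<le> M * (norm \<xi>)\<^sup>2 + M * \<tau> + M * (norm \<eta>)\<^sup>2"
        using M \<tau> by (intro add_mono mult_right_mono) (auto simp: M_def)
      also have "\<dots> = M * ((norm \<zeta>)\<^sup>2 + \<tau>)" unfolding nn by (simp add: algebra_simps)
      also have "\<dots> \<le> M * (\<sigma> / M)" using small M by (intro mult_left_mono) auto
      also have "\<dots> = \<sigma>" using M by simp
      finally show ?thesis .
    qed
    define s where "s = 1 - l \<xi> + (l \<xi>)\<^sup>2 / 2 - \<tau>' + c1 * (norm \<xi>)\<^sup>2"
    define R where "R = exp (- l \<xi> + \<epsilon> * (norm \<xi>)\<^sup>2)"
    have "exp (- log_dist V x) * R \<le> exp (- log_dist V (x + \<xi>))"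
      unfolding R_def exp_add[symmetric] using ld by simp
    then have \<delta>R: "\<delta> * R \<le> infdist (x + \<xi>) (- V)"
      using exp_neg_log_dist[OF V] exp_neg_log_dist[OF V(1,2) in_V] by (simp add: \<delta>_def)
    have sR: "\<bar>s\<bar> + m * ((norm \<zeta>)\<^sup>2 + \<tau>) \<le> R"
    proof -
      have "\<bar>s\<bar> \<le> \<bar>1 - l \<xi> + (l \<xi>)\<^sup>2 / 2 - \<tau>'\<bar> + c1 * (norm \<xi>)\<^sup>2"
        unfolding s_def using c1 by (intro order_trans[OF abs_triangle_ineq]) (simp add: abs_mult)
      then have "\<bar>s\<bar> + c * ((norm \<xi>)\<^sup>2 + \<tau>') - c1 * (norm \<xi>)\<^sup>2 \<le> R"
        using jet[OF \<tau>' small'] unfolding R_def by linarith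
      moreover have "m * ((norm \<zeta>)\<^sup>2 + \<tau>) \<le> c * ((norm \<xi>)\<^sup>2 + \<tau>') - c1 * (norm \<xi>)\<^sup>2"
      proof -
        have "m * ((norm \<zeta>)\<^sup>2 + \<tau>) = m * (norm \<xi>)\<^sup>2 + m * (norm \<eta>)\<^sup>2 + m * \<tau>"
          unfolding nn by (simp add: algebra_simps)
        also have "\<dots> \<le> c1 * (norm \<xi>)\<^sup>2 + (c * c1) * (norm \<eta>)\<^sup>2 + c * \<tau>"
          using m \<tau> by (intro add_mono mult_right_mono) auto
        also have "\<dots> \<le> c1 * (norm \<xi>)\<^sup>2 + c * \<tau>'"
          unfolding \<tau>'_def using c by (simp add: algebra_simps)
        also have "\<dots> = c * ((norm \<xi>)\<^sup>2 + \<tau>') - c1 * (norm \<xi>)\<^sup>2"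
          by (simp add: c1_def algebra_simps)
        finally show ?thesis .
      qed
      ultimately show ?thesis by linarith
    qed
    have eq: "x + \<delta> *\<^sub>R v + Re_vec (\<zeta> - (of_real \<delta> * complexify l \<zeta>) *s of_real_vec v) +
        Re_vec ((of_real \<delta> * (complexify l \<zeta> * complexify l \<zeta> / 2 + of_real c1 * dot \<zeta> \<zeta>)) *s of_real_vec v)
        + \<tau> *\<^sub>R (- \<delta> *\<^sub>R v) = x + \<xi> + (\<delta> * s) *\<^sub>R v"
    proof -
      have e1: "Re_vec (\<zeta> - (of_real \<delta> * complexify l \<zeta>) *s of_real_vec v) = \<xi> - (\<delta> * l \<xi>) *\<^sub>R v"
        by (simp add: complexify_def \<xi>_def)
      have "Re (complexify l \<zeta> * complexify l \<zeta> / 2 + of_real c1 * dot \<zeta> \<zeta>) =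
          ((l \<xi>)\<^sup>2 - (l \<eta>)\<^sup>2) / 2 + c1 * ((norm \<xi>)\<^sup>2 - (norm \<eta>)\<^sup>2)"
        by (simp add: complexify_def \<xi>_def \<eta>_def Re_dot_self power2_eq_square)
      then have e2: "Re_vec ((of_real \<delta> * (complexify l \<zeta> * complexify l \<zeta> / 2 + of_real c1 * dot \<zeta> \<zeta>)) *s of_real_vec v) =
          (\<delta> * (((l \<xi>)\<^sup>2 - (l \<eta>)\<^sup>2) / 2 + c1 * ((norm \<xi>)\<^sup>2 - (norm \<eta>)\<^sup>2))) *\<^sub>R v"
        by (simp only: Re_vec_simps Im_vec_simps Re_complex_of_real Im_complex_of_real times_complex.sel) simp
      have e3: "\<delta> *\<^sub>R v + (\<xi> - (\<delta> * l \<xi>) *\<^sub>R v) +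
          (\<delta> * (((l \<xi>)\<^sup>2 - (l \<eta>)\<^sup>2) / 2 + c1 * ((norm \<xi>)\<^sup>2 - (norm \<eta>)\<^sup>2))) *\<^sub>R v + \<tau> *\<^sub>R (- \<delta> *\<^sub>R v) =
          \<xi> + (\<delta> - \<delta> * l \<xi> + \<delta> * (((l \<xi>)\<^sup>2 - (l \<eta>)\<^sup>2) / 2 + c1 * ((norm \<xi>)\<^sup>2 - (norm \<eta>)\<^sup>2)) - \<tau> * \<delta>) *\<^sub>R v"
        by (simp add: scaleR_add_left scaleR_diff_left)
      have e4: "\<delta> - \<delta> * l \<xi> + \<delta> * (((l \<xi>)\<^sup>2 - (l \<eta>)\<^sup>2) / 2 + c1 * ((norm \<xi>)\<^sup>2 - (norm \<eta>)\<^sup>2)) - \<tau> * \<delta> = \<delta> * s"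
        by (simp add: s_def \<tau>'_def algebra_simps diff_divide_distrib)
      show ?thesis unfolding e1 e2 add.assoc[of x] e3[unfolded e4] ..
    qed
    have "ball (x + \<xi> + (\<delta> * s) *\<^sub>R v) (\<delta> * m * ((norm \<zeta>)\<^sup>2 + \<tau>)) \<subseteq> ball (x + \<xi>) (infdist (x + \<xi>) (- V))"
    proof
      fix a assume a: "a \<in> ball (x + \<xi> + (\<delta> * s) *\<^sub>R v) (\<delta> * m * ((norm \<zeta>)\<^sup>2 + \<tau>))"
      have "dist (x + \<xi>) a \<le> dist (x + \<xi>) (x + \<xi> + (\<delta> * s) *\<^sub>R v) + dist (x + \<xi> + (\<delta> * s) *\<^sub>R v) a"
        by (rule dist_triangle)
      also have "dist (x + \<xi>) (x + \<xi> + (\<delta> * s) *\<^sub>R v) = \<delta> * \<bar>s\<bar>"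
        using \<delta> v by (simp add: dist_norm abs_mult)
      also have "\<delta> * \<bar>s\<bar> + dist (x + \<xi> + (\<delta> * s) *\<^sub>R v) a < \<delta> * \<bar>s\<bar> + \<delta> * (m * ((norm \<zeta>)\<^sup>2 + \<tau>))"
        using a by (simp add: mult.assoc)
      also have "\<dots> = \<delta> * (\<bar>s\<bar> + m * ((norm \<zeta>)\<^sup>2 + \<tau>))" by (simp add: distrib_left)
      also have "\<dots> \<le> \<delta> * R" using sR \<delta> by (intro mult_left_mono) auto
      also note \<delta>R
      finally show "a \<in> ball (x + \<xi>) (infdist (x + \<xi>) (- V))" by simp
    qed
    also have "\<dots> \<subseteq> V" by (rule ball_infdist_compl)
    finally show "ball (x + \<delta> *\<^sub>R v + Re_vec (\<zeta> - (of_real \<delta> * complexify l \<zeta>) *s of_real_vec v) +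
        Re_vec ((of_real \<delta> * (complexify l \<zeta> * complexify l \<zeta> / 2 + of_real c1 * dot \<zeta> \<zeta>)) *s of_real_vec v)
        + \<tau> *\<^sub>R (- \<delta> *\<^sub>R v)) (\<delta> * m * ((norm \<zeta>)\<^sup>2 + \<tau>)) \<subseteq> V"
      unfolding eq .
  qed
qed

lemma bounded_bilinear_vecI:
  fixes B :: "complex ^ 'n \<Rightarrow> complex ^ 'n \<Rightarrow> 'b::euclidean_space"
  assumes "\<And>x y z. B (x + y) z = B x z + B y z" "\<And>x y z. B z (x + y) = B z x + B z y"
    "\<And>r x y. B (r *\<^sub>R x) y = r *\<^sub>R B x y" "\<And>r x y. B x (r *\<^sub>R y) = r *\<^sub>R B x y"
  shows "bounded_bilinear B"
  using assms unfolding bilinear_conv_bounded_bilinear[symmetric] bilinear_def linear_iff by blast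

text \<open>Over the complexified subspace \<open>P\<close> is complex linear and \<open>R\<close>
  complex bilinear. Componentwise products preserve this, so the family that
  \<open>touches_exp\<close> yields over \<open>Omega V\<close> is holomorphic.\<close>

lemma real_q_convex_set_of_q_pseudoconvex:
  fixes V :: "(real ^ 'n) set"
  assumes V: "open V" and qp: "q_pseudoconvex q (Omega V)"
  shows "real_q_convex_set q V"
proof (rule ccontr)
  assume "\<not> ?thesis"
  then obtain x S l \<epsilon> \<rho> where VU: "V \<noteq> UNIV" and x: "x \<in> V" and S: "subspace S" "dim S = q + 1"
    and l: "bounded_linear l" and \<epsilon>: "\<epsilon> > 0" and \<rho>: "\<rho> > 0" and
    le: "\<And>\<xi>. \<xi> \<in> S \<Longrightarrow> norm \<xi> \<le> \<rho> \<Longrightarrow> x + \<xi> \<in> V \<and>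
       log_dist V (x + \<xi>) \<le> log_dist V x + l \<xi> - \<epsilon> * (norm \<xi>)\<^sup>2"
    using not_real_q_convex_obtain[OF V] by metis
  obtain v where v: "norm v = 1" "x + infdist x (- V) *\<^sub>R v \<notin> V"
    using nearest_complement_point[OF V VU x] by blast
  define \<delta> where "\<delta> = infdist x (- V)"
  obtain c1 where t: "touches V (complexification S) (x + \<delta> *\<^sub>R v)
    (\<lambda>\<zeta>. Re_vec (\<zeta> - (of_real \<delta> * complexify l \<zeta>) *s of_real_vec v))
    (\<lambda>\<zeta> \<zeta>'. Re_vec ((of_real \<delta> * (complexify l \<zeta> * complexify l \<zeta>' / 2 + of_real c1 * dot \<zeta> \<zeta>')) *s of_real_vec v))
    (- \<delta> *\<^sub>R v)"
    using tube_touches[OF V VU x v l \<epsilon> \<rho> le] unfolding \<delta>_def by blast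
  note lin = complexify_linear[OF bounded_linear.linear[OF l]]
  define P where "P \<zeta> = \<zeta> - (of_real \<delta> * complexify l \<zeta>) *s of_real_vec v" for \<zeta>
  define R where "R \<zeta> \<zeta>' = (of_real \<delta> * (complexify l \<zeta> * complexify l \<zeta>' / 2 + of_real c1 * dot \<zeta> \<zeta>')) *s of_real_vec v" for \<zeta> \<zeta>'
  have P: "P (\<zeta> + \<zeta>') = P \<zeta> + P \<zeta>'" "P (c *s \<zeta>) = c *s P \<zeta>" for c \<zeta> \<zeta>'
    by (simp_all add: P_def lin vec_eq_iff algebra_simps)
  have R: "R (\<zeta> + \<zeta>') \<zeta>'' = R \<zeta> \<zeta>'' + R \<zeta>' \<zeta>''" "R \<zeta>'' (\<zeta> + \<zeta>') = R \<zeta>'' \<zeta> + R \<zeta>'' \<zeta>'"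
    "R (c *s \<zeta>) \<zeta>' = c *s R \<zeta> \<zeta>'" "R \<zeta> (c *s \<zeta>') = c *s R \<zeta> \<zeta>'" for c \<zeta> \<zeta>' \<zeta>''
    by (simp_all add: R_def lin dot_bilinear vec_eq_iff algebra_simps add_divide_distrib)
  have bP: "bounded_linear P"
    by (rule bounded_linear_of_complex_linear) (simp add: complex_linear_iff P)
  have bR: "bounded_bilinear R"
    by (rule bounded_bilinear_vecI) (simp_all add: R scaleR_eq_vector_scalar_mult)
  define y where "y = (of_real_vec (x + \<delta> *\<^sub>R v) :: complex ^ 'n)"
  define A where "A \<zeta> = exp_vec y * P \<zeta>" for \<zeta>
  define Q where "Q \<zeta> \<zeta>' = exp_vec y * (R \<zeta> \<zeta>' + (1/2) *\<^sub>R (P \<zeta> * P \<zeta>'))" for \<zeta> \<zeta>'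
  have "touches V (complexification S) (Re_vec y) (\<lambda>\<zeta>. Re_vec (P \<zeta>)) (\<lambda>\<zeta> \<zeta>'. Re_vec (R \<zeta> \<zeta>')) (Re_vec (of_real_vec (- \<delta> *\<^sub>R v)))"
    using t unfolding P_def R_def y_def by (simp only: Re_vec_simps)
  then have t': "touches (Omega V) (complexification S) (exp_vec y) A Q (exp_vec y * of_real_vec (- \<delta> *\<^sub>R v))"
    unfolding touches_exp[OF bP bR] A_def Q_def .
  have cm: "a * (c *s b) = c *s (a * b)" "(c *s b) * a = c *s (b * a)" for a b :: "complex ^ 'n" and c
    by (simp_all add: vec_eq_iff)
  have cr: "r *\<^sub>R (c *s b) = c *s (r *\<^sub>R b)" for b :: "complex ^ 'n" and c r
    by (simp add: vec_eq_iff)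
  have A: "A (\<zeta> + \<zeta>') = A \<zeta> + A \<zeta>'" "A (c *s \<zeta>) = c *s A \<zeta>" for c \<zeta> \<zeta>'
    by (simp_all add: A_def P cm distrib_left)
  have Q: "Q (\<zeta> + \<zeta>') \<zeta>'' = Q \<zeta> \<zeta>'' + Q \<zeta>' \<zeta>''" "Q \<zeta>'' (\<zeta> + \<zeta>') = Q \<zeta>'' \<zeta> + Q \<zeta>'' \<zeta>'"
    "Q (c *s \<zeta>) \<zeta>' = c *s Q \<zeta> \<zeta>'" "Q \<zeta> (c *s \<zeta>') = c *s Q \<zeta> \<zeta>'" for c \<zeta> \<zeta>' \<zeta>''
    by (simp_all add: Q_def P R cm cr distrib_left distrib_right scaleR_add_right vec.scale_right_distrib)
  have "\<not> q_pseudoconvex q (Omega V)"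
  proof (rule not_q_pseudoconvex_of_touches[OF t'])
    show "bounded_linear A" by (rule bounded_linear_of_complex_linear) (simp add: complex_linear_iff A)
    show "bounded_bilinear Q"
      by (rule bounded_bilinear_vecI) (simp_all add: Q scaleR_eq_vector_scalar_mult)
  qed (use V S A Q in \<open>simp_all add: open_Omega subspace_complexification dim_complexification\<close>)
  then show False using qp by simp
qed

text \<open>\<open>H\<close> is only real bilinear, so the family need not be holomorphic. What
  passes through the logarithm is the sign change of the quadratic part under multiplication by
  \<i>, and this is the form in which \<open>not_real_q_convex_of_touches\<close> asks for
  it.\<close>

lemma q_pseudoconvex_of_real_q_convex_set:
  fixes V :: "(real ^ 'n) set"
  assumes V: "open V" and qc: "real_q_convex_set q V"
  shows "q_pseudoconvex q (Omega V)"
proof (rule ccontr)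
  assume "\<not> ?thesis"
  then obtain z S l H \<epsilon> \<rho> where WU: "Omega V \<noteq> UNIV" and z: "z \<in> Omega V"
    and S: "vec.subspace S" "vec.dim S = q + 1" and l: "bounded_linear l"
    and H: "bounded_bilinear H" "\<And>\<zeta>. H (\<i> *s \<zeta>) (\<i> *s \<zeta>) = - H \<zeta> \<zeta>"
    and \<epsilon>: "\<epsilon> > 0" and \<rho>: "\<rho> > 0" and
    le: "\<And>\<zeta>. \<zeta> \<in> S \<Longrightarrow> norm \<zeta> \<le> \<rho> \<Longrightarrow> z + \<zeta> \<in> Omega V \<and>
       log_dist (Omega V) (z + \<zeta>) \<le> log_dist (Omega V) z + l \<zeta> + H \<zeta> \<zeta> - \<epsilon> * (norm \<zeta>)\<^sup>2"
    using not_q_pseudoconvex_obtain[OF open_Omega[OF V], of q] by metis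
  interpret H: bounded_bilinear H by fact
  have W: "open (Omega V)" by (rule open_Omega[OF V])
  obtain v where v: "norm v = 1" "z + infdist z (- Omega V) *\<^sub>R v \<notin> Omega V"
    using nearest_complement_point[OF W WU z] by blast
  obtain \<eta> where \<eta>: "\<eta> \<in> S" "\<eta> \<noteq> 0"
  proof -
    have "\<not> S \<subseteq> {0}"
    proof
      assume "S \<subseteq> {0}"
      then have "S = {0}" using vec.subspace_0[OF S(1)] by blast
      then show False using S(2) by simp
    qed
    then show thesis using that by blast
  qed
  define \<delta> where "\<delta> = infdist z (- Omega V)"
  define f where "f \<zeta> = Complex (l \<zeta>) (- l (\<i> *s \<zeta>))" for \<zeta>
  have f: "bounded_linear f" "\<And>\<zeta>. f (\<i> *s \<zeta>) = \<i> * f \<zeta>" "\<And>\<zeta>. Re (f \<zeta>) = l \<zeta>"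
    using complex_linear_of_Re[OF l] unfolding f_def by blast+
  interpret f: bounded_linear f by fact
  define w where "w = z + \<delta> *\<^sub>R v"
  have w0: "w $ j \<noteq> 0" for j
    using nearest_point_Omega_nonzero[OF V z v(1) S(1) \<eta> l H \<epsilon> \<rho> le] by (simp add: w_def \<delta>_def)
  define A where "A \<zeta> = \<zeta> - (of_real \<delta> * f \<zeta>) *s v" for \<zeta>
  define g where "g \<zeta> \<zeta>' = f \<zeta> * f \<zeta>' / 2 - of_real (H \<zeta> \<zeta>')" for \<zeta> \<zeta>'
  define Q where "Q \<zeta> \<zeta>' = (of_real \<delta> * g \<zeta> \<zeta>') *s v" for \<zeta> \<zeta>'
  have "touches (Omega V) S w A Q (- \<delta> *\<^sub>R v)"
    unfolding A_def Q_def g_def w_def \<delta>_def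
    by (rule touches_of_log_dist_bound[OF W WU z v f(1) H(1) \<epsilon> \<rho>]) (use le f(3) in auto)
  \<comment> \<open>Any logarithm would do: the branch affects neither \<open>exp_vec y\<close> nor
    \<open>Re_vec y\<close>.\<close>
  define y where "y = (\<chi> j. Ln (w $ j))"
  have y: "exp_vec y = w" using w0 by (simp add: exp_vec_def y_def vec_eq_iff)
  define u where "u = (\<chi> j. 1 / w $ j)"
  have wu: "w * (u * a) = a" for a using w0 by (simp add: u_def vec_eq_iff)
  \<comment> \<open>\<open>P\<close> and \<open>R\<close> are solved from the requirement that
    \<open>touches_exp\<close> gives back \<open>A\<close> and \<open>Q\<close>.\<close>
  define P where "P \<zeta> = u * A \<zeta>" for \<zeta>
  define R where "R \<zeta> \<zeta>' = u * Q \<zeta> \<zeta>' - (1/2) *\<^sub>R (P \<zeta> * P \<zeta>')" for \<zeta> \<zeta>'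
  have P: "P (\<zeta> + \<zeta>') = P \<zeta> + P \<zeta>'" "P (r *\<^sub>R \<zeta>) = r *\<^sub>R P \<zeta>" "P (\<i> *s \<zeta>) = \<i> *s P \<zeta>" for r \<zeta> \<zeta>'
    by (simp_all add: P_def A_def f.add f.scaleR f(2) vec_eq_iff algebra_simps)
  have g: "g (\<zeta> + \<zeta>') \<zeta>'' = g \<zeta> \<zeta>'' + g \<zeta>' \<zeta>''" "g \<zeta>'' (\<zeta> + \<zeta>') = g \<zeta>'' \<zeta> + g \<zeta>'' \<zeta>'"
    "g (r *\<^sub>R \<zeta>) \<zeta>' = r *\<^sub>R g \<zeta> \<zeta>'" "g \<zeta> (r *\<^sub>R \<zeta>') = r *\<^sub>R g \<zeta> \<zeta>'" "g (\<i> *s \<zeta>) (\<i> *s \<zeta>) = - g \<zeta> \<zeta>" for r \<zeta> \<zeta>' \<zeta>''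
    unfolding g_def f.scaleR H.scaleR_left H.scaleR_right f(2) H(2) f.add H.add_left H.add_right
    by (simp_all add: algebra_simps add_divide_distrib scaleR_conv_of_real)
  have Q: "Q (\<zeta> + \<zeta>') \<zeta>'' = Q \<zeta> \<zeta>'' + Q \<zeta>' \<zeta>''" "Q \<zeta>'' (\<zeta> + \<zeta>') = Q \<zeta>'' \<zeta> + Q \<zeta>'' \<zeta>'"
    "Q (r *\<^sub>R \<zeta>) \<zeta>' = r *\<^sub>R Q \<zeta> \<zeta>'" "Q \<zeta> (r *\<^sub>R \<zeta>') = r *\<^sub>R Q \<zeta> \<zeta>'" "Q (\<i> *s \<zeta>) (\<i> *s \<zeta>) = - Q \<zeta> \<zeta>" for r \<zeta> \<zeta>' \<zeta>''
    by (simp_all add: Q_def g vec_eq_iff algebra_simps)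
  have cm: "a * (r *\<^sub>R b) = r *\<^sub>R (a * b)" "(r *\<^sub>R b) * a = r *\<^sub>R (b * a)" for a b :: "complex ^ 'n" and r
    by (simp_all add: vec_eq_iff)
  have im: "(\<i> *s a) * (\<i> *s b) = - (a * b)" for a b :: "complex ^ 'n"
    by (simp add: vec_eq_iff complex_eq_iff algebra_simps)
  have R: "R (\<zeta> + \<zeta>') \<zeta>'' = R \<zeta> \<zeta>'' + R \<zeta>' \<zeta>''" "R \<zeta>'' (\<zeta> + \<zeta>') = R \<zeta>'' \<zeta> + R \<zeta>'' \<zeta>'"
    "R (r *\<^sub>R \<zeta>) \<zeta>' = r *\<^sub>R R \<zeta> \<zeta>'" "R \<zeta> (r *\<^sub>R \<zeta>') = r *\<^sub>R R \<zeta> \<zeta>'" "R (\<i> *s \<zeta>) (\<i> *s \<zeta>) = - R \<zeta> \<zeta>" for r \<zeta> \<zeta>' \<zeta>''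
    by (simp_all add: R_def P Q cm im distrib_left distrib_right scaleR_add_right scaleR_diff_right scaleR_left_commute)
  have bP: "bounded_linear P"
    unfolding linear_conv_bounded_linear[symmetric] by (rule linearI) (simp_all add: P)
  have bR: "bounded_bilinear R" by (rule bounded_bilinear_vecI) (simp_all add: R)
  have "(\<lambda>\<zeta>. exp_vec y * P \<zeta>) = A" by (simp add: y P_def wu)
  moreover have "(\<lambda>\<zeta> \<zeta>'. exp_vec y * (R \<zeta> \<zeta>' + (1/2) *\<^sub>R (P \<zeta> * P \<zeta>'))) = Q" by (simp add: y R_def wu)
  moreover have "exp_vec y * (u * (- \<delta> *\<^sub>R v)) = - \<delta> *\<^sub>R v" by (simp only: y wu)
  ultimately have t: "touches V S (Re_vec y) (\<lambda>\<zeta>. Re_vec (P \<zeta>)) (\<lambda>\<zeta> \<zeta>'. Re_vec (R \<zeta> \<zeta>')) (Re_vec (u * (- \<delta> *\<^sub>R v)))"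
    using \<open>touches (Omega V) S w A Q (- \<delta> *\<^sub>R v)\<close> unfolding touches_exp[OF bP bR] y by (simp add: wu)
  have "\<not> real_q_convex_set q V"
  proof (rule not_real_q_convex_of_touches[OF t V S])
    show "bounded_linear (\<lambda>\<zeta>. Re_vec (P \<zeta>))"
      unfolding linear_conv_bounded_linear[symmetric] by (rule linearI) (simp_all add: P)
    show "bounded_bilinear (\<lambda>\<zeta> \<zeta>'. Re_vec (R \<zeta> \<zeta>'))"
      by (rule bounded_bilinear_vecI) (simp_all add: R)
    show "Re_vec (R (\<i> *s \<zeta>) (\<i> *s \<zeta>)) = - Re_vec (R \<zeta> \<zeta>)" for \<zeta>
      by (simp add: R linear_neg[OF linear_Re_vec])
  qed
  then show False using qc by simp
qed

theorem corollary5p18: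
  fixes V :: "(real ^ 'n) set" and q :: nat
  assumes "q < CARD('n)" and "open V"
  shows "real_q_convex_set q V \<longleftrightarrow> q_pseudoconvex q (Omega V)"
  using real_q_convex_set_of_q_pseudoconvex[OF assms(2)] q_pseudoconvex_of_real_q_convex_set[OF assms(2)]
  by blast

end
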